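(* Let $p\ge 3$ be the dimension of the Euclidean space, let $\alpha_1,\alpha_2,\alpha_3$ be real constants with $0<2\alpha_j<1$ ($j=1,2,3$), let $\lambda$ be a real or purely imaginary constant, and put $\alpha=\alpha_1+\alpha_2+\alpha_3-1+\frac p2$. Let $x=(x_1,\dots,x_p)$ be any point and $x_0=(x_{01},\dots,x_{0p})$ any fixed point of $R_p^{3+}=\{(x_1,\dots,x_p): x_1>0,\ x_2>0,\ x_3>0\}$, and let $q_1,\dots,q_8$ be the fundamental solutions, given in the context, of $$\sum_{i=1}^p u_{x_ix_i}+\frac{2\alpha_1}{x_1}u_{x_1}+\frac{2\alpha_2}{x_2}u_{x_2}+\frac{2\alpha_3}{x_3}u_{x_3}-\lambda^2u=0 .$$ Then $q_1$ can be written as $$q_1(x,x_0)=r^{2-p}\,r_1^{-2\alpha_1}r_2^{-2\alpha_2}r_3^{-2\alpha_3}\,f(r^2,r_1^2,r_2^2,r_3^2),$$ where $$f(r^2,r_1^2,r_2^2,r_3^2)=k_1\sum_{l,m,n,s=0}^\infty\ \sum_{q=0}^s\ \sum_{\substack{i,j,k\ge0\\ i+j+k=s}}A(s,q)\,s!\,\binom sq\,\frac{(\alpha)_{l+m+n+s}(\alpha_1)_{i+l+m}(\alpha_2)_{j+l+n}(\alpha_3)_{k+m+n}}{(\alpha)_s(1-\alpha)_q(2\alpha_1)_{i+l+m}(2\alpha_2)_{j+l+n}(2\alpha_3)_{k+m+n}\,i!\,j!\,k!\,n!\,m!\,l!\,q!}$$ $$\times\Big(1-\frac{r^2}{r_1^2}\Big)^{i+l+m}\Big(1-\frac{r^2}{r_2^2}\Big)^{j+l+n}\Big(1-\frac{r^2}{r_3^2}\Big)^{k+m+n}\Big(\frac12\lambda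 r\Big)^{2q}$$ $$\times F\Big(2\alpha_1-\alpha-j-k,\,\alpha_1+i+l+m;\,2\alpha_1+i+l+m;\,1-\frac{r^2}{r_1^2}\Big)$$ $$\times F\Big(2\alpha_2-\alpha-i-k-m,\,\alpha_2+j+l+n;\,2\alpha_2+j+l+n;\,1-\frac{r^2}{r_2^2}\Big)$$ $$\times F\Big(2\alpha_3-\alpha-i-j-l,\,\alpha_3+k+m+n;\,2\alpha_3+k+m+n;\,1-\frac{r^2}{r_3^2}\Big)\;{}_0F_1\Big(1-\alpha+q;\,\frac14\lambda^2r^2\Big),$$ $$k_1=\frac{4^{\alpha_1+\alpha_2+\alpha_3-1}\,\Gamma(\alpha)\Gamma(\alpha_1)\Gamma(\alpha_2)\Gamma(\alpha_3)}{\pi^{p/2}\,\Gamma(2\alpha_1)\Gamma(2\alpha_2)\Gamma(2\alpha_3)},$$ and $$f(0,r_{10}^2,r_{20}^2,r_{30}^2)=\frac{4^{\alpha_1+\alpha_2+\alpha_3-1}}{\pi^{p/2}}\,\Gamma\!\left(\frac{p-2}{2}\right),\qquad p>2,$$ where $r_{k0}^2$ is the value of $r_k^2$ at $x=x_0$. Consequently $q_1(x,x_0)$ goes to infinity with order $r^{2-p}$ as $r\to0$. Likewise the solutions $q_i(x,x_0)$, $i=2,3,\dots,8$, also go to infinity with order $r^{2-p}$ as $r\to0$.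
   Context: The Pochhammer symbol is $(\kappa)_m=\Gamma(\kappa+m)/\Gamma(\kappa)$ for an integer $m$, where $\kappa\ne0,-1,-2,\dots$ if $(\kappa)_m$ stands in a denominator. The confluent hypergeometric function of four variables is $$\mathrm H_{4,3}^0(a,b_1,b_2,b_3;d_1,d_2,d_3;x,y,z,t)=\sum_{m,n,k,l=0}^\infty\frac{(a)_{m+n+k-l}(b_1)_m(b_2)_n(b_3)_k}{(d_1)_m(d_2)_n(d_3)_k\,m!\,n!\,k!\,l!}\,x^my^nz^kt^l,\qquad |x|+|y|+|z|<1.$$ $F(a,b;c;x)=\sum_{n\ge0}\frac{(a)_n(b)_n}{(c)_n\,n!}x^n$ is the Gauss hypergeometric function and ${}_0F_1(a;x)=\sum_{n\ge0}\frac{x^n}{(a)_n\,n!}$. The numbers $A(s,q)$ are $A(0,0)=1$ and $A(s,q)=q/s$ for $s\ge1$, $q\ge0$. Put $$r^2=\sum_{i=1}^p (x_i-x_{0i})^2,\qquad r_k^2=(x_k+x_{0k})^2+\sum_{i=1,\,i\ne k}^p (x_i-x_{0i})^2,\qquad \sigma_k=\frac{r^2-r_k^2}{r^2}=-\frac{4x_kx_{0k}}{r^2}\quad(k=1,2,3),$$ $$\sigma_4=-\frac14\lambda^2r^2,\qquad \sigma=(\sigma_1,\sigma_2,\sigma_3,\sigma_4).$$ The functions $q_i=q_i(x,x_0)$, with $k_1$ as in the claim and constants $k_2,\dots,k_8$ (to be determined when solving boundary value problems for the equation), are $$q_1=k_1(r^2)^{-\alpha}\,\mathrm H_{4,3}^0(\alpha,\alpha_1,\alpha_2,\alpha_3;2\alpha_1,2\alpha_2,2\alpha_3;\sigma),$$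 $$q_2=k_2(r^2)^{2\alpha_1-\alpha-1}(x_1x_{01})^{1-2\alpha_1}\,\mathrm H_{4,3}^0(1+\alpha-2\alpha_1,1-\alpha_1,\alpha_2,\alpha_3;2-2\alpha_1,2\alpha_2,2\alpha_3;\sigma),$$ $$q_3=k_3(r^2)^{2\alpha_2-\alpha-1}(x_2x_{02})^{1-2\alpha_2}\,\mathrm H_{4,3}^0(1+\alpha-2\alpha_2,\alpha_1,1-\alpha_2,\alpha_3;2\alpha_1,2-2\alpha_2,2\alpha_3;\sigma),$$ $$q_4=k_4(r^2)^{2\alpha_3-\alpha-1}(x_3x_{03})^{1-2\alpha_3}\,\mathrm H_{4,3}^0(1+\alpha-2\alpha_3,\alpha_1,\alpha_2,1-\alpha_3;2\alpha_1,2\alpha_2,2-2\alpha_3;\sigma),$$ $$q_5=k_5(r^2)^{2\alpha_1+2\alpha_2-\alpha-2}(x_1x_{01})^{1-2\alpha_1}(x_2x_{02})^{1-2\alpha_2}\,\mathrm H_{4,3}^0(2+\alpha-2\alpha_1-2\alpha_2,1-\alpha_1,1-\alpha_2,\alpha_3;2-2\alpha_1,2-2\alpha_2,2\alpha_3;\sigma),$$ $$q_6=k_6(r^2)^{2\alpha_1+2\alpha_3-\alpha-2}(x_1x_{01})^{1-2\alpha_1}(x_3x_{03})^{1-2\alpha_3}\,\mathrm H_{4,3}^0(2+\alpha-2\alpha_1-2\alpha_3,1-\alpha_1,\alpha_2,1-\alpha_3;2-2\alpha_1,2\alpha_2,2-2\alpha_3;\sigma),$$ $$q_7=k_7(r^2)^{2\alpha_2+2\alpha_3-\alpha-2}(x_2x_{02})^{1-2\alpha_2}(x_3x_{03})^{1-2\alpha_3}\,\mathrm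 H_{4,3}^0(2+\alpha-2\alpha_2-2\alpha_3,\alpha_1,1-\alpha_2,1-\alpha_3;2\alpha_1,2-2\alpha_2,2-2\alpha_3;\sigma),$$ $$q_8=k_8(r^2)^{2\alpha_1+2\alpha_2+2\alpha_3-\alpha-3}(x_1x_{01})^{1-2\alpha_1}(x_2x_{02})^{1-2\alpha_2}(x_3x_{03})^{1-2\alpha_3}\,\mathrm H_{4,3}^0(3+\alpha-2\alpha_1-2\alpha_2-2\alpha_3,1-\alpha_1,1-\alpha_2,1-\alpha_3;2-2\alpha_1,2-2\alpha_2,2-2\alpha_3;\sigma).$$ *)

theory Defs
  imports "HOL-Complex_Analysis.Complex_Analysis"
begin

section \<open>Hypergeometric functions\<close>

text \<open>
  The shifted factorial for an arbitrary integer index. For nonnegative indices this is the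
  library's \<^const>\<open>pochhammer\<close>, which also covers the numerator parameters
  \<open>0, -1, -2, \<dots>\<close>, where the quotient of Gamma values is not defined.
\<close>

definition poch :: "'a::Gamma \<Rightarrow> int \<Rightarrow> 'a" where
  "poch \<kappa> m = (if m \<ge> 0 then pochhammer \<kappa> (nat m) else Gamma (\<kappa> + of_int m) / Gamma \<kappa>)"

lemma poch_eq_Gamma:
  assumes "\<kappa> \<notin> \<int>\<^sub>\<le>\<^sub>0"
  shows "poch \<kappa> m = Gamma (\<kappa> + of_int m) / Gamma \<kappa>"
  using assms pochhammer_Gamma[OF assms, of "nat m"] by (auto simp: poch_def)

definition gauss_F :: "real \<Rightarrow> real \<Rightarrow> real \<Rightarrow> real \<Rightarrow> real" where
  "gauss_F a b c x =
     (\<Sum>n. pochhammer a n * pochhammer b n / (pochhammer c n * fact n) * x ^ n)"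

definition hyp_0F1 :: "real \<Rightarrow> complex \<Rightarrow> complex" where
  "hyp_0F1 a x = (\<Sum>n. x ^ n / (of_real (pochhammer a n) * fact n))"

definition H430_series ::
  "real \<Rightarrow> real \<Rightarrow> real \<Rightarrow> real \<Rightarrow> real \<Rightarrow> real \<Rightarrow> real \<Rightarrow>
   complex \<Rightarrow> complex \<Rightarrow> complex \<Rightarrow> complex \<Rightarrow> complex" where
  "H430_series a b1 b2 b3 d1 d2 d3 x y z t =
     (\<Sum>\<^sub>\<infinity>(m, n, k, l)\<in>(UNIV :: (nat \<times> nat \<times> nat \<times> nat) set).
        of_real (poch a (int m + int n + int k - int l)
                   * pochhammer b1 m * pochhammer b2 n * pochhammer b3 k
                 / (pochhammer d1 m * pochhammer d2 n * pochhammer d3 k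
                   * fact m * fact n * fact k * fact l))
        * x ^ m * y ^ n * z ^ k * t ^ l)"

text \<open>
  The series converges for \<open>\<bar>x\<bar> + \<bar>y\<bar> + \<bar>z\<bar> < 1\<close> only, whereas \<open>\<sigma>\<^sub>1, \<sigma>\<^sub>2, \<sigma>\<^sub>3 \<longlonglongrightarrow> -\<infinity>\<close> as
  \<open>r \<longlonglongrightarrow> 0\<close>, so the function H has to be understood as the analytic continuation of the
  series. It is continued along the segment from \<open>(0, 0, 0, t)\<close> to \<open>(x, y, z, t)\<close>, i.e.
  \<open>s \<mapsto> H (s x, s y, s z, t)\<close> is continued from a neighbourhood of \<open>s = 0\<close> to \<open>s = 1\<close>.
\<close>

definition H430_continues_to ::
  "real \<Rightarrow> real \<Rightarrow> real \<Rightarrow> real \<Rightarrow> real \<Rightarrow> real \<Rightarrow> real \<Rightarrow>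
   complex \<Rightarrow> complex \<Rightarrow> complex \<Rightarrow> complex \<Rightarrow> complex \<Rightarrow> bool" where
  "H430_continues_to a b1 b2 b3 d1 d2 d3 x y z t w \<longleftrightarrow>
     (\<exists>S g. open S \<and> closed_segment 0 1 \<subseteq> S \<and> g holomorphic_on S \<and>
        (\<forall>\<^sub>F s in nhds 0. g s = H430_series a b1 b2 b3 d1 d2 d3 (s * x) (s * y) (s * z) t) \<and>
        g 1 = w)"

definition H430 ::
  "real \<Rightarrow> real \<Rightarrow> real \<Rightarrow> real \<Rightarrow> real \<Rightarrow> real \<Rightarrow> real \<Rightarrow>
   complex \<Rightarrow> complex \<Rightarrow> complex \<Rightarrow> complex \<Rightarrow> complex" where
  "H430 a b1 b2 b3 d1 d2 d3 x y z t = (THE w. H430_continues_to a b1 b2 b3 d1 d2 d3 x y z t w)"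

lemma H430_continues_to_unique:
  assumes "H430_continues_to a b1 b2 b3 d1 d2 d3 x y z t w"
    and "H430_continues_to a b1 b2 b3 d1 d2 d3 x y z t w'"
  shows "w = w'"
proof -
  let ?h = "\<lambda>s. H430_series a b1 b2 b3 d1 d2 d3 (s * x) (s * y) (s * z) t"
  obtain S g where S: "open S" "closed_segment 0 1 \<subseteq> S" "g holomorphic_on S"
      "\<forall>\<^sub>F s in nhds 0. g s = ?h s" "g 1 = w"
    using assms(1) unfolding H430_continues_to_def by blast
  obtain S' g' where S': "open S'" "closed_segment 0 1 \<subseteq> S'" "g' holomorphic_on S'"
      "\<forall>\<^sub>F s in nhds 0. g' s = ?h s" "g' 1 = w'"
    using assms(2) unfolding H430_continues_to_def by blast
  have "\<forall>\<^sub>F s in nhds 0. g s = g' s"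
    using S(4) S'(4) by eventually_elim simp
  then obtain U where U: "open U" "0 \<in> U" "\<And>s. s \<in> U \<Longrightarrow> g s = g' s"
    unfolding eventually_nhds by blast
  define T where "T = connected_component_set (S \<inter> S') 0"
  have oT: "open T" unfolding T_def using S(1) S'(1) by (intro open_connected_component) auto
  have cT: "connected T" unfolding T_def by simp
  have sub: "T \<subseteq> S \<inter> S'" unfolding T_def by (rule connected_component_subset)
  have seg: "closed_segment 0 1 \<subseteq> T"
    unfolding T_def using S(2) S'(2) by (intro connected_component_maximal) auto
  hence mem: "0 \<in> T" "1 \<in> T" by auto
  have "g 1 = g' 1"
  proof (rule analytic_continuation_open[of "U \<inter> T" T g g'])
    show "open (U \<inter> T)" using U(1) oT by auto
    show "U \<inter> T \<noteq> {}" using U(2) mem by auto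
    show "g holomorphic_on T" "g' holomorphic_on T"
      using S(3) S'(3) sub by (meson holomorphic_on_subset le_inf_iff)+
  qed (use oT cT U mem in auto)
  thus ?thesis using S(5) S'(5) by simp
qed

lemma H430_eqI:
  assumes "H430_continues_to a b1 b2 b3 d1 d2 d3 x y z t w"
  shows "H430 a b1 b2 b3 d1 d2 d3 x y z t = w"
  unfolding H430_def using assms H430_continues_to_unique by (intro the_equality) blast+


section \<open>The geometry\<close>

text \<open>
  \<open>e 1, e 2, e 3\<close> are the three distinguished coordinates; the numbering of the remaining
  coordinates of the space \<open>real ^ 'p\<close> is immaterial.
\<close>

definition Rp3 :: "(nat \<Rightarrow> 'p::finite) \<Rightarrow> (real ^ 'p) set" where
  "Rp3 e = {x. x $ e 1 > 0 \<and> x $ e 2 > 0 \<and> x $ e 3 > 0}"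

definition rsq :: "real ^ 'p::finite \<Rightarrow> real ^ 'p \<Rightarrow> real" where
  "rsq x x0 = (\<Sum>i\<in>UNIV. (x $ i - x0 $ i)\<^sup>2)"

definition rsqk :: "(nat \<Rightarrow> 'p::finite) \<Rightarrow> nat \<Rightarrow> real ^ 'p \<Rightarrow> real ^ 'p \<Rightarrow> real" where
  "rsqk e j x x0 = (x $ e j + x0 $ e j)\<^sup>2 + (\<Sum>i\<in>UNIV - {e j}. (x $ i - x0 $ i)\<^sup>2)"

definition sig :: "(nat \<Rightarrow> 'p::finite) \<Rightarrow> nat \<Rightarrow> real ^ 'p \<Rightarrow> real ^ 'p \<Rightarrow> real" where
  "sig e j x x0 = (rsq x x0 - rsqk e j x x0) / rsq x x0"

definition sig4 :: "complex \<Rightarrow> real ^ 'p::finite \<Rightarrow> real ^ 'p \<Rightarrow> complex" where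
  "sig4 lam x x0 = - (1/4) * lam\<^sup>2 * of_real (rsq x x0)"

lemma sig_eq:
  "sig e j x x0 = - (4 * x $ e j * x0 $ e j) / rsq x x0"
proof -
  have "rsq x x0 = (x $ e j - x0 $ e j)\<^sup>2 + (\<Sum>i\<in>UNIV - {e j}. (x $ i - x0 $ i)\<^sup>2)"
    unfolding rsq_def by (subst sum.remove[of _ "e j"]) auto
  hence "rsq x x0 - rsqk e j x x0 = - (4 * x $ e j * x0 $ e j)"
    unfolding rsqk_def by (simp add: power2_eq_square algebra_simps)
  thus ?thesis unfolding sig_def by simp
qed


section \<open>The eight solutions\<close>

definition alpha_tot :: "nat \<Rightarrow> (nat \<Rightarrow> real) \<Rightarrow> real" where
  "alpha_tot p \<alpha> = \<alpha> 1 + \<alpha> 2 + \<alpha> 3 - 1 + real p / 2"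

definition k_one :: "nat \<Rightarrow> (nat \<Rightarrow> real) \<Rightarrow> real" where
  "k_one p \<alpha> = 4 powr (\<alpha> 1 + \<alpha> 2 + \<alpha> 3 - 1)
     * Gamma (alpha_tot p \<alpha>) * Gamma (\<alpha> 1) * Gamma (\<alpha> 2) * Gamma (\<alpha> 3)
     / (pi powr (real p / 2) * Gamma (2 * \<alpha> 1) * Gamma (2 * \<alpha> 2) * Gamma (2 * \<alpha> 3))"

definition H_sig ::
  "(nat \<Rightarrow> 'p::finite) \<Rightarrow> complex \<Rightarrow> real ^ 'p \<Rightarrow> real ^ 'p \<Rightarrow>
   real \<Rightarrow> real \<Rightarrow> real \<Rightarrow> real \<Rightarrow> real \<Rightarrow> real \<Rightarrow> real \<Rightarrow> complex" where
  "H_sig e lam x x0 a b1 b2 b3 d1 d2 d3 =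
     H430 a b1 b2 b3 d1 d2 d3
       (of_real (sig e 1 x x0)) (of_real (sig e 2 x x0)) (of_real (sig e 3 x x0)) (sig4 lam x x0)"

definition q1 :: "(nat \<Rightarrow> 'p::finite) \<Rightarrow> (nat \<Rightarrow> real) \<Rightarrow> complex \<Rightarrow>
    real ^ 'p \<Rightarrow> real ^ 'p \<Rightarrow> complex" where
  "q1 e \<alpha> lam x x0 = (let a = alpha_tot CARD('p) \<alpha> in
     of_real (k_one CARD('p) \<alpha>) * of_real (rsq x x0 powr (- a))
     * H_sig e lam x x0 a (\<alpha> 1) (\<alpha> 2) (\<alpha> 3) (2 * \<alpha> 1) (2 * \<alpha> 2) (2 * \<alpha> 3))"

definition q2 :: "(nat \<Rightarrow> 'p::finite) \<Rightarrow> (nat \<Rightarrow> real) \<Rightarrow> complex \<Rightarrow> complex \<Rightarrow>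
    real ^ 'p \<Rightarrow> real ^ 'p \<Rightarrow> complex" where
  "q2 e \<alpha> lam k x x0 = (let a = alpha_tot CARD('p) \<alpha> in
     k * of_real (rsq x x0 powr (2 * \<alpha> 1 - a - 1)
        * (x $ e 1 * x0 $ e 1) powr (1 - 2 * \<alpha> 1))
     * H_sig e lam x x0 (1 + a - 2 * \<alpha> 1) (1 - \<alpha> 1) (\<alpha> 2) (\<alpha> 3)
         (2 - 2 * \<alpha> 1) (2 * \<alpha> 2) (2 * \<alpha> 3))"

definition q3 :: "(nat \<Rightarrow> 'p::finite) \<Rightarrow> (nat \<Rightarrow> real) \<Rightarrow> complex \<Rightarrow> complex \<Rightarrow>
    real ^ 'p \<Rightarrow> real ^ 'p \<Rightarrow> complex" where
  "q3 e \<alpha> lam k x x0 = (let a = alpha_tot CARD('p) \<alpha> in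
     k * of_real (rsq x x0 powr (2 * \<alpha> 2 - a - 1)
        * (x $ e 2 * x0 $ e 2) powr (1 - 2 * \<alpha> 2))
     * H_sig e lam x x0 (1 + a - 2 * \<alpha> 2) (\<alpha> 1) (1 - \<alpha> 2) (\<alpha> 3)
         (2 * \<alpha> 1) (2 - 2 * \<alpha> 2) (2 * \<alpha> 3))"

definition q4 :: "(nat \<Rightarrow> 'p::finite) \<Rightarrow> (nat \<Rightarrow> real) \<Rightarrow> complex \<Rightarrow> complex \<Rightarrow>
    real ^ 'p \<Rightarrow> real ^ 'p \<Rightarrow> complex" where
  "q4 e \<alpha> lam k x x0 = (let a = alpha_tot CARD('p) \<alpha> in
     k * of_real (rsq x x0 powr (2 * \<alpha> 3 - a - 1)
        * (x $ e 3 * x0 $ e 3) powr (1 - 2 * \<alpha> 3))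
     * H_sig e lam x x0 (1 + a - 2 * \<alpha> 3) (\<alpha> 1) (\<alpha> 2) (1 - \<alpha> 3)
         (2 * \<alpha> 1) (2 * \<alpha> 2) (2 - 2 * \<alpha> 3))"

definition q5 :: "(nat \<Rightarrow> 'p::finite) \<Rightarrow> (nat \<Rightarrow> real) \<Rightarrow> complex \<Rightarrow> complex \<Rightarrow>
    real ^ 'p \<Rightarrow> real ^ 'p \<Rightarrow> complex" where
  "q5 e \<alpha> lam k x x0 = (let a = alpha_tot CARD('p) \<alpha> in
     k * of_real (rsq x x0 powr (2 * \<alpha> 1 + 2 * \<alpha> 2 - a - 2)
        * (x $ e 1 * x0 $ e 1) powr (1 - 2 * \<alpha> 1)
        * (x $ e 2 * x0 $ e 2) powr (1 - 2 * \<alpha> 2))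
     * H_sig e lam x x0 (2 + a - 2 * \<alpha> 1 - 2 * \<alpha> 2) (1 - \<alpha> 1) (1 - \<alpha> 2) (\<alpha> 3)
         (2 - 2 * \<alpha> 1) (2 - 2 * \<alpha> 2) (2 * \<alpha> 3))"

definition q6 :: "(nat \<Rightarrow> 'p::finite) \<Rightarrow> (nat \<Rightarrow> real) \<Rightarrow> complex \<Rightarrow> complex \<Rightarrow>
    real ^ 'p \<Rightarrow> real ^ 'p \<Rightarrow> complex" where
  "q6 e \<alpha> lam k x x0 = (let a = alpha_tot CARD('p) \<alpha> in
     k * of_real (rsq x x0 powr (2 * \<alpha> 1 + 2 * \<alpha> 3 - a - 2)
        * (x $ e 1 * x0 $ e 1) powr (1 - 2 * \<alpha> 1)
        * (x $ e 3 * x0 $ e 3) powr (1 - 2 * \<alpha> 3))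
     * H_sig e lam x x0 (2 + a - 2 * \<alpha> 1 - 2 * \<alpha> 3) (1 - \<alpha> 1) (\<alpha> 2) (1 - \<alpha> 3)
         (2 - 2 * \<alpha> 1) (2 * \<alpha> 2) (2 - 2 * \<alpha> 3))"

definition q7 :: "(nat \<Rightarrow> 'p::finite) \<Rightarrow> (nat \<Rightarrow> real) \<Rightarrow> complex \<Rightarrow> complex \<Rightarrow>
    real ^ 'p \<Rightarrow> real ^ 'p \<Rightarrow> complex" where
  "q7 e \<alpha> lam k x x0 = (let a = alpha_tot CARD('p) \<alpha> in
     k * of_real (rsq x x0 powr (2 * \<alpha> 2 + 2 * \<alpha> 3 - a - 2)
        * (x $ e 2 * x0 $ e 2) powr (1 - 2 * \<alpha> 2)
        * (x $ e 3 * x0 $ e 3) powr (1 - 2 * \<alpha> 3))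
     * H_sig e lam x x0 (2 + a - 2 * \<alpha> 2 - 2 * \<alpha> 3) (\<alpha> 1) (1 - \<alpha> 2) (1 - \<alpha> 3)
         (2 * \<alpha> 1) (2 - 2 * \<alpha> 2) (2 - 2 * \<alpha> 3))"

definition q8 :: "(nat \<Rightarrow> 'p::finite) \<Rightarrow> (nat \<Rightarrow> real) \<Rightarrow> complex \<Rightarrow> complex \<Rightarrow>
    real ^ 'p \<Rightarrow> real ^ 'p \<Rightarrow> complex" where
  "q8 e \<alpha> lam k x x0 = (let a = alpha_tot CARD('p) \<alpha> in
     k * of_real (rsq x x0 powr (2 * \<alpha> 1 + 2 * \<alpha> 2 + 2 * \<alpha> 3 - a - 3)
        * (x $ e 1 * x0 $ e 1) powr (1 - 2 * \<alpha> 1)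
        * (x $ e 2 * x0 $ e 2) powr (1 - 2 * \<alpha> 2)
        * (x $ e 3 * x0 $ e 3) powr (1 - 2 * \<alpha> 3))
     * H_sig e lam x x0 (3 + a - 2 * \<alpha> 1 - 2 * \<alpha> 2 - 2 * \<alpha> 3)
         (1 - \<alpha> 1) (1 - \<alpha> 2) (1 - \<alpha> 3)
         (2 - 2 * \<alpha> 1) (2 - 2 * \<alpha> 2) (2 - 2 * \<alpha> 3))"


section \<open>The function f\<close>

definition A_num :: "nat \<Rightarrow> nat \<Rightarrow> real" where
  "A_num s q = (if s = 0 \<and> q = 0 then 1 else real q / real s)"

text \<open>
  The arguments \<open>R, R1, R2, R3\<close> stand for \<open>r\<^sup>2, r\<^sub>1\<^sup>2, r\<^sub>2\<^sup>2, r\<^sub>3\<^sup>2\<close>.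
\<close>

definition f_term :: "nat \<Rightarrow> (nat \<Rightarrow> real) \<Rightarrow> complex \<Rightarrow> real \<Rightarrow> real \<Rightarrow> real \<Rightarrow> real \<Rightarrow>
    nat \<times> nat \<times> nat \<times> nat \<Rightarrow> complex" where
  "f_term p \<alpha> lam R R1 R2 R3 = (\<lambda>(l, m, n, s). let a = alpha_tot p \<alpha> in
     \<Sum>q=0..s. \<Sum>(i, j, k)\<in>{(i, j, k). i + j + k = s}.
       of_real
         (A_num s q * fact s * real (s choose q)
          * (pochhammer a (l + m + n + s) * pochhammer (\<alpha> 1) (i + l + m)
             * pochhammer (\<alpha> 2) (j + l + n) * pochhammer (\<alpha> 3) (k + m + n))
          / (pochhammer a s * pochhammer (1 - a) q
             * pochhammer (2 * \<alpha> 1) (i + l + m) * pochhammer (2 * \<alpha> 2) (j + l + n)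
             * pochhammer (2 * \<alpha> 3) (k + m + n)
             * fact i * fact j * fact k * fact n * fact m * fact l * fact q)
          * (1 - R / R1) ^ (i + l + m) * (1 - R / R2) ^ (j + l + n) * (1 - R / R3) ^ (k + m + n))
       * (lam / 2 * of_real (sqrt R)) ^ (2 * q)
       * of_real
         (gauss_F (2 * \<alpha> 1 - a - real j - real k) (\<alpha> 1 + real (i + l + m))
            (2 * \<alpha> 1 + real (i + l + m)) (1 - R / R1)
          * gauss_F (2 * \<alpha> 2 - a - real i - real k - real m) (\<alpha> 2 + real (j + l + n))
              (2 * \<alpha> 2 + real (j + l + n)) (1 - R / R2)
          * gauss_F (2 * \<alpha> 3 - a - real i - real j - real l) (\<alpha> 3 + real (k + m + n))
              (2 * \<alpha> 3 + real (k + m + n)) (1 - R / R3))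
       * hyp_0F1 (1 - a + real q) (lam\<^sup>2 * of_real R / 4))"

definition f_fun :: "nat \<Rightarrow> (nat \<Rightarrow> real) \<Rightarrow> complex \<Rightarrow> real \<Rightarrow> real \<Rightarrow> real \<Rightarrow> real \<Rightarrow> complex" where
  "f_fun p \<alpha> lam R R1 R2 R3 =
     of_real (k_one p \<alpha>) * (\<Sum>\<^sub>\<infinity>lmns\<in>UNIV. f_term p \<alpha> lam R R1 R2 R3 lmns)"


section \<open>Order of growth\<close>

definition infinite_of_order :: "('a \<Rightarrow> complex) \<Rightarrow> ('a \<Rightarrow> real) \<Rightarrow> 'a filter \<Rightarrow> bool" where
  "infinite_of_order q g F \<longleftrightarrow>
     filterlim q at_infinity F \<and> (\<exists>C. C \<noteq> 0 \<and> ((\<lambda>x. q x / of_real (g x)) \<longlongrightarrow> C) F)"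

end

theory Submission
  imports Defs
begin

text \<open>
All eight solutions have the same shape. With \<open>\<beta>\<^sub>j\<close> equal to \<open>\<alpha>\<^sub>j\<close> or \<open>1 - \<alpha>\<^sub>j\<close> and
\<open>a = \<beta>\<^sub>1 + \<beta>\<^sub>2 + \<beta>\<^sub>3 - 1 + p/2\<close>, each of them is a nonvanishing continuous function times
\<open>(r\<^sup>2)\<close> to the power \<open>-a\<close> times \<open>H(a; \<beta>; 2\<beta>; \<sigma>)\<close>. So one function has to be understood, and it is
understood through an integral. Euler's formula for each of the three variables gives
\<open>H(a; \<beta>; 2\<beta>; \<sigma>) = \<integral> w(u) (1 + T)\<^sup>-\<^sup>a \<^sub>0F\<^sub>1(1 - a; -\<sigma>\<^sub>4 (1 + T)) du\<close>, with \<open>T = -\<Sigma> u\<^sub>j \<sigma>\<^sub>j\<close> and \<open>w\<close> the product of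
three beta densities on \<open>(0, 1)\<close>. The right-hand side is regular for all negative \<open>\<sigma>\<^sub>j\<close>; replacing
\<open>\<sigma>\<^sub>j\<close> by \<open>s \<sigma>\<^sub>j\<close> makes it holomorphic in \<open>s\<close> near \<open>[0, 1]\<close>, and near \<open>s = 0\<close> it can be expanded into the
series. Hence it is the continuation (\<open>H430_eq_cube_int\<close>).

The variable of integration is not \<open>u\<close> but \<open>v\<close>, with \<open>-u\<^sub>j \<sigma>\<^sub>j = \<xi>\<^sub>j v\<^sub>j / (1 - \<xi>\<^sub>j v\<^sub>j)\<close> and
\<open>\<xi>\<^sub>j = \<sigma>\<^sub>j / (\<sigma>\<^sub>j - 1) = 1 - r\<^sup>2 / r\<^sub>j\<^sup>2\<close>. This is Pfaff's transformation, and it has two advantages. First,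
the Gauss functions in \<open>f\<close>, whose argument is \<open>\<xi>\<^sub>j\<close>, are moments of the weight in \<open>v\<close> by Euler's integral
in its original form, so that no change of variables is carried out. Second, as \<open>r \<rightarrow> 0\<close> all \<open>\<xi>\<^sub>j\<close> tend
to \<open>1\<close> while the domain \<open>(0, 1)\<^sup>3\<close> stays fixed, and since \<open>a > \<beta>\<^sub>1 + \<beta>\<^sub>2 + \<beta>\<^sub>3\<close> the integrand has an
integrable majorant independent of \<open>\<xi>\<close>. So the integral converges (\<open>cube_int_tendsto\<close>) to its value at
\<open>\<xi> = (1, 1, 1)\<close>, \<open>\<lambda> r = 0\<close>, a Dirichlet integral that equals
\<open>\<Gamma>(\<beta>\<^sub>1) \<Gamma>(\<beta>\<^sub>2) \<Gamma>(\<beta>\<^sub>3) \<Gamma>(p/2 - 1) / \<Gamma>(a)\<close> (\<open>cube_int_limit_value\<close>). The prefactors combine to \<open>r\<^sup>2\<^sup>-\<^sup>p\<close> times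
a function with a nonzero limit, which is the growth claim for all eight solutions
(\<open>infinite_of_order_H_sig\<close>).

The expansion of \<open>f\<close> (\<open>f_term_has_sum\<close>) is an expansion of the integrand at each point \<open>v\<close>. Write
\<open>T = X + Y + Z\<close>. The identity
\<open>(1 + X)(1 + Y)(1 + Z) - XY - XZ - YZ(1 + X) = 1 + X + Y + Z\<close> and the trinomial series expand
\<open>(1 + T)\<close> to a negative power into products of functions of one variable: this is the sum over
\<open>l, m, n\<close> (\<open>bc_kernel_has_sum\<close>). Expanding \<open>\<^sub>0F\<^sub>1(1 - a; \<tau> + \<tau> T)\<close> around \<open>\<tau>\<close> gives the sum over \<open>q\<close>, and
\<open>T\<^sup>q = \<Sigma>\<^sub>s A(s, q) (s choose q) (T / (1 + T))\<^sup>s\<close> the sum over \<open>s\<close>; the trinomial formula for \<open>T\<^sup>s\<close> gives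
the sum over \<open>i, j, k\<close>. Apart from coefficients that depend only on \<open>s\<close> and \<open>q\<close>, every term is positive, so
the sums of absolute values are again explicit and justify integrating term by term
(\<open>has_sum_lebesgue_integral\<close>). The lemma covers \<open>\<xi> = (1, 1, 1)\<close> with \<open>\<tau> = 0\<close> as well, so it also yields the
value of \<open>f\<close> at \<open>r = 0\<close>, and the continuity of \<open>f\<close> there is the convergence of the integral.
\<close>

section \<open>Sums of integrals and exponential generating functions\<close>

text \<open>
Dominated convergence for unordered sums. It is the only tool by which sums and integrals are
interchanged below. The sum of the norms is kept as a separate function \<open>G\<close> because in the applications
it can be computed by the same formula as the sum itself.
\<close>
lemma has_sum_lebesgue_integral:
  fixes f :: "'i::countable \<Rightarrow> 'a \<Rightarrow> 'b::{banach, second_countable_topology}"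
  assumes meas: "\<And>i. f i \<in> borel_measurable M"
    and lim: "\<And>x. x \<in> space M \<Longrightarrow> ((\<lambda>i. f i x) has_sum F x) UNIV"
    and abs: "\<And>x. x \<in> space M \<Longrightarrow> ((\<lambda>i. norm (f i x)) has_sum G x) UNIV"
    and bound: "\<And>x. x \<in> space M \<Longrightarrow> G x \<le> h x"
    and int: "integrable M h"
  shows "integrable M F" "((\<lambda>i. LINT x|M. f i x) has_sum (LINT x|M. F x)) UNIV"
proof -
  have part: "(\<Sum>i\<in>A. norm (f i x)) \<le> h x" if "x \<in> space M" "finite A" for x A
  proof -
    have "(\<Sum>i\<in>A. norm (f i x)) \<le> G x"
      by (rule finite_sum_le_has_sum[OF abs[OF that(1)]]) (use that in auto)
    with bound[OF that(1)] show ?thesis by linarith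
  qed
  have fint: "integrable M (f i)" for i
    by (rule Bochner_Integration.integrable_bound[OF int meas])
       (use part[of _ "{i}"] in \<open>auto intro!: AE_I2 order.trans[OF _ abs_ge_self]\<close>)
  have normsum: "(\<lambda>i. norm (LINT x|M. f i x)) summable_on UNIV"
  proof (rule nonneg_bdd_above_summable_on)
    show "bdd_above (sum (\<lambda>i. norm (LINT x|M. f i x)) ` {F. F \<subseteq> UNIV \<and> finite F})"
    proof (rule bdd_aboveI2)
      fix A assume A: "A \<in> {F. F \<subseteq> (UNIV::'i set) \<and> finite F}"
      have "(\<Sum>i\<in>A. norm (LINT x|M. f i x)) \<le> (\<Sum>i\<in>A. (LINT x|M. norm (f i x)))"
        by (intro sum_mono integral_norm_bound)
      also have "\<dots> = (LINT x|M. (\<Sum>i\<in>A. norm (f i x)))"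
        by (rule Bochner_Integration.integral_sum[symmetric]) (use fint in auto)
      also have "\<dots> \<le> (LINT x|M. h x)"
        by (rule integral_mono) (use fint part A int in auto)
      finally show "(\<Sum>i\<in>A. norm (LINT x|M. f i x)) \<le> (LINT x|M. h x)" .
    qed
  qed auto
  hence hs: "((\<lambda>i. LINT x|M. f i x) has_sum (\<Sum>\<^sub>\<infinity>i. (LINT x|M. f i x))) UNIV"
    using abs_summable_summable by (metis has_sum_infsum)
  \<comment> \<open>Dominated convergence is about sequences, so the unordered sum is followed along one exhausting
    sequence of finite sets.\<close>
  define A where "A n = (to_nat :: 'i \<Rightarrow> nat) -` {..<n}" for n
  have finA: "finite (A n)" for n
    unfolding A_def by (intro finite_vimageI) auto
  have flA: "filterlim A (finite_subsets_at_top UNIV) sequentially"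
    unfolding filterlim_def le_filter_def eventually_filtermap
  proof safe
    fix P assume "eventually P (finite_subsets_at_top (UNIV::'i set))"
    then obtain X where X: "finite X" "\<And>Y. finite Y \<Longrightarrow> X \<subseteq> Y \<Longrightarrow> P Y"
      unfolding eventually_finite_subsets_at_top by auto
    have "X \<subseteq> A n" if "n \<ge> Suc (Max (insert 0 (to_nat ` X)))" for n
    proof
      fix y assume "y \<in> X"
      hence "to_nat y \<le> Max (insert 0 (to_nat ` X))" using X(1) by (intro Max_ge) auto
      thus "y \<in> A n" using that unfolding A_def by auto
    qed
    hence "P (A n)" if "n \<ge> Suc (Max (insert 0 (to_nat ` X)))" for n
      using X(2)[OF finA] that by blast
    thus "eventually (\<lambda>n. P (A n)) sequentially"
      unfolding eventually_sequentially by blast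
  qed
  have pt: "(\<lambda>n. \<Sum>i\<in>A n. f i x) \<longlonglongrightarrow> F x" if "x \<in> space M" for x
    using lim[OF that] flA unfolding has_sum_def by (rule filterlim_compose)
  have Fmeas: "F \<in> borel_measurable M"
    by (rule borel_measurable_LIMSEQ_metric[OF _ pt]) (use meas in measurable)
  have sumb: "norm (\<Sum>i\<in>A n. f i x) \<le> h x" if "x \<in> space M" for n x
    by (rule order.trans[OF norm_sum part[OF that finA]])
  show "integrable M F"
    by (rule integrable_dominated_convergence[where w=h and s="\<lambda>n x. \<Sum>i\<in>A n. f i x"])
       (use Fmeas meas int pt sumb in \<open>auto intro!: AE_I2\<close>)
  have "(\<lambda>n. LINT x|M. (\<Sum>i\<in>A n. f i x)) \<longlonglongrightarrow> (LINT x|M. F x)"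
    by (rule integral_dominated_convergence[where w=h])
       (use Fmeas meas int pt sumb in \<open>auto intro!: AE_I2\<close>)
  moreover have "(\<lambda>n. LINT x|M. (\<Sum>i\<in>A n. f i x)) = (\<lambda>n. \<Sum>i\<in>A n. (LINT x|M. f i x))"
    by (intro ext Bochner_Integration.integral_sum) (use fint in auto)
  moreover have "(\<lambda>n. \<Sum>i\<in>A n. (LINT x|M. f i x)) \<longlonglongrightarrow> (\<Sum>\<^sub>\<infinity>i. (LINT x|M. f i x))"
    using hs flA unfolding has_sum_def by (rule filterlim_compose)
  ultimately show "((\<lambda>i. LINT x|M. f i x) has_sum (LINT x|M. F x)) UNIV"
    using hs LIMSEQ_unique by metis
qed

text \<open>
By the binomial theorem, \<open>(Y + Z)\<^sup>p / p!\<close> is the sum of \<open>Y\<^sup>m Z\<^sup>n / (m! n!)\<close> over \<open>m + n = p\<close>. In this form a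
coefficient depending on \<open>m + n\<close> only can be split into one more variable; the index \<open>i\<close> carries the
variables that have been split off already.
\<close>
lemma exp_generating_split:
  fixes c :: "'i \<Rightarrow> nat \<Rightarrow> 'a::{real_normed_field, banach}"
  assumes S: "((\<lambda>(i, p). c i p * (Y + Z) ^ p / fact p) has_sum S) UNIV"
    and abs: "(\<lambda>(i, p). norm (c i p) * (norm Y + norm Z) ^ p / fact p) summable_on UNIV"
  shows "((\<lambda>(i, m, n). c i (m + n) * Y ^ m * Z ^ n / (fact m * fact n)) has_sum S) UNIV"
proof -
  define g where "g = (\<lambda>((i, p), m). c i p * Y ^ m * Z ^ (p - m) / (fact m * fact (p - m)))"
  have binom: "(\<Sum>m\<le>p. C * U ^ m * V ^ (p - m) / (fact m * fact (p - m))) = C * (U + V) ^ p / fact p"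
    for C U V :: "'b::{real_normed_field}" and p
    unfolding binomial_ring sum_distrib_left sum_divide_distrib
    by (intro sum.cong) (auto simp: binomial_fact)
  have fib: "((\<lambda>m. g (ip, m)) has_sum (case ip of (i, p) \<Rightarrow> c i p * (Y + Z) ^ p / fact p)) {..snd ip}" for ip
    unfolding g_def using has_sum_finite[of "{..snd ip}" "\<lambda>m. g (ip, m)"]
    by (cases ip) (simp add: binom g_def)
  have nfib: "((\<lambda>m. norm (g (ip, m))) has_sum
      (case ip of (i, p) \<Rightarrow> norm (c i p) * (norm Y + norm Z) ^ p / fact p)) {..snd ip}" for ip
    using has_sum_finite[of "{..snd ip}" "\<lambda>m. norm (g (ip, m))"]
    by (cases ip) (simp add: binom g_def norm_mult norm_divide norm_power)
  have "(\<lambda>x. norm (g x)) summable_on Sigma UNIV (\<lambda>ip. {..snd ip})"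
    by (rule summable_on_SigmaI[OF nfib abs]) auto
  hence sm: "g summable_on Sigma UNIV (\<lambda>ip. {..snd ip})"
    by (rule abs_summable_summable)
  have "(g has_sum S) (Sigma UNIV (\<lambda>ip. {..snd ip}))"
    by (rule has_sum_SigmaI[OF fib S sm])
  also have "?this \<longleftrightarrow> ?thesis"
    unfolding g_def
    by (rule has_sum_reindex_bij_witness[of _ "\<lambda>(i, m, n). ((i, m + n), m)" "\<lambda>((i, p), m). (i, m, p - m)"])
       auto
  finally show ?thesis .
qed

lemma exp_generating_2:
  fixes c :: "nat \<Rightarrow> 'a::{real_normed_field, banach}"
  assumes S: "((\<lambda>p. c p * (Y + Z) ^ p / fact p) has_sum S) UNIV"
    and abs: "(\<lambda>p. norm (c p) * (norm Y + norm Z) ^ p / fact p) summable_on UNIV"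
  shows "((\<lambda>(m, n). c (m + n) * Y ^ m * Z ^ n / (fact m * fact n)) has_sum S) UNIV"
proof -
  have bij: "bij (\<lambda>x. ((), x))" by (auto simp: bij_def inj_def)
  have "((\<lambda>(i::unit, m, n). c (m + n) * Y ^ m * Z ^ n / (fact m * fact n)) has_sum S) UNIV"
  proof (rule exp_generating_split[of "\<lambda>_. c"])
    show "((\<lambda>(i::unit, p). c p * (Y + Z) ^ p / fact p) has_sum S) UNIV"
      using S by (subst has_sum_reindex_bij_betw[OF bij, symmetric]) simp
    show "(\<lambda>(i::unit, p). norm (c p) * (norm Y + norm Z) ^ p / fact p) summable_on UNIV"
      using abs by (subst summable_on_reindex_bij_betw[OF bij, symmetric]) simp
  qed
  thus ?thesis by (subst (asm) has_sum_reindex_bij_betw[OF bij, symmetric]) simp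
qed

text \<open>
Applied with \<open>c = pochhammer a\<close> this is the trinomial series for \<open>(1 - X - Y - Z)\<^sup>-\<^sup>a\<close>.
\<close>
lemma exp_generating_3:
  fixes c :: "nat \<Rightarrow> 'a::{real_normed_field, banach}"
  assumes S: "((\<lambda>p. c p * (X + Y + Z) ^ p / fact p) has_sum S) UNIV"
    and abs: "(\<lambda>p. norm (c p) * (norm X + norm Y + norm Z) ^ p / fact p) summable_on UNIV"
  shows "((\<lambda>(l, m, n). c (l + m + n) * X ^ l * Y ^ m * Z ^ n / (fact l * fact m * fact n)) has_sum S) UNIV"
proof -
  have smono: "summable (\<lambda>p. norm (c p) * (norm X + norm (Y + Z)) ^ p / fact p)"
  proof (rule summable_comparison_test', rule summable_on_imp_summable[OF abs])
    fix p :: nat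
    show "norm (norm (c p) * (norm X + norm (Y + Z)) ^ p / fact p)
       \<le> norm (c p) * (norm X + norm Y + norm Z) ^ p / fact p"
      using norm_triangle_ineq[of Y Z]
      by (auto intro!: divide_right_mono mult_left_mono power_mono simp: abs_mult)
  qed
  have "((\<lambda>(l, p). c (l + p) * X ^ l * (Y + Z) ^ p / (fact l * fact p)) has_sum S) UNIV"
    by (rule exp_generating_2)
       (use S smono in \<open>auto simp: add.assoc intro!: norm_summable_imp_summable_on simp: norm_mult norm_divide
         norm_power\<close>)
  hence 1: "((\<lambda>(l, p). (c (l + p) * X ^ l / fact l) * (Y + Z) ^ p / fact p) has_sum S) UNIV"
    by (simp add: case_prod_unfold)
  have "((\<lambda>(l, p). norm (c (l + p)) * norm X ^ l * (norm Y + norm Z) ^ p / (fact l * fact p))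
      has_sum (\<Sum>\<^sub>\<infinity>p. norm (c p) * (norm X + norm Y + norm Z) ^ p / fact p)) UNIV"
    by (rule exp_generating_2) (use abs in \<open>auto simp: add.assoc\<close>)
  hence "(\<lambda>(l, p). norm (c (l + p)) * norm X ^ l * (norm Y + norm Z) ^ p / (fact l * fact p)) summable_on UNIV"
    by (rule has_sum_imp_summable)
  hence 2: "(\<lambda>(l, p). norm (c (l + p) * X ^ l / fact l) * (norm Y + norm Z) ^ p / fact p) summable_on UNIV"
    by (simp add: case_prod_unfold norm_mult norm_divide norm_power)
  show ?thesis
    using exp_generating_split[OF 1 2] by (simp add: case_prod_unfold add.assoc mult_ac)
qed

section \<open>Euler's integral for the Gauss function\<close>

lemma pochhammer_binomial_sums:
  fixes c x :: real
  assumes "\<bar>x\<bar> < 1"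
  shows "(\<lambda>n. pochhammer c n * x ^ n / fact n) sums (1 - x) powr (- c)"
proof -
  have "((- c) gchoose n) * (- x) ^ n = pochhammer c n * x ^ n / fact n" for n
    unfolding gbinomial_pochhammer power_minus[of x] by (simp add: mult.assoc[symmetric]
      power_mult_distrib[symmetric])
  thus ?thesis using gen_binomial_real[of "-x" "-c"] assms by simp
qed

lemma pochhammer_binomial_sums_complex:
  fixes c x :: complex
  assumes "norm x < 1"
  shows "(\<lambda>n. pochhammer c n * x ^ n / fact n) sums (1 - x) powr (- c)"
proof -
  have "((- c) gchoose n) * (- x) ^ n = pochhammer c n * x ^ n / fact n" for n
    unfolding gbinomial_pochhammer power_minus[of x] by (simp add: mult.assoc[symmetric]
      power_mult_distrib[symmetric])
  thus ?thesis using gen_binomial_complex[of "-x" "-c"] assms by simp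
qed

lemma abs_pochhammer_le:
  fixes c :: real
  assumes "\<bar>c\<bar> \<le> d"
  shows "\<bar>pochhammer c n\<bar> \<le> pochhammer d n"
  unfolding pochhammer_prod abs_prod
  by (rule prod_mono) (use assms in auto)

lemma summable_abs_pochhammer:
  fixes c x :: real
  assumes "\<bar>x\<bar> < 1"
  shows "summable (\<lambda>n. \<bar>pochhammer c n\<bar> * \<bar>x\<bar> ^ n / fact n)"
proof (rule summable_comparison_test')
  show "summable (\<lambda>n. pochhammer \<bar>c\<bar> n * \<bar>x\<bar> ^ n / fact n)"
    using pochhammer_binomial_sums[of "\<bar>x\<bar>" "\<bar>c\<bar>"] assms by (simp add: sums_iff)
  show "norm (\<bar>pochhammer c n\<bar> * \<bar>x\<bar> ^ n / fact n) \<le> pochhammer \<bar>c\<bar> n * \<bar>x\<bar> ^ n / fact n" for n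
    using abs_pochhammer_le[of c "\<bar>c\<bar>" n]
    by (auto simp: abs_mult intro!: divide_right_mono mult_right_mono)
qed

lemma pochhammer_binomial_has_sum:
  fixes c x :: real
  assumes "\<bar>x\<bar> < 1"
  shows "((\<lambda>n. pochhammer c n * x ^ n / fact n) has_sum (1 - x) powr (- c)) UNIV"
proof (rule norm_summable_imp_has_sum)
  show "summable (\<lambda>n. norm (pochhammer c n * x ^ n / fact n))"
    using summable_abs_pochhammer[OF assms, of c] by (simp add: abs_mult power_abs)
qed (rule pochhammer_binomial_sums[OF assms])

lemma pochhammer_binomial_has_sum_complex:
  fixes c :: real and x :: complex
  assumes "norm x < 1"
  shows "((\<lambda>n. of_real (pochhammer c n) * x ^ n / fact n) has_sum (1 - x) powr (- of_real c)) UNIV"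
proof (rule norm_summable_imp_has_sum)
  show "summable (\<lambda>n. norm (complex_of_real (pochhammer c n) * x ^ n / fact n))"
    using summable_abs_pochhammer[of "norm x" c] assms
    by (simp add: norm_mult norm_divide norm_power)
  show "(\<lambda>n. complex_of_real (pochhammer c n) * x ^ n / fact n) sums (1 - x) powr (- of_real c)"
    using pochhammer_binomial_sums_complex[OF assms, of "of_real c"]
    by (simp add: pochhammer_of_real)
qed

text \<open>
From some index on, the coefficients of \<open>(1 - x)\<close> to the power \<open>-c\<close> have constant sign. So the series of
absolute values exceeds the function by a constant at most. For negative \<open>c\<close> the bound
\<open>abs_pochhammer_le\<close> would give a negative power of \<open>1 - x\<close> instead, which need not be integrable against
the beta weight at \<open>x = 1\<close>.
\<close>
lemma abs_pochhammer_binomial_bound: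
  fixes c :: real
  shows "\<exists>K\<ge>0. \<forall>x. 0 \<le> x \<longrightarrow> x < 1 \<longrightarrow>
           (\<Sum>n. \<bar>pochhammer c n\<bar> * x ^ n / fact n) \<le> (1 - x) powr (- c) + K"
proof -
  \<comment> \<open>beyond this index all further factors of the Pochhammer symbol are positive\<close>
  obtain N :: nat where N: "real N > - c" using reals_Archimedean2 by blast
  define s where "s = (if pochhammer c N \<ge> 0 then 1 else -1 :: real)"
  have sgn: "\<bar>pochhammer c n\<bar> = s * pochhammer c n" if "n \<ge> N" for n
  proof -
    have "pochhammer c n = pochhammer c N * pochhammer (c + real N) (n - N)"
      using pochhammer_product[OF that, of c] by simp
    moreover have "pochhammer (c + real N) (n - N) \<ge> 0"
      using N by (intro pochhammer_nonneg) auto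
    ultimately show ?thesis unfolding s_def by (auto simp: abs_mult)
  qed
  define K where "K = (\<Sum>n<N. 2 * \<bar>pochhammer c n\<bar>)"
  have "(\<Sum>n. \<bar>pochhammer c n\<bar> * x ^ n / fact n) \<le> (1 - x) powr (- c) + K" if x: "0 \<le> x" "x < 1" for x
  proof -
    have 1: "(\<lambda>n. s * (pochhammer c n * x ^ n / fact n)) sums (s * (1 - x) powr (- c))"
      using pochhammer_binomial_sums[of x c] x by (intro sums_mult) auto
    have 2: "(\<lambda>n. if n < N then 2 * \<bar>pochhammer c n\<bar> else 0) sums (\<Sum>n<N. 2 * \<bar>pochhammer c n\<bar>)"
      using sums_If_finite_set[of "{..<N}" "\<lambda>n. 2 * \<bar>pochhammer c n\<bar>"] by simp
    have 3: "(\<lambda>n. \<bar>pochhammer c n\<bar> * x ^ n / fact n) sums (\<Sum>n. \<bar>pochhammer c n\<bar> * x ^ n / fact n)"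
      using summable_abs_pochhammer[of x c] x by (simp add: summable_sums)
    have "(\<Sum>n. \<bar>pochhammer c n\<bar> * x ^ n / fact n) \<le> s * (1 - x) powr (- c) + K"
      unfolding K_def
    proof (rule sums_le[OF _ 3 sums_add[OF 1 2]])
      fix n
      have le1: "x ^ n / fact n \<le> 1"
        using x power_le_one[of x n] order.trans[OF power_le_one fact_ge_1, of x n n] by (simp add:
          divide_le_eq)
      show "\<bar>pochhammer c n\<bar> * x ^ n / fact n \<le> s * (pochhammer c n * x ^ n / fact n)
            + (if n < N then 2 * \<bar>pochhammer c n\<bar> else 0)"
      proof (cases "n < N")
        case True
        have "\<bar>pochhammer c n\<bar> * (x ^ n / fact n) \<le> \<bar>pochhammer c n\<bar>"
          using le1 by (intro mult_left_le) auto
        moreover have "- (\<bar>pochhammer c n\<bar> * (x ^ n / fact n)) \<le> s * (pochhammer c n * (x ^ n / fact n))"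
        proof -
          have "\<bar>s * (pochhammer c n * (x ^ n / fact n))\<bar> = \<bar>pochhammer c n\<bar> * (x ^ n / fact n)"
            using x by (simp add: s_def abs_mult)
          from abs_le_D2[OF eq_refl[OF this]] show ?thesis by (subst minus_le_iff)
        qed
        ultimately show ?thesis using True by simp
      next
        case False
        thus ?thesis using sgn[of n] by simp
      qed
    qed
    also have "s * (1 - x) powr (- c) \<le> (1 - x) powr (- c)" by (auto simp: s_def)
    finally show ?thesis by simp
  qed
  moreover have "K \<ge> 0" unfolding K_def by (intro sum_nonneg) auto
  ultimately show ?thesis by blast
qed

definition lborel01 :: "real measure" where "lborel01 = restrict_space lborel {0<..<1}"

lemma space_lborel01 [simp]: "space lborel01 = {0<..<1}"
  by (simp add: lborel01_def space_restrict_space)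

lemma measurable_lborel01: "f \<in> borel_measurable borel \<Longrightarrow> f \<in> borel_measurable lborel01"
  unfolding lborel01_def by (rule measurable_restrict_space1) simp

lemma finite_measure_lborel01: "finite_measure lborel01"
  by (rule finite_measureI) (simp add: lborel01_def emeasure_restrict_space space_restrict_space)

interpretation lborel01: finite_measure lborel01 by (rule finite_measure_lborel01)

lemma
  fixes a b :: real
  assumes "a > 0" "b > 0"
  shows integrable_lborel01_Beta: "integrable lborel01 (\<lambda>t. t powr (a - 1) * (1 - t) powr (b - 1))"
    and integral_lborel01_Beta: "(LINT t|lborel01. t powr (a - 1) * (1 - t) powr (b - 1)) = Beta a b"
proof -
  have eq: "(\<lambda>t. indicator {0<..<1} t *\<^sub>R (t powr (a - 1) * (1 - t) powr (b - 1))) =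
     (\<lambda>t. indicator {0..1} t *\<^sub>R (t powr (a - 1) * (1 - t) powr (b - 1)))"
    by (auto simp: fun_eq_iff indicator_def)
  note int = integrable_Beta[OF assms]
  show "integrable lborel01 (\<lambda>t. t powr (a - 1) * (1 - t) powr (b - 1))"
    using int unfolding lborel01_def set_integrable_def eq[symmetric]
    by (subst integrable_restrict_space) simp_all
  have "(LINT t|lborel01. t powr (a - 1) * (1 - t) powr (b - 1)) =
        (LINT t:{0..1}|lborel. t powr (a - 1) * (1 - t) powr (b - 1))"
    unfolding lborel01_def set_lebesgue_integral_def eq[symmetric] by (rule integral_restrict_space) simp
  also have "\<dots> = integral {0..1} (\<lambda>t. t powr (a - 1) * (1 - t) powr (b - 1))"
    by (rule set_borel_integral_eq_integral(2)[OF int])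
  also have "\<dots> = Beta a b" using has_integral_Beta_real[OF assms] by (rule integral_unique)
  finally show "(LINT t|lborel01. t powr (a - 1) * (1 - t) powr (b - 1)) = Beta a b" .
qed

lemma Beta_real_pos: "0 < a \<Longrightarrow> 0 < b \<Longrightarrow> 0 < Beta a (b :: real)"
  by (auto simp: Beta_def intro!: divide_pos_pos mult_pos_pos Gamma_real_pos)

text \<open>
The moments of the beta density.
\<close>
lemma Beta_shift:
  fixes a b :: real
  assumes "a > 0" "b > 0"
  shows "Beta (a + real n) b = Beta a b * pochhammer a n / pochhammer (a + b) n"
proof -
  have "a \<notin> \<int>\<^sub>\<le>\<^sub>0" "a + b \<notin> \<int>\<^sub>\<le>\<^sub>0" using assms by (auto elim!: nonpos_Ints_cases)
  moreover have "Gamma a \<noteq> 0" "Gamma (a + b) \<noteq> 0"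
    using assms by (metis Gamma_real_pos add_pos_pos less_irrefl)+
  ultimately show ?thesis by (simp add: Beta_def pochhammer_Gamma add_ac)
qed

text \<open>
Expand \<open>(1 - \<xi> v)\<close> to the power \<open>-A\<close> and integrate term by term. The case \<open>\<xi> = 1\<close> is included (with Gauss's
condition \<open>A + B < C\<close>), because the values of \<open>f\<close> at \<open>r = 0\<close> involve Gauss functions at \<open>1\<close>.
\<close>
lemma
  fixes A B C \<xi> :: real
  assumes B: "0 < B" "B < C" and \<xi>: "0 \<le> \<xi>" "\<xi> \<le> 1" and conv: "\<xi> < 1 \<or> A + B < C"
  shows integrable_Euler: "integrable lborel01 (\<lambda>v. v powr (B - 1) * (1 - v) powr (C - B - 1) * (1 - \<xi> * v) powr
    (- A))"
    and Euler_integral: "(LINT v|lborel01. v powr (B - 1) * (1 - v) powr (C - B - 1) * (1 - \<xi> * v) powr (- A))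
           = Beta B (C - B) * gauss_F A B C \<xi>"
proof -
  define w where "w v = v powr (B - 1) * (1 - v) powr (C - B - 1)" for v
  have wint: "integrable lborel01 w" unfolding w_def using integrable_lborel01_Beta[of B "C - B"] B by simp
  have lt1: "0 \<le> \<xi> * v" "\<xi> * v < 1" if "v \<in> space lborel01" for v
  proof -
    from that have v: "0 < v" "v < 1" by auto
    show "0 \<le> \<xi> * v" using v \<xi> by simp
    have "\<xi> * v \<le> 1 * v" using \<xi> v by (intro mult_right_mono) auto
    thus "\<xi> * v < 1" using v by linarith
  qed
  have wpint: "integrable lborel01 (\<lambda>v. w v * (1 - \<xi> * v) powr (- A))"
  proof (cases "\<xi> < 1")
    case True
    define K where "K = max 1 ((1 - \<xi>) powr (- A))"
    show ?thesis
    proof (rule Bochner_Integration.integrable_bound)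
      show "integrable lborel01 (\<lambda>v. w v * K)" using wint by simp
      show "(\<lambda>v. w v * (1 - \<xi> * v) powr (- A)) \<in> borel_measurable lborel01"
        unfolding w_def by (rule measurable_lborel01) measurable
      show "AE v in lborel01. norm (w v * (1 - \<xi> * v) powr (- A)) \<le> norm (w v * K)"
      proof (rule AE_I2)
        fix v assume v: "v \<in> space lborel01"
        have le: "1 - \<xi> \<le> 1 - \<xi> * v" using v \<xi> by (simp add: mult_left_le)
        have "(1 - \<xi> * v) powr (- A) \<le> K"
        proof (cases "A \<ge> 0")
          case True
          have "(1 - \<xi> * v) powr (- A) \<le> (1 - \<xi>) powr (- A)"
            by (rule powr_mono2') (use True le \<open>\<xi> < 1\<close> in auto)
          thus ?thesis by (simp add: K_def)
        next
          case False
          have "(1 - \<xi> * v) powr (- A) \<le> 1 powr (- A)"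
            by (rule powr_mono2) (use False lt1[OF v] in auto)
          thus ?thesis by (simp add: K_def)
        qed
        moreover have "w v \<ge> 0" by (simp add: w_def)
        moreover have "K \<ge> 1" by (simp add: K_def)
        ultimately show "norm (w v * (1 - \<xi> * v) powr (- A)) \<le> norm (w v * K)"
          by (auto simp: abs_mult intro!: mult_left_mono)
      qed
    qed
  next
    case False
    hence 1: "\<xi> = 1" using \<xi> by simp
    have "integrable lborel01 (\<lambda>v. v powr (B - 1) * (1 - v) powr (C - A - B - 1))"
      using integrable_lborel01_Beta[of B "C - A - B"] B conv 1 by simp
    also have "?this \<longleftrightarrow> ?thesis"
      by (rule Bochner_Integration.integrable_cong)
         (auto simp: w_def 1 powr_add[symmetric] mult.assoc algebra_simps)
    finally show ?thesis .
  qed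
  thus "integrable lborel01 (\<lambda>v. v powr (B - 1) * (1 - v) powr (C - B - 1) * (1 - \<xi> * v) powr (- A))"
    by (simp add: w_def)
  obtain K where K: "K \<ge> 0" "\<And>x. 0 \<le> x \<Longrightarrow> x < 1 \<Longrightarrow>
           (\<Sum>n. \<bar>pochhammer A n\<bar> * x ^ n / fact n) \<le> (1 - x) powr (- A) + K"
    using abs_pochhammer_binomial_bound[of A] by blast
  have w0: "w v \<ge> 0" for v by (simp add: w_def)
  define f where "f n v = w v * (pochhammer A n * (\<xi> * v) ^ n / fact n)" for n :: nat and v
  let ?c = "\<lambda>v n. \<bar>pochhammer A n\<bar> * (\<xi> * v) ^ n / fact n"
  have "((\<lambda>n. LINT v|lborel01. f n v) has_sum (LINT v|lborel01. w v * (1 - \<xi> * v) powr (- A))) UNIV"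
  proof (rule has_sum_lebesgue_integral(2))
    show "f n \<in> borel_measurable lborel01" for n unfolding f_def w_def by (rule measurable_lborel01) measurable
    fix v assume v: "v \<in> space lborel01"
    note lt = lt1[OF v]
    show "((\<lambda>n. f n v) has_sum (w v * (1 - \<xi> * v) powr (- A))) UNIV"
      unfolding f_def using pochhammer_binomial_has_sum[of "\<xi> * v" A] lt
      by (intro has_sum_cmult_right) auto
    have "summable (\<lambda>n. ?c v n)"
      using summable_abs_pochhammer[of "\<xi> * v" A] lt by (simp only: abs_of_nonneg)
    hence "((\<lambda>n. ?c v n) has_sum
         (\<Sum>n. ?c v n)) UNIV"
      using lt by (intro sums_nonneg_imp_has_sum summable_sums) auto
    from has_sum_cmult_right[OF this, of "w v"]
    show "((\<lambda>n. norm (f n v)) has_sum (w v * (\<Sum>n. ?c v n))) UNIV"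
      using v \<xi> w0[of v] by (simp add: f_def abs_mult power_abs)
    show "w v * (\<Sum>n. ?c v n) \<le> w v * ((1 - \<xi> * v) powr (- A) + K)"
      using K(2)[OF lt] w0[of v] by (intro mult_left_mono) auto
  next
    show "integrable lborel01 (\<lambda>v. w v * ((1 - \<xi> * v) powr (- A) + K))"
      using wpint wint by (simp add: distrib_left)
  qed
  moreover have "(LINT v|lborel01. f n v) = Beta B (C - B) * (pochhammer A n * pochhammer B n / (pochhammer C n
    * fact n) * \<xi> ^ n)" for n
  proof -
    have "(LINT v|lborel01. f n v) = (LINT v|lborel01. (pochhammer A n * \<xi> ^ n / fact n) * (v powr ((B + real n)
      - 1) * (1 - v) powr ((C - B) - 1)))"
    proof (rule Bochner_Integration.integral_cong)
      fix v assume "v \<in> space lborel01"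
      hence v: "0 < v" by simp
      have "v powr ((B + real n) - 1) = v powr (B - 1) * v ^ n"
        using v by (simp add: powr_add[symmetric] powr_realpow[symmetric] algebra_simps)
      thus "f n v = (pochhammer A n * \<xi> ^ n / fact n) * (v powr ((B + real n) - 1) * (1 - v) powr ((C - B) -
        1))"
        by (simp add: f_def w_def power_mult_distrib)
    qed simp
    also have "\<dots> = (pochhammer A n * \<xi> ^ n / fact n) * Beta (B + real n) (C - B)"
      using B by (simp add: integral_lborel01_Beta)
    finally show ?thesis using B by (simp add: Beta_shift mult_ac)
  qed
  ultimately have hs: "((\<lambda>n. Beta B (C - B) * (pochhammer A n * pochhammer B n / (pochhammer C n * fact n) * \<xi> ^
    n))
      has_sum (LINT v|lborel01. w v * (1 - \<xi> * v) powr (- A))) UNIV" by simp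
  have Bpos: "Beta B (C - B) \<noteq> 0" using B Beta_real_pos[of B "C - B"] by simp
  from sums_mult_D[OF has_sum_imp_sums[OF hs] Bpos]
  have "(\<Sum>n. pochhammer A n * pochhammer B n / (pochhammer C n * fact n) * \<xi> ^ n) =
      (LINT v|lborel01. w v * (1 - \<xi> * v) powr (- A)) / Beta B (C - B)"
    by (rule sums_unique[symmetric])
  thus "(LINT v|lborel01. v powr (B - 1) * (1 - v) powr (C - B - 1) * (1 - \<xi> * v) powr (- A))
           = Beta B (C - B) * gauss_F A B C \<xi>"
    using Bpos by (simp add: gauss_F_def w_def)
qed

text \<open>
Together with Euler's integral this evaluates the beta integrals that would otherwise call for a
fractional linear substitution.
\<close>
lemma gauss_F_cancel:
  assumes "0 < C" "0 \<le> \<xi>" "\<xi> < 1"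
  shows "gauss_F C B C \<xi> = (1 - \<xi>) powr (- B)"
proof -
  have "pochhammer C n \<noteq> 0" for n using pochhammer_pos[of C n] assms by simp
  hence "gauss_F C B C \<xi> = (\<Sum>n. pochhammer B n * \<xi> ^ n / fact n)"
    by (simp add: gauss_F_def)
  also have "\<dots> = (1 - \<xi>) powr (- B)"
    using pochhammer_binomial_sums[of \<xi> B] assms by (simp add: sums_iff)
  finally show ?thesis .
qed

section \<open>Weights on the unit cube\<close>

text \<open>
Since the weights on the cube are products of functions of one coordinate, this reduces the moments of
the three-dimensional weight to Euler's integral.
\<close>
lemma
  fixes f :: "'a \<Rightarrow> real" and g :: "'b \<Rightarrow> real"
  assumes "sigma_finite_measure M" "sigma_finite_measure N"
    and f: "integrable M f" and g: "integrable N g"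
  shows integrable_pair_product: "integrable (M \<Otimes>\<^sub>M N) (\<lambda>z. f (fst z) * g (snd z))"
    and integral_pair_product: "(LINT z|(M \<Otimes>\<^sub>M N). f (fst z) * g (snd z)) = (LINT x|M. f x) * (LINT y|N. g y)"
proof -
  interpret pair_sigma_finite M N using assms by (simp add: pair_sigma_finite_def)
  have [measurable]: "f \<in> borel_measurable M" "g \<in> borel_measurable N" using f g by auto
  have "integrable (M \<Otimes>\<^sub>M N) (\<lambda>(x, y). f x * g y)"
  proof (rule Fubini_integrable)
    have "integrable M (\<lambda>x. norm (f x) * (LINT y|N. norm (g y)))"
      by (intro integrable_mult_left integrable_norm f)
    thus "integrable M (\<lambda>x. LINT y|N. norm (case (x, y) of (x, y) \<Rightarrow> f x * g y))"
      by (simp add: abs_mult)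
    show "(\<lambda>(x, y). f x * g y) \<in> borel_measurable (M \<Otimes>\<^sub>M N)" by measurable
    show "AE x in M. integrable N (\<lambda>y. case (x, y) of (x, y) \<Rightarrow> f x * g y)"
      using g by simp
  qed
  thus int: "integrable (M \<Otimes>\<^sub>M N) (\<lambda>z. f (fst z) * g (snd z))" by (simp add: case_prod_unfold)
  show "(LINT z|(M \<Otimes>\<^sub>M N). f (fst z) * g (snd z)) = (LINT x|M. f x) * (LINT y|N. g y)"
    by (subst integral_fst'[OF int, symmetric]) simp
qed

definition cube :: "(real \<times> real \<times> real) measure" where
  "cube = lborel01 \<Otimes>\<^sub>M (lborel01 \<Otimes>\<^sub>M lborel01)"

lemma space_cube: "space cube = {0<..<1} \<times> {0<..<1} \<times> {0<..<1}"
  by (simp add: cube_def space_pair_measure)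

lemma measurable_cube [measurable]:
  "(\<lambda>v. fst v) \<in> borel_measurable cube"
  "(\<lambda>v. fst (snd v)) \<in> borel_measurable cube"
  "(\<lambda>v. snd (snd v)) \<in> borel_measurable cube"
proof -
  have id: "(\<lambda>x. x) \<in> measurable lborel01 borel" by (rule measurable_lborel01) measurable
  have "(\<lambda>v. fst v) \<in> measurable cube lborel01" "(\<lambda>v. fst (snd v)) \<in> measurable cube lborel01"
    "(\<lambda>v. snd (snd v)) \<in> measurable cube lborel01"
    unfolding cube_def by measurable
  from this[THEN measurable_compose[OF _ id]]
  show "(\<lambda>v. fst v) \<in> borel_measurable cube"
  "(\<lambda>v. fst (snd v)) \<in> borel_measurable cube"
  "(\<lambda>v. snd (snd v)) \<in> borel_measurable cube" .
qed

lemma sigma_finite_lborel01: "sigma_finite_measure lborel01" and sigma_finite_lborel01_lborel01: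
  "sigma_finite_measure (lborel01 \<Otimes>\<^sub>M lborel01)"
proof -
  show 1: "sigma_finite_measure lborel01" by (rule finite_measure.axioms(1)[OF finite_measure_lborel01])
  interpret pair_sigma_finite lborel01 lborel01 using 1 by (simp add: pair_sigma_finite_def)
  show "sigma_finite_measure (lborel01 \<Otimes>\<^sub>M lborel01)" ..
qed

lemma
  fixes f g h :: "real \<Rightarrow> real"
  assumes "integrable lborel01 f" "integrable lborel01 g" "integrable lborel01 h"
  shows integrable_cube_product: "integrable cube (\<lambda>v. f (fst v) * g (fst (snd v)) * h (snd (snd v)))"
    and integral_cube_product: "(LINT v|cube. f (fst v) * g (fst (snd v)) * h (snd (snd v))) =
       (LINT x|lborel01. f x) * (LINT x|lborel01. g x) * (LINT x|lborel01. h x)"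
  using integrable_pair_product[OF sigma_finite_lborel01 sigma_finite_lborel01_lborel01 assms(1)
          integrable_pair_product[OF sigma_finite_lborel01 sigma_finite_lborel01 assms(2,3)]]
        integral_pair_product[OF sigma_finite_lborel01 sigma_finite_lborel01_lborel01 assms(1)
          integrable_pair_product[OF sigma_finite_lborel01 sigma_finite_lborel01 assms(2,3)]]
        integral_pair_product[OF sigma_finite_lborel01 sigma_finite_lborel01 assms(2,3)]
  by (simp_all add: cube_def mult.assoc)

text \<open>
In the variable \<open>u = (1 - \<xi>) v / (1 - \<xi> v)\<close> this becomes the beta weight
\<open>u\<^sup>b\<^sup>-\<^sup>1 (1 - u)\<^sup>b\<^sup>-\<^sup>1 du\<close> times the constant \<open>(1 - \<xi>)\<^sup>-\<^sup>b\<close>.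
\<close>
definition wgt :: "real \<Rightarrow> real \<Rightarrow> real \<Rightarrow> real" where
  "wgt b \<xi> v = v powr (b - 1) * (1 - v) powr (b - 1) * (1 - \<xi> * v) powr (- 2 * b)"

text \<open>
If \<open>\<xi> = \<sigma> / (\<sigma> - 1)\<close> and \<open>u\<close> is as above, this is \<open>-u \<sigma>\<close>. The form chosen here makes sense for
\<open>\<xi> = 1\<close>, i.e. \<open>\<sigma> = -\<infinity>\<close>.
\<close>
definition mob :: "real \<Rightarrow> real \<Rightarrow> real" where "mob \<xi> v = \<xi> * v / (1 - \<xi> * v)"

lemma measurable_wgt_mob [measurable]:
  "wgt b \<xi> \<in> borel_measurable borel" "mob \<xi> \<in> borel_measurable borel"
  unfolding wgt_def[abs_def] mob_def[abs_def] by measurable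

lemma wgt_nonneg: "0 \<le> wgt b \<xi> v" by (simp add: wgt_def)

lemma
  assumes "0 \<le> \<xi>" "\<xi> \<le> 1" "0 < v" "v < 1"
  shows xi_v_less_1: "\<xi> * v < 1" and mob_nonneg: "0 \<le> mob \<xi> v" and one_plus_mob: "1 + mob \<xi> v = 1 / (1 - \<xi> * v)"
proof -
  have "\<xi> * v \<le> 1 * v" using assms by (intro mult_right_mono) auto
  thus *: "\<xi> * v < 1" using assms by linarith
  thus "0 \<le> mob \<xi> v" "1 + mob \<xi> v = 1 / (1 - \<xi> * v)" using assms by (auto simp: mob_def field_simps)
qed

lemma inverse_power_eq_powr: "0 < (x::real) \<Longrightarrow> (1 / x) ^ N = x powr (- real N)"
  by (simp add: powr_minus powr_realpow power_one_over inverse_eq_divide)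

text \<open>
As \<open>1 + mob \<xi> v = 1 / (1 - \<xi> v)\<close>, the moments that occur in the expansion are integrands of Euler's
integral, with second and third parameter \<open>b + N\<close> and \<open>2b + N\<close>. These are the Gauss functions of \<open>f\<close>.
\<close>
lemma wgt_moment_eq:
  assumes "0 \<le> \<xi>" "\<xi> \<le> 1" "0 < v" "v < 1"
  shows "wgt b \<xi> v * mob \<xi> v ^ N * (1 + mob \<xi> v) powr (- A)
       = \<xi> ^ N * (v powr (b + real N - 1) * (1 - v) powr (2 * b + real N - (b + real N) - 1)
            * (1 - \<xi> * v) powr (- (2 * b + real N - A)))"
proof -
  define x where "x = 1 - \<xi> * v"
  have x: "x > 0" using xi_v_less_1[OF assms] by (simp add: x_def)
  have 1: "v powr (b + real N - 1) = v powr (b - 1) * v ^ N"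
    using assms by (simp add: powr_add[symmetric] powr_realpow[symmetric] algebra_simps)
  have 2: "x powr (- (2 * b + real N - A)) = x powr (- 2 * b) * (1 / x) ^ N * x powr A"
  proof -
    have "x powr (- 2 * b) * (1 / x) ^ N * x powr A = x powr (- 2 * b + - real N + A)"
      unfolding inverse_power_eq_powr[OF x] powr_add ..
    also have "- 2 * b + - real N + A = - (2 * b + real N - A)" by simp
    finally show ?thesis ..
  qed
  have 3: "(1 / x) powr (- A) = x powr A"
    using x by (simp add: powr_divide powr_minus inverse_eq_divide)
  have 4: "(\<xi> * v / x) ^ N = \<xi> ^ N * v ^ N * (1 / x) ^ N"
    by (simp add: power_mult_distrib power_divide)
  have 5: "2 * b + real N - (b + real N) - 1 = b - 1" by simp
  show ?thesis
    unfolding wgt_def one_plus_mob[OF assms] unfolding mob_def x_def[symmetric] 1 2 3 4 5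
    by (simp only: mult_ac)
qed

lemma
  assumes b: "0 < b" and \<xi>: "0 \<le> \<xi>" "\<xi> \<le> 1" and conv: "\<xi> < 1 \<or> b + real N < A"
  shows integrable_wgt_moment: "integrable lborel01 (\<lambda>v. wgt b \<xi> v * mob \<xi> v ^ N * (1 + mob \<xi> v) powr (- A))"
    and integral_wgt_moment: "(LINT v|lborel01. wgt b \<xi> v * mob \<xi> v ^ N * (1 + mob \<xi> v) powr (- A))
      = Beta b b * (pochhammer b N / pochhammer (2 * b) N * \<xi> ^ N
          * gauss_F (2 * b + real N - A) (b + real N) (2 * b + real N) \<xi>)"
proof -
  let ?g = "\<lambda>v. \<xi> ^ N * (v powr (b + real N - 1) * (1 - v) powr (2 * b + real N - (b + real N) - 1)
            * (1 - \<xi> * v) powr (- (2 * b + real N - A)))"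
  have eq: "wgt b \<xi> v * mob \<xi> v ^ N * (1 + mob \<xi> v) powr (- A) = ?g v" if "v \<in> space lborel01" for v
    using wgt_moment_eq[OF \<xi>] that by simp
  have "integrable lborel01 ?g"
    by (intro integrable_mult_right integrable_Euler) (use b \<xi> conv in auto)
  also have "?this \<longleftrightarrow> integrable lborel01 (\<lambda>v. wgt b \<xi> v * mob \<xi> v ^ N * (1 + mob \<xi> v) powr (- A))"
    by (intro Bochner_Integration.integrable_cong refl) (use eq in auto)
  finally show "integrable lborel01 (\<lambda>v. wgt b \<xi> v * mob \<xi> v ^ N * (1 + mob \<xi> v) powr (- A))" .
  have "(LINT v|lborel01. wgt b \<xi> v * mob \<xi> v ^ N * (1 + mob \<xi> v) powr (- A)) = (LINT v|lborel01. ?g v)"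
    by (intro Bochner_Integration.integral_cong refl) (use eq in auto)
  also have "\<dots> = \<xi> ^ N * (Beta (b + real N) (2 * b + real N - (b + real N)) * gauss_F (2 * b + real N - A) (b +
    real N) (2 * b + real N) \<xi>)"
    by (subst integral_mult_right_zero, subst Euler_integral) (use b \<xi> conv in auto)
  finally show "(LINT v|lborel01. wgt b \<xi> v * mob \<xi> v ^ N * (1 + mob \<xi> v) powr (- A))
      = Beta b b * (pochhammer b N / pochhammer (2 * b) N * \<xi> ^ N
          * gauss_F (2 * b + real N - A) (b + real N) (2 * b + real N) \<xi>)"
    using b by (simp add: Beta_shift mult_ac)
qed

text \<open>
Without the negative power of \<open>1 + mob \<xi> v\<close> the first and third parameter of the Gauss function
coincide. The moments obtained are those of the beta density, scaled by \<open>\<xi> / (1 - \<xi>) = -\<sigma>\<close>.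
\<close>
lemma
  assumes b: "0 < b" and \<xi>: "0 \<le> \<xi>" "\<xi> < 1"
  shows integrable_wgt_power: "integrable lborel01 (\<lambda>v. wgt b \<xi> v * mob \<xi> v ^ N)"
    and integral_wgt_power: "(LINT v|lborel01. wgt b \<xi> v * mob \<xi> v ^ N)
      = Beta b b * (pochhammer b N / pochhammer (2 * b) N * (\<xi> / (1 - \<xi>)) ^ N * (1 - \<xi>) powr (- b))"
proof -
  have \<xi>': "\<xi> \<le> 1" using \<xi> by simp
  have eq: "wgt b \<xi> v * mob \<xi> v ^ N * (1 + mob \<xi> v) powr (- 0) = wgt b \<xi> v * mob \<xi> v ^ N"
    if "v \<in> space lborel01" for v
    using mob_nonneg[OF \<xi>(1) \<xi>', of v] that by simp
  have "integrable lborel01 (\<lambda>v. wgt b \<xi> v * mob \<xi> v ^ N * (1 + mob \<xi> v) powr (- 0))"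
    by (rule integrable_wgt_moment) (use assms in auto)
  also have "?this \<longleftrightarrow> integrable lborel01 (\<lambda>v. wgt b \<xi> v * mob \<xi> v ^ N)"
    by (intro Bochner_Integration.integrable_cong refl) (use eq in auto)
  finally show "integrable lborel01 (\<lambda>v. wgt b \<xi> v * mob \<xi> v ^ N)" .
  have "(LINT v|lborel01. wgt b \<xi> v * mob \<xi> v ^ N) = (LINT v|lborel01. wgt b \<xi> v * mob \<xi> v ^ N * (1 + mob \<xi> v)
    powr (- 0))"
    by (intro Bochner_Integration.integral_cong refl) (use eq in auto)
  also have "\<dots> = Beta b b * (pochhammer b N / pochhammer (2 * b) N * \<xi> ^ N
          * gauss_F (2 * b + real N - 0) (b + real N) (2 * b + real N) \<xi>)"
    by (rule integral_wgt_moment) (use assms in auto)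
  also have "gauss_F (2 * b + real N - 0) (b + real N) (2 * b + real N) \<xi> = (1 - \<xi>) powr (- (b + real N))"
    using gauss_F_cancel[of "2 * b + real N" \<xi>] assms by simp
  also have "\<dots> = (1 - \<xi>) powr (- b) * (1 / (1 - \<xi>)) ^ N"
    using \<xi> by (simp only: inverse_power_eq_powr[of "1 - \<xi>" N] diff_gt_0_iff_gt powr_add minus_add_distrib)
  finally show "(LINT v|lborel01. wgt b \<xi> v * mob \<xi> v ^ N)
      = Beta b b * (pochhammer b N / pochhammer (2 * b) N * (\<xi> / (1 - \<xi>)) ^ N * (1 - \<xi>) powr (- b))"
    by (simp add: power_divide mult_ac)
qed

text \<open>
A majorant that does not depend on \<open>\<xi>\<close>; two powers of \<open>1 - v\<close> are added since either may be the larger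
one.
\<close>
definition wgt_majorant :: "real \<Rightarrow> real \<Rightarrow> real \<Rightarrow> real" where
  "wgt_majorant b d v = v powr (b - 1) * (1 - v) powr (b - 1) + v powr (b - 1) * (1 - v) powr (d - 1)"

lemma integrable_wgt_majorant:
  assumes "0 < b" "0 < d"
  shows "integrable lborel01 (wgt_majorant b d)"
  unfolding wgt_majorant_def[abs_def] using assms by (intro Bochner_Integration.integrable_add
    integrable_lborel01_Beta) auto

text \<open>
For \<open>\<xi>\<close> near \<open>1\<close> the weight alone is of order \<open>(1 - v)\<close> to the power \<open>-b - 1\<close> at \<open>v = 1\<close>; the factor
\<open>(1 + mob \<xi> v)\<close> to the power \<open>-(b + d)\<close> with \<open>d > 0\<close> is what makes it uniformly integrable.
\<close>
lemma wgt_le_wgt_majorant: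
  assumes b: "0 < b" and d: "0 < d" and \<xi>: "0 \<le> \<xi>" "\<xi> \<le> 1" and v: "0 < v" "v < 1"
  shows "wgt b \<xi> v * (1 + mob \<xi> v) powr (- (b + d)) \<le> wgt_majorant b d v"
proof -
  note lt = xi_v_less_1[OF \<xi> v]
  have le: "1 - v \<le> 1 - \<xi> * v" using v \<xi> by (simp add: mult_left_le_one_le)
  have "wgt b \<xi> v * (1 + mob \<xi> v) powr (- (b + d)) = v powr (b - 1) * ((1 - v) powr (b - 1) * (1 - \<xi> * v) powr
    (d - b))"
    using wgt_moment_eq[OF \<xi> v, of b 0 "b + d"] by (simp add: algebra_simps)
  also have "\<dots> \<le> v powr (b - 1) * ((1 - v) powr (b - 1) + (1 - v) powr (d - 1))"
  proof (rule mult_left_mono)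
    show "(1 - v) powr (b - 1) * (1 - \<xi> * v) powr (d - b) \<le> (1 - v) powr (b - 1) + (1 - v) powr (d - 1)"
    proof (cases "d \<ge> b")
      case True
      have "(1 - \<xi> * v) powr (d - b) \<le> 1 powr (d - b)"
        by (rule powr_mono2) (use True lt v \<xi> in auto)
      hence "(1 - v) powr (b - 1) * (1 - \<xi> * v) powr (d - b) \<le> (1 - v) powr (b - 1) * 1"
        by (intro mult_left_mono) auto
      thus ?thesis by (simp add: add_increasing2)
    next
      case False
      have "(1 - \<xi> * v) powr (d - b) \<le> (1 - v) powr (d - b)"
        by (rule powr_mono2') (use False le v in auto)
      hence "(1 - v) powr (b - 1) * (1 - \<xi> * v) powr (d - b) \<le> (1 - v) powr (b - 1) * (1 - v) powr (d - b)"
        by (intro mult_left_mono) auto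
      also have "\<dots> = (1 - v) powr (d - 1)" by (simp add: powr_add[symmetric])
      finally show ?thesis by (simp add: add_increasing)
    qed
  qed auto
  finally show ?thesis by (simp add: wgt_majorant_def algebra_simps)
qed

text \<open>
The weight is not normalised; for \<open>\<xi>\<^sub>j < 1\<close> its total mass is the product of the three numbers
\<open>B(b\<^sub>j, b\<^sub>j)\<close> divided by the powers of \<open>1 - \<xi>\<^sub>j\<close> with exponent \<open>b\<^sub>j\<close>.
\<close>
definition wgt3 :: "real \<Rightarrow> real \<Rightarrow> real \<Rightarrow> real \<Rightarrow> real \<Rightarrow> real \<Rightarrow> real \<times> real \<times> real \<Rightarrow> real" where
  "wgt3 b1 b2 b3 \<xi>1 \<xi>2 \<xi>3 v = wgt b1 \<xi>1 (fst v) * wgt b2 \<xi>2 (fst (snd v)) * wgt b3 \<xi>3 (snd (snd v))"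

definition mob3 :: "real \<Rightarrow> real \<Rightarrow> real \<Rightarrow> real \<times> real \<times> real \<Rightarrow> real" where
  "mob3 \<xi>1 \<xi>2 \<xi>3 v = mob \<xi>1 (fst v) + mob \<xi>2 (fst (snd v)) + mob \<xi>3 (snd (snd v))"

lemma wgt3_nonneg: "0 \<le> wgt3 b1 b2 b3 \<xi>1 \<xi>2 \<xi>3 v"
  by (simp add: wgt3_def wgt_nonneg)

lemma measurable_wgt3_mob3 [measurable]:
  "wgt3 b1 b2 b3 \<xi>1 \<xi>2 \<xi>3 \<in> borel_measurable cube" "mob3 \<xi>1 \<xi>2 \<xi>3 \<in> borel_measurable cube"
  unfolding wgt3_def[abs_def] mob3_def[abs_def] by measurable

definition wgt3_majorant :: "real \<Rightarrow> real \<Rightarrow> real \<Rightarrow> real \<Rightarrow> real \<times> real \<times> real \<Rightarrow> real" where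
  "wgt3_majorant b1 b2 b3 a v = (let d = (a - (b1 + b2 + b3)) / 3 in
     wgt_majorant b1 d (fst v) * wgt_majorant b2 d (fst (snd v)) * wgt_majorant b3 d (snd (snd v)))"

lemma integrable_wgt3_majorant:
  assumes "0 < b1" "0 < b2" "0 < b3" "b1 + b2 + b3 < a"
  shows "integrable cube (wgt3_majorant b1 b2 b3 a)"
  unfolding wgt3_majorant_def[abs_def] Let_def
  by (rule integrable_cube_product) (use assms in \<open>auto intro!: integrable_wgt_majorant\<close>)

text \<open>
The surplus \<open>a - (b\<^sub>1 + b\<^sub>2 + b\<^sub>3) > 0\<close> is shared equally among the variables, and
\<open>1 + mob3 \<xi>\<^sub>1 \<xi>\<^sub>2 \<xi>\<^sub>3 v\<close> dominates each \<open>1 + mob \<xi>\<^sub>j v\<^sub>j\<close>.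
\<close>
lemma wgt3_le_wgt3_majorant:
  assumes b: "0 < b1" "0 < b2" "0 < b3" "b1 + b2 + b3 < a"
    and \<xi>: "0 \<le> \<xi>1" "\<xi>1 \<le> 1" "0 \<le> \<xi>2" "\<xi>2 \<le> 1" "0 \<le> \<xi>3" "\<xi>3 \<le> 1"
    and v: "v \<in> space cube"
  shows "wgt3 b1 b2 b3 \<xi>1 \<xi>2 \<xi>3 v * (1 + mob3 \<xi>1 \<xi>2 \<xi>3 v) powr (- a) \<le> wgt3_majorant b1 b2 b3 a v"
proof -
  \<comment> \<open>chosen such that the exponents \<open>b\<^sub>j + d\<close> add up to \<open>a\<close>\<close>
  define d where "d = (a - (b1 + b2 + b3)) / 3"
  have d: "0 < d" using b by (simp add: d_def)
  obtain v1 v2 v3 where veq: "v = (v1, v2, v3)" by (cases v)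
  have v': "0 < v1" "v1 < 1" "0 < v2" "v2 < 1" "0 < v3" "v3 < 1" using v by (auto simp: space_cube veq)
  define t1 t2 t3 where t_def: "t1 = mob \<xi>1 v1" "t2 = mob \<xi>2 v2" "t3 = mob \<xi>3 v3"
  have t: "0 \<le> t1" "0 \<le> t2" "0 \<le> t3" unfolding t_def using mob_nonneg \<xi> v' by auto
  have a: "a = (b1 + d) + (b2 + d) + (b3 + d)" unfolding d_def by (simp add: field_simps)
  have "(1 + (t1 + t2 + t3)) powr (- a) = (1 + (t1 + t2 + t3)) powr (- (b1 + d)) * (1 + (t1 + t2 + t3)) powr (-
    (b2 + d)) * (1 + (t1 + t2 + t3)) powr (- (b3 + d))"
    unfolding a by (simp add: powr_add[symmetric])
  also have "\<dots> \<le> (1 + t1) powr (- (b1 + d)) * (1 + t2) powr (- (b2 + d)) * (1 + t3) powr (- (b3 + d))"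
    by (intro mult_mono powr_mono2') (use t d b in auto)
  finally have "wgt3 b1 b2 b3 \<xi>1 \<xi>2 \<xi>3 v * (1 + mob3 \<xi>1 \<xi>2 \<xi>3 v) powr (- a) \<le>
     wgt b1 \<xi>1 v1 * wgt b2 \<xi>2 v2 * wgt b3 \<xi>3 v3 * ((1 + t1) powr (- (b1 + d)) * (1 + t2) powr (- (b2 + d)) * (1
       + t3) powr (- (b3 + d)))"
    unfolding wgt3_def mob3_def veq fst_conv snd_conv t_def[symmetric]
    by (intro mult_left_mono mult_nonneg_nonneg wgt_nonneg)
  also have "\<dots> = (wgt b1 \<xi>1 v1 * (1 + t1) powr (- (b1 + d))) * (wgt b2 \<xi>2 v2 * (1 + t2) powr (- (b2 + d))) *
    (wgt b3 \<xi>3 v3 * (1 + t3) powr (- (b3 + d)))"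
    by (simp add: mult_ac)
  also have "\<dots> \<le> wgt_majorant b1 d v1 * wgt_majorant b2 d v2 * wgt_majorant b3 d v3"
    unfolding t_def
    by (intro mult_mono wgt_le_wgt_majorant mult_nonneg_nonneg wgt_nonneg) (use b d \<xi> v' in \<open>auto simp:
      wgt_majorant_def\<close>)
  finally show ?thesis by (simp add: wgt3_majorant_def Let_def d_def veq)
qed

lemma integrable_wgt3:
  assumes b: "0 < b1" "0 < b2" "0 < b3" "b1 + b2 + b3 < a"
    and \<xi>: "0 \<le> \<xi>1" "\<xi>1 \<le> 1" "0 \<le> \<xi>2" "\<xi>2 \<le> 1" "0 \<le> \<xi>3" "\<xi>3 \<le> 1"
  shows "integrable cube (\<lambda>v. wgt3 b1 b2 b3 \<xi>1 \<xi>2 \<xi>3 v * (1 + mob3 \<xi>1 \<xi>2 \<xi>3 v) powr (- a))"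
proof (rule Bochner_Integration.integrable_bound[OF integrable_wgt3_majorant[OF b]])
  show "AE v in cube. norm (wgt3 b1 b2 b3 \<xi>1 \<xi>2 \<xi>3 v * (1 + mob3 \<xi>1 \<xi>2 \<xi>3 v) powr (- a)) \<le> norm (wgt3_majorant
    b1 b2 b3 a v)"
    using wgt3_le_wgt3_majorant[OF b \<xi>] by (auto intro!: AE_I2 order.trans[OF _ abs_ge_self] simp: wgt3_nonneg)
qed measurable

lemma mob3_nonneg:
  assumes "0 \<le> \<xi>1" "\<xi>1 \<le> 1" "0 \<le> \<xi>2" "\<xi>2 \<le> 1" "0 \<le> \<xi>3" "\<xi>3 \<le> 1" "v \<in> space cube"
  shows "0 \<le> mob3 \<xi>1 \<xi>2 \<xi>3 v"
  using assms by (auto simp: mob3_def space_cube intro!: add_nonneg_nonneg mob_nonneg)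

section \<open>Confluent series and the decomposition of a power\<close>

text \<open>
Even for negative noninteger \<open>c\<close>, where the Pochhammer symbols may be small at first, the series of
\<open>\<^sub>0F\<^sub>1\<close> is dominated by a multiple of the exponential series.
\<close>
lemma pochhammer_inverse_bounded:
  fixes c :: real
  assumes "c \<notin> \<int>\<^sub>\<le>\<^sub>0"
  shows "\<exists>K>0. \<forall>n. \<bar>1 / pochhammer c n\<bar> \<le> K"
proof -
  have nz: "pochhammer c n \<noteq> 0" for n
    using assms by (auto simp: pochhammer_eq_0_iff)
  \<comment> \<open>beyond this index all further factors of the Pochhammer symbol are at least one\<close>
  obtain N :: nat where N: "real N \<ge> 1 - c" using real_arch_simple by blast
  define K where "K = (\<Sum>n\<le>N. \<bar>1 / pochhammer c n\<bar>)"
  have leK: "\<bar>1 / pochhammer c n\<bar> \<le> K" if "n \<le> N" for n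
    unfolding K_def by (rule member_le_sum) (use that in auto)
  have "\<bar>1 / pochhammer c n\<bar> \<le> K" for n
  proof (cases "n \<le> N")
    case False
    have "1 \<le> pochhammer (c + real N) (n - N)"
      unfolding pochhammer_prod using N by (intro prod_ge_1) auto
    moreover have "pochhammer c n = pochhammer c N * pochhammer (c + real N) (n - N)"
      using pochhammer_product[of N n c] False by simp
    ultimately have "\<bar>pochhammer c N\<bar> \<le> \<bar>pochhammer c n\<bar>"
      by (simp add: abs_mult mult_le_cancel_left1)
    hence "\<bar>1 / pochhammer c n\<bar> \<le> \<bar>1 / pochhammer c N\<bar>"
      using nz by (simp add: abs_divide frac_le)
    thus ?thesis using leK[of N] by simp
  qed (rule leK)
  moreover have "K > 0" using leK[of 0] by simp
  ultimately show ?thesis by blast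
qed

lemma summable_0F1:
  fixes c x :: real
  assumes "c \<notin> \<int>\<^sub>\<le>\<^sub>0" "0 \<le> x"
  shows "summable (\<lambda>n. \<bar>1 / pochhammer c n\<bar> * x ^ n / fact n)"
proof -
  obtain K where K: "\<And>n. \<bar>1 / pochhammer c n\<bar> \<le> K"
    using pochhammer_inverse_bounded[OF assms(1)] by blast
  show ?thesis
  proof (rule summable_comparison_test')
    show "summable (\<lambda>n. K * (inverse (fact n) * x ^ n))" by (intro summable_mult summable_exp)
    show "norm (\<bar>1 / pochhammer c n\<bar> * x ^ n / fact n) \<le> K * (inverse (fact n) * x ^ n)" for n
      using mult_right_mono[OF K[of n], of "x ^ n / fact n"] assms(2)
      by (simp add: divide_inverse mult_ac)
  qed
qed

lemma summable_on_0F1: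
  fixes c x :: real
  assumes "c \<notin> \<int>\<^sub>\<le>\<^sub>0" "0 \<le> x"
  shows "(\<lambda>n. norm (complex_of_real (1 / pochhammer c n)) * x ^ n / fact n) summable_on UNIV"
  by (rule norm_summable_imp_summable_on)
     (use summable_0F1[OF assms] assms(2) in \<open>simp add: abs_mult norm_divide\<close>)

lemma hyp_0F1_has_sum:
  fixes c :: real
  assumes "c \<notin> \<int>\<^sub>\<le>\<^sub>0"
  shows "((\<lambda>n. of_real (1 / pochhammer c n) * z ^ n / fact n) has_sum hyp_0F1 c z) UNIV"
proof (rule norm_summable_imp_has_sum)
  show s: "summable (\<lambda>n. norm (complex_of_real (1 / pochhammer c n) * z ^ n / fact n))"
    using summable_0F1[OF assms, of "norm z"] by (simp add: norm_mult norm_divide norm_power)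
  show "(\<lambda>n. of_real (1 / pochhammer c n) * z ^ n / fact n) sums hyp_0F1 c z"
    using summable_sums[OF summable_norm_cancel[OF s]] by (simp add: hyp_0F1_def)
qed

lemma hyp_0F1_0 [simp]: "hyp_0F1 c 0 = 1"
  using powser_zero[of "\<lambda>n. 1 / (complex_of_real (pochhammer c n) * fact n)"]
  by (simp add: hyp_0F1_def divide_inverse mult_ac)

text \<open>
The Taylor coefficient of order \<open>q\<close> of \<open>y \<mapsto> \<^sub>0F\<^sub>1(c; \<tau> (1 + y))\<close> at \<open>y = 0\<close>.
\<close>
definition taylor_coeff :: "real \<Rightarrow> complex \<Rightarrow> nat \<Rightarrow> complex" where
  "taylor_coeff c \<tau> q = of_real (1 / (pochhammer c q * fact q)) * \<tau> ^ q * hyp_0F1 (c + real q) \<tau>"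

lemma nonpos_Ints_add_nat: "(c::real) \<notin> \<int>\<^sub>\<le>\<^sub>0 \<Longrightarrow> c + real q \<notin> \<int>\<^sub>\<le>\<^sub>0"
  by (metis add_diff_cancel_right' nonpos_Ints_diff_Nats of_nat_in_Nats)

text \<open>
Split \<open>(\<tau> y + \<tau>)\<^sup>N / N!\<close> in the series of \<open>\<^sub>0F\<^sub>1\<close> and use
\<open>(c)\<^sub>q\<^sub>+\<^sub>p = (c)\<^sub>q (c + q)\<^sub>p\<close>.
\<close>
lemma
  fixes c y :: real
  assumes c: "c \<notin> \<int>\<^sub>\<le>\<^sub>0" and y: "0 \<le> y"
  shows hyp_0F1_Taylor: "((\<lambda>q. taylor_coeff c \<tau> q * of_real y ^ q) has_sum hyp_0F1 c (\<tau> * of_real (1 + y)))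
    UNIV"
    and summable_taylor_coeff: "(\<lambda>q. norm (taylor_coeff c \<tau> q) * y ^ q) summable_on UNIV"
proof -
  let ?g = "\<lambda>(q, p). complex_of_real (1 / pochhammer c (q + p)) * (\<tau> * of_real y) ^ q * \<tau> ^ p / (fact q * fact
    p)"
  have hs: "(?g has_sum hyp_0F1 c (\<tau> * of_real (1 + y))) UNIV"
    by (rule exp_generating_2)
       (use hyp_0F1_has_sum[OF c, of "\<tau> * of_real (1 + y)"]
         summable_on_0F1[OF c, of "norm (\<tau> * of_real y) + norm \<tau>"] in \<open>simp_all add: algebra_simps\<close>)
  have in1: "((\<lambda>p. ?g (q, p)) has_sum (taylor_coeff c \<tau> q * of_real y ^ q)) UNIV" for q
  proof -
    have "((\<lambda>p. (of_real (1 / (pochhammer c q * fact q)) * (\<tau> * of_real y) ^ q) * (of_real (1 / pochhammer (c +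
      real q) p) * \<tau> ^ p / fact p))
      has_sum ((of_real (1 / (pochhammer c q * fact q)) * (\<tau> * of_real y) ^ q) * hyp_0F1 (c + real q) \<tau>)) UNIV"
      by (intro has_sum_cmult_right hyp_0F1_has_sum nonpos_Ints_add_nat c)
    thus ?thesis by (simp add: taylor_coeff_def pochhammer_product' power_mult_distrib mult_ac)
  qed
  show "((\<lambda>q. taylor_coeff c \<tau> q * of_real y ^ q) has_sum hyp_0F1 c (\<tau> * of_real (1 + y))) UNIV"
    by (rule has_sum_SigmaD[where f = ?g and A = UNIV and B = "\<lambda>_. UNIV"]) (use hs in1 in auto)
  have "(\<lambda>z. norm (?g z)) summable_on UNIV \<times> UNIV"
    using hs summable_on_iff_abs_summable_on_complex[of ?g UNIV] by (auto simp: summable_on_def)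
  from iffD1[OF Infinite_Sum.abs_summable_on_Sigma_iff this]
  have ab: "(\<lambda>q. norm (infsum (\<lambda>p. norm (?g (q, p))) UNIV)) summable_on UNIV"
    "\<And>q. (\<lambda>p. norm (?g (q, p))) summable_on UNIV"
    by blast+
  show "(\<lambda>q. norm (taylor_coeff c \<tau> q) * y ^ q) summable_on UNIV"
  proof (rule summable_on_comparison_test)
    show "(\<lambda>q. infsum (\<lambda>p. norm (?g (q, p))) UNIV) summable_on UNIV"
      using abs_summable_summable[OF ab(1)] .
    show "norm (taylor_coeff c \<tau> q) * y ^ q \<le> infsum (\<lambda>p. norm (?g (q, p))) UNIV" for q
    proof -
      have "norm (taylor_coeff c \<tau> q * of_real y ^ q) \<le> infsum (\<lambda>p. norm (?g (q, p))) UNIV"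
        by (rule norm_has_sum_bound[OF has_sum_infsum[OF ab(2)] in1])
      thus ?thesis using y by (simp add: norm_mult norm_power)
    qed
  qed (use y in auto)
qed

text \<open>
For \<open>s, q \<ge> 1\<close> the number \<open>A(s, q) (s choose q)\<close> is \<open>s - 1\<close> choose \<open>q - 1\<close>, so this is the negative binomial
series, shifted by \<open>q\<close>. For \<open>q = 0\<close> only \<open>s = 0\<close> contributes, in accordance with \<open>A(0, 0) = 1\<close>.
\<close>
lemma A_num_binomial_has_sum:
  fixes x :: real
  assumes "0 \<le> x" "x < 1"
  shows "((\<lambda>s. A_num s q * real (s choose q) * x ^ s) has_sum (x / (1 - x)) ^ q) UNIV"
proof (cases q)
  case 0
  have "((\<lambda>s. A_num s q * real (s choose q) * x ^ s) has_sum 1) {0}"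
    using has_sum_finite[of "{0}" "\<lambda>s. A_num s q * real (s choose q) * x ^ s"] by (simp add: A_num_def 0)
  also have "?this \<longleftrightarrow> ((\<lambda>s. A_num s q * real (s choose q) * x ^ s) has_sum 1) UNIV"
    by (rule has_sum_cong_neutral) (auto simp: A_num_def 0)
  finally show ?thesis using 0 by simp
next
  case (Suc q')
  have "((\<lambda>n. x ^ q * (pochhammer (real q) n * x ^ n / fact n)) has_sum (x ^ q * (1 - x) powr (- real q))) UNIV"
    by (intro has_sum_cmult_right pochhammer_binomial_has_sum) (use assms in auto)
  moreover have "x ^ q * (1 - x) powr (- real q) = (x / (1 - x)) ^ q"
    using assms by (simp add: power_divide flip: inverse_power_eq_powr)
  moreover have "x ^ q * (pochhammer (real q) n * x ^ n / fact n) =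
      A_num (q + n) q * real ((q + n) choose q) * x ^ (q + n)" for n
  proof -
    have "pochhammer (real q) n = fact (q' + n) / fact q'"
    proof -
      have "fact q' * pochhammer (real q) n = pochhammer 1 q' * pochhammer (1 + real q') n"
        by (simp add: Suc pochhammer_fact)
      also have "\<dots> = pochhammer 1 (q' + n)" by (simp add: pochhammer_product')
      also have "\<dots> = fact (q' + n)" by (simp add: pochhammer_fact)
      finally show ?thesis by (simp add: field_simps)
    qed
    moreover have "real ((q + n) choose q) = fact (q + n) / (fact q * fact n)"
      by (simp add: binomial_fact)
    moreover have "fact (q + n) = real (q + n) * fact (q' + n)" "fact q = real q * fact q'"
      by (simp_all add: Suc)
    moreover have "q > 0" by (simp add: Suc)
    ultimately show ?thesis
      by (simp add: A_num_def power_add del: of_nat_add)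
  qed
  ultimately have "((\<lambda>n. A_num (q + n) q * real ((q + n) choose q) * x ^ (q + n)) has_sum (x / (1 - x)) ^ q)
    UNIV"
    by simp
  also have "?this \<longleftrightarrow> ((\<lambda>s. A_num s q * real (s choose q) * x ^ s) has_sum (x / (1 - x)) ^ q) {q..}"
    by (rule has_sum_reindex_bij_witness[of _ "\<lambda>s. s - q" "\<lambda>n. q + n"]) auto
  also have "\<dots> \<longleftrightarrow> ?thesis"
    by (rule has_sum_cong_neutral) auto
  finally show ?thesis .
qed

definition inner_sum :: "real \<Rightarrow> complex \<Rightarrow> nat \<Rightarrow> complex" where
  "inner_sum c \<tau> s = (\<Sum>q=0..s. of_real (A_num s q * real (s choose q)) * taylor_coeff c \<tau> q)"

text \<open>
With \<open>x = T / (1 + T)\<close> one has \<open>x / (1 - x) = T\<close>, and the sum is \<open>\<^sub>0F\<^sub>1(c; \<tau> (1 + T))\<close>. Unlike \<open>T\<close>,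
the quotient \<open>x\<close> stays below \<open>1\<close>, so multiplying by \<open>x\<^sup>s\<close> does not harm integrability even when
\<open>T\<close> is unbounded.
\<close>
lemma
  fixes c x :: real
  assumes c: "c \<notin> \<int>\<^sub>\<le>\<^sub>0" and x: "0 \<le> x" "x < 1"
  shows inner_sum_has_sum: "((\<lambda>s. inner_sum c \<tau> s * of_real x ^ s) has_sum hyp_0F1 c (\<tau> * of_real (1 / (1 -
    x)))) UNIV"
    and summable_inner_sum: "(\<lambda>s. norm (inner_sum c \<tau> s) * x ^ s) summable_on UNIV"
proof -
  define y where "y = x / (1 - x)"
  have y: "0 \<le> y" "1 + y = 1 / (1 - x)" using x by (auto simp: y_def field_simps)
  have A0: "0 \<le> A_num s q" for s q by (simp add: A_num_def)
  let ?g = "\<lambda>(q, s). of_real (A_num s q * real (s choose q) * x ^ s) * taylor_coeff c \<tau> q"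
  have in1: "((\<lambda>s. ?g (q, s)) has_sum taylor_coeff c \<tau> q * of_real y ^ q) UNIV" for q
    using has_sum_cmult_left[OF has_sum_of_real[OF A_num_binomial_has_sum[OF x, of q]], of "taylor_coeff c \<tau> q"]
    by (simp add: y_def mult_ac)
  have in1n: "((\<lambda>s. norm (?g (q, s))) has_sum norm (taylor_coeff c \<tau> q) * y ^ q) UNIV" for q
    using has_sum_cmult_left[OF A_num_binomial_has_sum[OF x, of q], of "norm (taylor_coeff c \<tau> q)"] x A0
    by (simp add: y_def mult_ac norm_mult norm_power abs_mult)
  have "(\<lambda>z. norm (?g z)) summable_on UNIV \<times> UNIV"
    by (rule summable_on_SigmaI[OF in1n]) (use summable_taylor_coeff[OF c y(1)] in auto)
  hence g1: "?g summable_on UNIV \<times> UNIV" by (rule abs_summable_summable)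
  have "(?g has_sum hyp_0F1 c (\<tau> * of_real (1 + y))) (UNIV \<times> UNIV)"
    by (rule has_sum_SigmaI[OF in1 hyp_0F1_Taylor[OF c y(1)] g1])
  hence hs: "((\<lambda>(s, q). ?g (q, s)) has_sum hyp_0F1 c (\<tau> * of_real (1 + y))) (UNIV \<times> UNIV)"
    by (subst (asm) has_sum_swap) simp
  have in2: "((\<lambda>q. (\<lambda>(s, q). ?g (q, s)) (s, q)) has_sum inner_sum c \<tau> s * of_real x ^ s) UNIV" for s
  proof -
    have "((\<lambda>q. ?g (q, s)) has_sum (\<Sum>q=0..s. ?g (q, s))) {0..s}" by (rule has_sum_finite) auto
    also have "?this \<longleftrightarrow> ((\<lambda>q. ?g (q, s)) has_sum (\<Sum>q=0..s. ?g (q, s))) UNIV"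
      by (rule has_sum_cong_neutral) auto
    also have "(\<Sum>q=0..s. ?g (q, s)) = inner_sum c \<tau> s * of_real x ^ s"
      by (simp add: inner_sum_def sum_distrib_left sum_distrib_right mult_ac)
    finally show ?thesis by simp
  qed
  show "((\<lambda>s. inner_sum c \<tau> s * of_real x ^ s) has_sum hyp_0F1 c (\<tau> * of_real (1 / (1 - x)))) UNIV"
    using has_sum_SigmaD[OF hs in2] y(2) by simp
  hence "(\<lambda>s. norm (inner_sum c \<tau> s * of_real x ^ s)) summable_on UNIV"
    using summable_on_iff_abs_summable_on_complex[of "\<lambda>s. inner_sum c \<tau> s * of_real x ^ s" UNIV]
    by (auto simp: summable_on_def)
  thus "(\<lambda>s. norm (inner_sum c \<tau> s) * x ^ s) summable_on UNIV"
    using x by (simp add: norm_mult norm_power)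
qed

text \<open>
A product of functions of one variable; integrating it against the weights leads to a product of three
Gauss functions. The unequal exponents come from applying the two-variable Burchnall--Chaundy
decomposition twice.
\<close>
definition bc_kernel :: "real \<Rightarrow> real \<Rightarrow> real \<Rightarrow> real \<Rightarrow> nat \<Rightarrow> nat \<Rightarrow> nat \<Rightarrow> real" where
  "bc_kernel c X Y Z l m n = X ^ (l + m) * (1 + X) powr (- (c + real (l + m)))
     * (Y ^ (l + n) * (1 + Y) powr (- (c + real (l + m + n))))
     * (Z ^ (m + n) * (1 + Z) powr (- (c + real (l + m + n))))"

text \<open>
Dividing \<open>1 + X + Y + Z\<close> by \<open>(1 + X)(1 + Y)(1 + Z)\<close> gives \<open>1 - (P + Q + R)\<close> with
\<open>P, Q, R \<ge> 0\<close> that factor into functions of one variable; the trinomial series in \<open>P, Q, R\<close> is the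
decomposition.
\<close>
lemma bc_kernel_has_sum:
  fixes X Y Z c :: real
  assumes "0 \<le> X" "0 \<le> Y" "0 \<le> Z"
  shows "((\<lambda>(l, m, n). pochhammer c (l + m + n) / (fact l * fact m * fact n) * bc_kernel c X Y Z l m n)
      has_sum (1 + (X + Y + Z)) powr (- c)) UNIV"
proof -
  define P Q R where "P = X * Y / ((1 + X) * (1 + Y) * (1 + Z))" and
    "Q = X * Z / ((1 + X) * (1 + Y) * (1 + Z))" and "R = Y * Z / ((1 + Y) * (1 + Z))"
  define D where "D = (1 + X) * (1 + Y) * (1 + Z)"
  have D: "D > 0" using assms by (simp add: D_def)
  have pos: "0 \<le> P" "0 \<le> Q" "0 \<le> R" using assms by (auto simp: P_def Q_def R_def)
  have R': "R = Y * Z * (1 + X) / D" using assms by (simp add: R_def D_def)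
  have "D * P = X * Y" "D * Q = X * Z" "D * R = Y * Z * (1 + X)"
    using D unfolding P_def Q_def R' D_def[symmetric] by simp_all
  hence "D * (P + Q + R) = X * Y + X * Z + Y * Z * (1 + X)"
    by (simp only: distrib_left)
  hence key: "D * (1 - (P + Q + R)) = 1 + (X + Y + Z)"
    unfolding right_diff_distrib by (simp add: D_def algebra_simps)
  hence lt: "P + Q + R < 1" using D assms
    by (metis add_nonneg_nonneg add_pos_nonneg diff_gt_0_iff_gt zero_less_mult_pos zero_less_one)
  have "((\<lambda>(l, m, n). pochhammer c (l + m + n) * P ^ l * Q ^ m * R ^ n / (fact l * fact m * fact n))
      has_sum (1 - (P + Q + R)) powr (- c)) UNIV"
  proof (rule exp_generating_3)
    show "((\<lambda>p. pochhammer c p * (P + Q + R) ^ p / fact p) has_sum (1 - (P + Q + R)) powr (- c)) UNIV"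
      by (rule pochhammer_binomial_has_sum) (use lt pos in auto)
    have "summable (\<lambda>p. \<bar>pochhammer c p\<bar> * \<bar>P + Q + R\<bar> ^ p / fact p)"
      by (rule summable_abs_pochhammer) (use lt pos in auto)
    thus "(\<lambda>p. norm (pochhammer c p) * (norm P + norm Q + norm R) ^ p / fact p) summable_on UNIV"
      using pos by (intro norm_summable_imp_summable_on) (auto simp: abs_mult power_abs)
  qed
  from has_sum_cmult_right[OF this, of "D powr (- c)"]
  have A: "((\<lambda>(l, m, n). D powr (- c) * (pochhammer c (l + m + n) * P ^ l * Q ^ m * R ^ n / (fact l * fact m *
    fact n)))
      has_sum D powr (- c) * (1 - (P + Q + R)) powr (- c)) UNIV"
    by (simp add: case_prod_unfold)
  have B: "D powr (- c) * (1 - (P + Q + R)) powr (- c) = (1 + (X + Y + Z)) powr (- c)"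
    using D lt key by (simp add: powr_mult[symmetric])
  have C: "D powr (- c) * (pochhammer c (l + m + n) * P ^ l * Q ^ m * R ^ n / (fact l * fact m * fact n))
      = pochhammer c (l + m + n) / (fact l * fact m * fact n) * bc_kernel c X Y Z l m n" for l m n
  proof -
    have pw: "(1 + U) powr (- (c + real k)) = (1 + U) powr (- c) * (1 / (1 + U)) ^ k" if "0 \<le> U" for U k
      using that by (simp add: inverse_power_eq_powr powr_add[symmetric])
    define u v w where "u = 1 / (1 + X)" and "v = 1 / (1 + Y)" and "w = 1 / (1 + Z)"
    define u' v' w' where "u' = (1 + X) powr (- c)" and "v' = (1 + Y) powr (- c)" and "w' = (1 + Z) powr (- c)"
    have "D powr (- c) = u' * v' * w'"
      using assms by (simp add: D_def powr_mult u'_def v'_def w'_def)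
    moreover have "P = X * Y * u * v * w" "Q = X * Z * u * v * w" "R = Y * Z * v * w"
      by (simp_all add: P_def Q_def R_def u_def v_def w_def)
    ultimately show ?thesis
      unfolding bc_kernel_def pw[OF assms(1)] pw[OF assms(2)] pw[OF assms(3)]
        u_def[symmetric] v_def[symmetric] w_def[symmetric] u'_def[symmetric] v'_def[symmetric] w'_def[symmetric]
      by (simp add: power_mult_distrib power_add)
  qed
  show ?thesis using A unfolding B C .
qed

lemma sum_triples:
  "(\<Sum>(i, j, k)\<in>{(i, j, k). i + j + k = s}. f i j k) = (\<Sum>i\<le>s. \<Sum>j\<le>s - i. f i j (s - i - j))"
  for f :: "nat \<Rightarrow> nat \<Rightarrow> nat \<Rightarrow> 'a::comm_monoid_add"
proof -
  have "(\<Sum>i\<le>s. \<Sum>j\<le>s - i. f i j (s - i - j)) = (\<Sum>(i, j)\<in>Sigma {..s} (\<lambda>i. {..s - i}). f i j (s - i - j))"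
    by (rule sum.Sigma) auto
  also have "\<dots> = (\<Sum>(i, j, k)\<in>{(i, j, k). i + j + k = s}. f i j k)"
    by (rule sum.reindex_bij_witness[of _ "\<lambda>(i, j, k). (i, j)" "\<lambda>(i, j). (i, j, s - i - j)"]) auto
  finally show ?thesis ..
qed

lemma trinomial:
  fixes X Y Z :: real
  shows "(\<Sum>(i, j, k)\<in>{(i, j, k). i + j + k = s}. fact s / (fact i * fact j * fact k) * (X ^ i * Y ^ j * Z ^ k))
    = (X + Y + Z) ^ s"
proof -
  have "(X + Y + Z) ^ s = (\<Sum>i\<le>s. real (s choose i) * X ^ i * (Y + Z) ^ (s - i))"
    unfolding add.assoc by (rule binomial_ring)
  also have "\<dots> = (\<Sum>i\<le>s. \<Sum>j\<le>s - i. fact s / (fact i * fact j * fact (s - i - j)) * (X ^ i * Y ^ j * Z ^ (s - i -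
    j)))"
    unfolding binomial_ring[of Y Z] sum_distrib_left
    by (intro sum.cong refl) (simp add: binomial_fact)
  finally show ?thesis unfolding sum_triples by simp
qed

section \<open>The series for f as an integral over the cube\<close>

text \<open>
Euler's integral for \<open>H\<close> in the variables \<open>v\<close>, apart from the normalisation of the weight and with
\<open>\<tau> = -\<sigma>\<^sub>4\<close>.
\<close>
definition cube_int :: "real \<Rightarrow> real \<Rightarrow> real \<Rightarrow> real \<Rightarrow> real \<Rightarrow> real \<Rightarrow> real \<Rightarrow> complex \<Rightarrow> complex" where
  "cube_int b1 b2 b3 a \<xi>1 \<xi>2 \<xi>3 \<tau> = (LINT v|cube.
     of_real (wgt3 b1 b2 b3 \<xi>1 \<xi>2 \<xi>3 v * (1 + mob3 \<xi>1 \<xi>2 \<xi>3 v) powr (- a))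
       * hyp_0F1 (1 - a) (\<tau> * of_real (1 + mob3 \<xi>1 \<xi>2 \<xi>3 v)))"

definition gauss_moment :: "real \<Rightarrow> real \<Rightarrow> nat \<Rightarrow> real \<Rightarrow> real" where
  "gauss_moment b \<xi> N A = pochhammer b N / pochhammer (2 * b) N * \<xi> ^ N * gauss_F (2 * b + real N - A) (b + real
    N) (2 * b + real N) \<xi>"

definition bc_kernel3 :: "real \<Rightarrow> real \<Rightarrow> real \<Rightarrow> real \<Rightarrow> nat \<Rightarrow> nat \<Rightarrow> nat \<Rightarrow> real \<times> real \<times> real \<Rightarrow> real" where
  "bc_kernel3 c \<xi>1 \<xi>2 \<xi>3 l m n v = bc_kernel c (mob \<xi>1 (fst v)) (mob \<xi>2 (fst (snd v))) (mob \<xi>3 (snd (snd v))) l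
    m n"

definition mob_monomial :: "real \<Rightarrow> real \<Rightarrow> real \<Rightarrow> nat \<Rightarrow> nat \<Rightarrow> nat \<Rightarrow> real \<times> real \<times> real \<Rightarrow> real" where
  "mob_monomial \<xi>1 \<xi>2 \<xi>3 i j k v = mob \<xi>1 (fst v) ^ i * mob \<xi>2 (fst (snd v)) ^ j * mob \<xi>3 (snd (snd v)) ^ k"

lemma measurable_bc_kernel3_mob_monomial [measurable]:
  "bc_kernel3 c \<xi>1 \<xi>2 \<xi>3 l m n \<in> borel_measurable cube" "mob_monomial \<xi>1 \<xi>2 \<xi>3 i j k \<in> borel_measurable cube"
  unfolding bc_kernel3_def[abs_def] mob_monomial_def[abs_def] bc_kernel_def by measurable

lemma mob3_power: "mob3 \<xi>1 \<xi>2 \<xi>3 v ^ s =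
   (\<Sum>(i, j, k)\<in>{(i, j, k). i + j + k = s}. fact s / (fact i * fact j * fact k) * mob_monomial \<xi>1 \<xi>2 \<xi>3 i j k v)"
  unfolding mob3_def mob_monomial_def trinomial ..

text \<open>
The three exponents of \<open>1 + mob\<close> are \<open>a + s + l + m\<close>, \<open>a + s + l + m + n\<close> and
\<open>a + s + l + m + n\<close>. Since \<open>s = i + j + k\<close> and each \<open>b\<close> is less than \<open>a\<close>, Gauss's condition holds for each
factor, so \<open>\<xi>\<^sub>j = 1\<close> is admitted.
\<close>
lemma
  fixes i j k l m n :: nat
  defines "s \<equiv> i + j + k"
  assumes b: "0 < b1" "0 < b2" "0 < b3" "b1 + b2 + b3 < a"
    and \<xi>: "0 \<le> \<xi>1" "\<xi>1 \<le> 1" "0 \<le> \<xi>2" "\<xi>2 \<le> 1" "0 \<le> \<xi>3" "\<xi>3 \<le> 1"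
  shows integrable_kernel: "integrable cube (\<lambda>v. wgt3 b1 b2 b3 \<xi>1 \<xi>2 \<xi>3 v * (mob_monomial \<xi>1 \<xi>2 \<xi>3 i j k v *
    bc_kernel3 (a + real s) \<xi>1 \<xi>2 \<xi>3 l m n v))"
    and integral_kernel: "(LINT v|cube. wgt3 b1 b2 b3 \<xi>1 \<xi>2 \<xi>3 v * (mob_monomial \<xi>1 \<xi>2 \<xi>3 i j k v * bc_kernel3
      (a + real s) \<xi>1 \<xi>2 \<xi>3 l m n v))
      = Beta b1 b1 * Beta b2 b2 * Beta b3 b3 *
        (gauss_moment b1 \<xi>1 (i + l + m) (a + real (s + l + m)) * gauss_moment b2 \<xi>2 (j + l + n) (a + real (s + l
          + m + n))
          * gauss_moment b3 \<xi>3 (k + m + n) (a + real (s + l + m + n)))"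
proof -
  let ?f1 = "\<lambda>v. wgt b1 \<xi>1 v * mob \<xi>1 v ^ (i + l + m) * (1 + mob \<xi>1 v) powr (- (a + real (s + l + m)))"
  let ?f2 = "\<lambda>v. wgt b2 \<xi>2 v * mob \<xi>2 v ^ (j + l + n) * (1 + mob \<xi>2 v) powr (- (a + real (s + l + m + n)))"
  let ?f3 = "\<lambda>v. wgt b3 \<xi>3 v * mob \<xi>3 v ^ (k + m + n) * (1 + mob \<xi>3 v) powr (- (a + real (s + l + m + n)))"
  have eq: "(\<lambda>v. wgt3 b1 b2 b3 \<xi>1 \<xi>2 \<xi>3 v * (mob_monomial \<xi>1 \<xi>2 \<xi>3 i j k v * bc_kernel3 (a + real s) \<xi>1 \<xi>2 \<xi>3 l
    m n v)) =
     (\<lambda>v. ?f1 (fst v) * ?f2 (fst (snd v)) * ?f3 (snd (snd v)))"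
    by (simp add: fun_eq_iff wgt3_def mob_monomial_def bc_kernel3_def bc_kernel_def power_add add_ac mult_ac)
  have int: "integrable lborel01 ?f1" "integrable lborel01 ?f2" "integrable lborel01 ?f3"
    by (intro integrable_wgt_moment; use b \<xi> in \<open>simp add: s_def\<close>)+
  show "integrable cube (\<lambda>v. wgt3 b1 b2 b3 \<xi>1 \<xi>2 \<xi>3 v * (mob_monomial \<xi>1 \<xi>2 \<xi>3 i j k v * bc_kernel3 (a + real s)
    \<xi>1 \<xi>2 \<xi>3 l m n v))"
    unfolding eq by (rule integrable_cube_product[OF int])
  have v: "(LINT v|lborel01. ?f1 v) = Beta b1 b1 * gauss_moment b1 \<xi>1 (i + l + m) (a + real (s + l + m))"
     "(LINT v|lborel01. ?f2 v) = Beta b2 b2 * gauss_moment b2 \<xi>2 (j + l + n) (a + real (s + l + m + n))"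
     "(LINT v|lborel01. ?f3 v) = Beta b3 b3 * gauss_moment b3 \<xi>3 (k + m + n) (a + real (s + l + m + n))"
    unfolding gauss_moment_def by (intro integral_wgt_moment; use b \<xi> in \<open>simp add: s_def\<close>)+
  show "(LINT v|cube. wgt3 b1 b2 b3 \<xi>1 \<xi>2 \<xi>3 v * (mob_monomial \<xi>1 \<xi>2 \<xi>3 i j k v * bc_kernel3 (a + real s) \<xi>1 \<xi>2
    \<xi>3 l m n v))
      = Beta b1 b1 * Beta b2 b2 * Beta b3 b3 *
        (gauss_moment b1 \<xi>1 (i + l + m) (a + real (s + l + m)) * gauss_moment b2 \<xi>2 (j + l + n) (a + real (s + l
          + m + n))
          * gauss_moment b3 \<xi>3 (k + m + n) (a + real (s + l + m + n)))"
    unfolding eq integral_cube_product[OF int] v by (simp add: mult_ac)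
qed

text \<open>
The part of the integrand of \<open>cube_int\<close> that integrates to the term \<open>(l, m, n, s)\<close> of the series for \<open>f\<close>; the
sums over \<open>q\<close> and over \<open>i, j, k\<close> are hidden in \<open>inner_sum\<close> and in the power of \<open>mob3\<close>.
\<close>
definition f_integrand :: "real \<Rightarrow> real \<Rightarrow> real \<Rightarrow> real \<Rightarrow> real \<Rightarrow> real \<Rightarrow> real \<Rightarrow> complex \<Rightarrow>
    nat \<times> nat \<times> nat \<times> nat \<Rightarrow> real \<times> real \<times> real \<Rightarrow> complex" where
  "f_integrand b1 b2 b3 a \<xi>1 \<xi>2 \<xi>3 \<tau> = (\<lambda>(l, m, n, s) v. inner_sum (1 - a) \<tau> s *
     of_real (wgt3 b1 b2 b3 \<xi>1 \<xi>2 \<xi>3 v * mob3 \<xi>1 \<xi>2 \<xi>3 v ^ s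
       * (pochhammer (a + real s) (l + m + n) / (fact l * fact m * fact n) * bc_kernel3 (a + real s) \<xi>1 \<xi>2 \<xi>3 l
         m n v)))"

lemma integral_f_integrand:
  assumes b: "0 < b1" "0 < b2" "0 < b3" "b1 + b2 + b3 < a"
    and \<xi>: "0 \<le> \<xi>1" "\<xi>1 \<le> 1" "0 \<le> \<xi>2" "\<xi>2 \<le> 1" "0 \<le> \<xi>3" "\<xi>3 \<le> 1"
  shows "(LINT v|cube. f_integrand b1 b2 b3 a \<xi>1 \<xi>2 \<xi>3 \<tau> (l, m, n, s) v) =
     inner_sum (1 - a) \<tau> s * of_real (Beta b1 b1 * Beta b2 b2 * Beta b3 b3 *
       (\<Sum>(i, j, k)\<in>{(i, j, k). i + j + k = s}. fact s / (fact i * fact j * fact k) *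
          (pochhammer (a + real s) (l + m + n) / (fact l * fact m * fact n)) *
          (gauss_moment b1 \<xi>1 (i + l + m) (a + real (s + l + m)) * gauss_moment b2 \<xi>2 (j + l + n) (a + real (s +
            l + m + n))
          * gauss_moment b3 \<xi>3 (k + m + n) (a + real (s + l + m + n)))))"
proof -
  let ?M = "\<lambda>i j k. gauss_moment b1 \<xi>1 (i + l + m) (a + real (s + l + m)) * gauss_moment b2 \<xi>2 (j + l + n) (a +
    real (s + l + m + n))
          * gauss_moment b3 \<xi>3 (k + m + n) (a + real (s + l + m + n))"
  let ?p = "pochhammer (a + real s) (l + m + n) / (fact l * fact m * fact n)"
  let ?K = "\<lambda>i j k v. wgt3 b1 b2 b3 \<xi>1 \<xi>2 \<xi>3 v * (mob_monomial \<xi>1 \<xi>2 \<xi>3 i j k v * bc_kernel3 (a + real s) \<xi>1 \<xi>2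
    \<xi>3 l m n v)"
  have "wgt3 b1 b2 b3 \<xi>1 \<xi>2 \<xi>3 v * mob3 \<xi>1 \<xi>2 \<xi>3 v ^ s * (?p * bc_kernel3 (a + real s) \<xi>1 \<xi>2 \<xi>3 l m n v)
     = (\<Sum>(i, j, k)\<in>{(i, j, k). i + j + k = s}. fact s / (fact i * fact j * fact k) * ?p * ?K i j k v)" for v
    unfolding mob3_power sum_distrib_left sum_distrib_right
    by (intro sum.cong refl) (auto simp: mult_ac)
  hence "(LINT v|cube. wgt3 b1 b2 b3 \<xi>1 \<xi>2 \<xi>3 v * mob3 \<xi>1 \<xi>2 \<xi>3 v ^ s * (?p * bc_kernel3 (a + real s) \<xi>1 \<xi>2 \<xi>3 l
    m n v))
     = (LINT v|cube. (\<Sum>z\<in>{(i, j, k). i + j + k = s}. case z of (i, j, k) \<Rightarrow> fact s / (fact i * fact j * fact k) *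
       ?p * ?K i j k v))"
    by simp
  also have "\<dots> = (\<Sum>z\<in>{(i, j, k). i + j + k = s}. LINT v|cube. (case z of (i, j, k) \<Rightarrow> fact s / (fact i * fact j *
    fact k) * ?p * ?K i j k v))"
  proof (rule Bochner_Integration.integral_sum)
    fix z assume "z \<in> {(i, j, k). i + j + k = s}"
    then obtain i j k where z: "z = (i, j, k)" "s = i + j + k" by auto
    have "integrable cube (?K i j k)" using integrable_kernel[OF b \<xi>] z(2) by simp
    thus "integrable cube (\<lambda>v. case z of (i, j, k) \<Rightarrow> fact s / (fact i * fact j * fact k) * ?p * ?K i j k v)"
      unfolding z(1) prod.case by (rule integrable_mult_right)
  qed
  also have "\<dots> = (\<Sum>(i, j, k)\<in>{(i, j, k). i + j + k = s}. fact s / (fact i * fact j * fact k) * ?p *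
        (Beta b1 b1 * Beta b2 b2 * Beta b3 b3 * (?M i j k)))"
  proof (rule sum.cong[OF refl])
    fix z assume "z \<in> {(i, j, k). i + j + k = s}"
    then obtain i j k where z: "z = (i, j, k)" "s = i + j + k" by auto
    show "(LINT v|cube. (case z of (i, j, k) \<Rightarrow> fact s / (fact i * fact j * fact k) * ?p * ?K i j k v)) =
      (case z of (i, j, k) \<Rightarrow> fact s / (fact i * fact j * fact k) * ?p *
        (Beta b1 b1 * Beta b2 b2 * Beta b3 b3 * (?M i j k)))"
      unfolding z(1) prod.case integral_mult_right_zero
      unfolding z(2) integral_kernel[OF b \<xi>] ..
  qed
  finally have "(LINT v|cube. wgt3 b1 b2 b3 \<xi>1 \<xi>2 \<xi>3 v * mob3 \<xi>1 \<xi>2 \<xi>3 v ^ s * (?p * bc_kernel3 (a + real s) \<xi>1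
    \<xi>2 \<xi>3 l m n v))
     = Beta b1 b1 * Beta b2 b2 * Beta b3 b3 *
       (\<Sum>(i, j, k)\<in>{(i, j, k). i + j + k = s}. fact s / (fact i * fact j * fact k) * ?p *
          (?M i j k))"
    unfolding sum_distrib_left by (simp add: case_prod_unfold mult_ac)
  thus ?thesis
    unfolding f_integrand_def prod.case integral_mult_right_zero integral_complex_of_real by simp
qed

lemma f_term_eq_integral:
  assumes b: "0 < \<alpha> 1" "0 < \<alpha> 2" "0 < \<alpha> 3" "\<alpha> 1 + \<alpha> 2 + \<alpha> 3 < alpha_tot p \<alpha>"
    and R: "0 \<le> R" "R \<le> R1" "R \<le> R2" "R \<le> R3" "0 < R1" "0 < R2" "0 < R3"
  shows "of_real (Beta (\<alpha> 1) (\<alpha> 1) * Beta (\<alpha> 2) (\<alpha> 2) * Beta (\<alpha> 3) (\<alpha> 3)) * f_term p \<alpha> lam R R1 R2 R3 lmns =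
     (LINT v|cube. f_integrand (\<alpha> 1) (\<alpha> 2) (\<alpha> 3) (alpha_tot p \<alpha>) (1 - R / R1) (1 - R / R2) (1 - R / R3)
        (lam\<^sup>2 * of_real R / 4) lmns v)"
proof -
  obtain l m n s where lmns: "lmns = (l, m, n, s)" by (cases lmns)
  define a \<xi>1 \<xi>2 \<xi>3 \<tau> where "a = alpha_tot p \<alpha>" and \<xi>: "\<xi>1 = 1 - R / R1" "\<xi>2 = 1 - R / R2" "\<xi>3 = 1 - R / R3"
    and \<tau>: "\<tau> = lam\<^sup>2 * of_real R / 4"
  have \<xi>': "0 \<le> \<xi>1" "\<xi>1 \<le> 1" "0 \<le> \<xi>2" "\<xi>2 \<le> 1" "0 \<le> \<xi>3" "\<xi>3 \<le> 1"
    using R unfolding \<xi> by auto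
  note b' = b[folded a_def]
  have a0: "0 < a" using b' by simp
  have pow: "(lam / 2 * of_real (sqrt R)) ^ (2 * q) = \<tau> ^ q" for q
  proof -
    have "(lam / 2 * of_real (sqrt R))\<^sup>2 = \<tau>"
      using R(1) by (simp add: \<tau> power_mult_distrib power_divide flip: of_real_power)
    thus ?thesis by (simp add: power_mult)
  qed
  have poch: "pochhammer a (l + m + n + s) / pochhammer a s = pochhammer (a + real s) (l + m + n)"
    using pochhammer_product'[of a s "l + m + n"] pochhammer_pos[OF a0, of s] by (simp add: add_ac)
  let ?c = "\<lambda>q. of_real (A_num s q * real (s choose q)) * taylor_coeff (1 - a) \<tau> q"
  let ?d = "\<lambda>i j k. fact s / (fact i * fact j * fact k) *
          (pochhammer (a + real s) (l + m + n) / (fact l * fact m * fact n)) *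
          (gauss_moment (\<alpha> 1) \<xi>1 (i + l + m) (a + real (s + l + m)) * gauss_moment (\<alpha> 2) \<xi>2 (j + l + n) (a +
            real (s + l + m + n))
          * gauss_moment (\<alpha> 3) \<xi>3 (k + m + n) (a + real (s + l + m + n)))"
  have "f_term p \<alpha> lam R R1 R2 R3 lmns = (\<Sum>q=0..s. \<Sum>(i, j, k)\<in>{(i, j, k). i + j + k = s}. ?c q * of_real (?d i j
    k))"
    unfolding lmns f_term_def prod.case Let_def a_def[symmetric] \<xi>[symmetric] \<tau>[symmetric] pow
  proof (intro sum.cong refl, goal_cases)
    case (1 q z)
    then obtain i j k where z: "z = (i, j, k)" "s = i + j + k" by auto
    have e1: "2 * \<alpha> 1 - a - real j - real k = 2 * \<alpha> 1 + real (i + l + m) - (a + real (s + l + m))"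
      "2 * \<alpha> 2 - a - real i - real k - real m = 2 * \<alpha> 2 + real (j + l + n) - (a + real (s + l + m + n))"
      "2 * \<alpha> 3 - a - real i - real j - real l = 2 * \<alpha> 3 + real (k + m + n) - (a + real (s + l + m + n))"
      by (simp_all add: z(2))
    show ?case
      unfolding z(1) prod.case e1 poch[symmetric] gauss_moment_def taylor_coeff_def
      by (simp add: mult_ac)
  qed
  also have "\<dots> = inner_sum (1 - a) \<tau> s * of_real (\<Sum>(i, j, k)\<in>{(i, j, k). i + j + k = s}. ?d i j k)"
    unfolding inner_sum_def of_real_sum sum_product
    by (intro sum.cong refl) (auto simp: case_prod_unfold)
  finally show ?thesis
    unfolding lmns a_def[symmetric] \<xi>[symmetric] \<tau>[symmetric] integral_f_integrand[OF b' \<xi>']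
    by (simp add: mult_ac)
qed

lemma inner_sum_0: "inner_sum c 0 s = (if s = 0 then 1 else 0)"
proof -
  have "inner_sum c 0 s = (\<Sum>q=0..s. if q = 0 then of_real (A_num s 0) else 0)"
    unfolding inner_sum_def by (intro sum.cong refl) (simp add: taylor_coeff_def)
  thus ?thesis by (simp add: A_num_def)
qed

text \<open>
The majorant needed for integrating term by term. For \<open>\<xi>\<^sub>j < 1\<close> the quotient \<open>T / (1 + T)\<close> stays away from
\<open>1\<close>; for \<open>\<tau> = 0\<close> only the term \<open>s = 0\<close> is left.
\<close>
lemma inner_sum_bound:
  assumes c: "c \<notin> \<int>\<^sub>\<le>\<^sub>0"
    and \<xi>: "0 \<le> \<xi>1" "\<xi>1 \<le> 1" "0 \<le> \<xi>2" "\<xi>2 \<le> 1" "0 \<le> \<xi>3" "\<xi>3 \<le> 1"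
    and lt: "\<xi>1 < 1 \<and> \<xi>2 < 1 \<and> \<xi>3 < 1 \<or> \<tau> = 0"
  shows "\<exists>K. \<forall>v\<in>space cube. (\<Sum>\<^sub>\<infinity>s. norm (inner_sum c \<tau> s) * (mob3 \<xi>1 \<xi>2 \<xi>3 v / (1 + mob3 \<xi>1 \<xi>2 \<xi>3 v)) ^ s) \<le> K"
proof (cases "\<tau> = 0")
  case True
  have "(\<Sum>\<^sub>\<infinity>s. norm (inner_sum c \<tau> s) * x ^ s) = 1" for x
  proof -
    have "(\<Sum>\<^sub>\<infinity>s. norm (inner_sum c \<tau> s) * x ^ s) = (\<Sum>\<^sub>\<infinity>s\<in>{0}. norm (inner_sum c \<tau> s) * x ^ s)"
      by (rule infsum_cong_neutral) (auto simp: True inner_sum_0)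
    thus ?thesis by (simp add: True inner_sum_0)
  qed
  thus ?thesis by (intro exI[of _ 1]) simp
next
  case False
  with lt have lt: "\<xi>1 < 1" "\<xi>2 < 1" "\<xi>3 < 1" by auto
  let ?T = "\<lambda>v. mob3 \<xi>1 \<xi>2 \<xi>3 v"
  define T where "T = \<xi>1 / (1 - \<xi>1) + \<xi>2 / (1 - \<xi>2) + \<xi>3 / (1 - \<xi>3)"
  have tle: "mob \<xi> w \<le> \<xi> / (1 - \<xi>)" if "0 \<le> \<xi>" "\<xi> < 1" "0 < w" "w < 1" for \<xi> w
    unfolding mob_def by (rule frac_le) (use that in \<open>auto simp: mult_left_le\<close>)
  have T0: "0 \<le> T" unfolding T_def using \<xi> lt by (intro add_nonneg_nonneg) auto
  have xT: "0 \<le> T / (1 + T)" "T / (1 + T) < 1" using T0 by auto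
  show ?thesis
  proof (intro exI ballI)
    fix v assume v: "v \<in> space cube"
    have Tv: "0 \<le> ?T v" using mob3_nonneg[OF \<xi> v] .
    have le: "?T v \<le> T"
      unfolding mob3_def T_def using v \<xi> lt by (intro add_mono tle) (auto simp: space_cube)
    have xle: "?T v / (1 + ?T v) \<le> T / (1 + T)"
      using le Tv by (simp add: field_simps)
    have xv: "0 \<le> ?T v / (1 + ?T v)" "?T v / (1 + ?T v) < 1"
      using Tv by auto
    show "(\<Sum>\<^sub>\<infinity>s. norm (inner_sum c \<tau> s) * (?T v / (1 + ?T v)) ^ s)
       \<le> (\<Sum>\<^sub>\<infinity>s. norm (inner_sum c \<tau> s) * (T / (1 + T)) ^ s)"
      by (rule infsum_mono) (use summable_inner_sum[OF c xT] summable_inner_sum[OF c xv] xle xv in \<open>auto intro!: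
        mult_left_mono power_mono\<close>)
  qed
qed

lemma measurable_f_integrand: "f_integrand b1 b2 b3 a \<xi>1 \<xi>2 \<xi>3 \<tau> lmns \<in> borel_measurable cube"
proof -
  obtain l m n s where lmns: "lmns = (l, m, n, s)" by (cases lmns)
  have [measurable]: "(\<lambda>v. wgt3 b1 b2 b3 \<xi>1 \<xi>2 \<xi>3 v * mob3 \<xi>1 \<xi>2 \<xi>3 v ^ s
       * (pochhammer (a + real s) (l + m + n) / (fact l * fact m * fact n) * bc_kernel3 (a + real s) \<xi>1 \<xi>2 \<xi>3 l
         m n v)) \<in> borel_measurable cube"
    by measurable
  show ?thesis unfolding lmns f_integrand_def prod.case
    by measurable
qed

text \<open>
Sum over \<open>l, m, n\<close> by the decomposition of the power, then over \<open>s\<close>. The kernel is nonnegative, so the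
sum of the norms differs from the sum itself only in the coefficients \<open>inner_sum\<close>.
\<close>
lemma
  fixes \<tau> :: complex and b1 b2 b3 :: real
  assumes c: "1 - a \<notin> \<int>\<^sub>\<le>\<^sub>0"
    and \<xi>: "0 \<le> \<xi>1" "\<xi>1 \<le> 1" "0 \<le> \<xi>2" "\<xi>2 \<le> 1" "0 \<le> \<xi>3" "\<xi>3 \<le> 1"
    and v: "v \<in> space cube" and a: "0 < a"
  defines "T \<equiv> mob3 \<xi>1 \<xi>2 \<xi>3 v" and "W \<equiv> wgt3 b1 b2 b3 \<xi>1 \<xi>2 \<xi>3 v"
  shows f_integrand_norm_has_sum: "((\<lambda>lmns. norm (f_integrand b1 b2 b3 a \<xi>1 \<xi>2 \<xi>3 \<tau> lmns v)) has_sum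
       W * (1 + T) powr (- a) * (\<Sum>\<^sub>\<infinity>s. norm (inner_sum (1 - a) \<tau> s) * (T / (1 + T)) ^ s)) UNIV"
    and f_integrand_has_sum: "((\<lambda>lmns. f_integrand b1 b2 b3 a \<xi>1 \<xi>2 \<xi>3 \<tau> lmns v) has_sum
       of_real (W * (1 + T) powr (- a)) * hyp_0F1 (1 - a) (\<tau> * of_real (1 + T))) UNIV"
proof -
  define x where "x = T / (1 + T)"
  have T0: "0 \<le> T" unfolding T_def using mob3_nonneg[OF \<xi> v] .
  have W0: "0 \<le> W" unfolding W_def by (rule wgt3_nonneg)
  have x: "0 \<le> x" "x < 1" and x1: "1 / (1 - x) = 1 + T" using T0 by (auto simp: x_def field_simps)
  have tts: "0 \<le> mob \<xi>1 (fst v)" "0 \<le> mob \<xi>2 (fst (snd v))" "0 \<le> mob \<xi>3 (snd (snd v))"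
    using \<xi> v by (auto simp: space_cube intro!: mob_nonneg)
  have b0: "0 \<le> bc_kernel3 (a + real s) \<xi>1 \<xi>2 \<xi>3 l m n v" for s l m n
    unfolding bc_kernel3_def bc_kernel_def using tts by (intro mult_nonneg_nonneg) auto
  have p0: "0 \<le> pochhammer (a + real s) n" for s n using a by (intro pochhammer_nonneg) auto
  have Tx: "T ^ s * (1 + T) powr (- (a + real s)) = (1 + T) powr (- a) * x ^ s" for s
  proof -
    have "(1 + T) powr (- (a + real s)) = (1 + T) powr (- a) * (1 / (1 + T)) ^ s"
      using T0 by (simp add: inverse_power_eq_powr powr_add[symmetric])
    thus ?thesis by (simp add: x_def power_divide)
  qed
  let ?h = "\<lambda>(s, l, m, n). W * T ^ s * (pochhammer (a + real s) (l + m + n) / (fact l * fact m * fact n) *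
    bc_kernel3 (a + real s) \<xi>1 \<xi>2 \<xi>3 l m n v)"
  have h0: "0 \<le> ?h z" for z
    using W0 T0 p0 b0 by (cases z) auto
  have hsum: "((\<lambda>z. ?h (s, z)) has_sum (W * (1 + T) powr (- a)) * x ^ s) UNIV" for s
  proof -
    have "((\<lambda>(l, m, n). pochhammer (a + real s) (l + m + n) / (fact l * fact m * fact n) * bc_kernel3 (a + real
      s) \<xi>1 \<xi>2 \<xi>3 l m n v) has_sum
      (1 + T) powr (- (a + real s))) UNIV"
      unfolding bc_kernel3_def T_def mob3_def by (rule bc_kernel_has_sum[OF tts])
    from has_sum_cmult_right[OF this, of "W * T ^ s"]
    show ?thesis using Tx[of s] by (simp add: case_prod_unfold mult.assoc)
  qed
  let ?g = "\<lambda>(s, z). inner_sum (1 - a) \<tau> s * of_real (?h (s, z))"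
  have gsum: "((\<lambda>z. ?g (s, z)) has_sum of_real (W * (1 + T) powr (- a)) * (inner_sum (1 - a) \<tau> s * of_real x ^
    s)) UNIV" for s
    using has_sum_cmult_right[OF has_sum_of_real[OF hsum[of s]], of "inner_sum (1 - a) \<tau> s"] by (simp add:
      mult_ac)
  have gnsum: "((\<lambda>z. norm (?g (s, z))) has_sum (W * (1 + T) powr (- a)) * (norm (inner_sum (1 - a) \<tau> s) * x ^
    s)) UNIV" for s
  proof -
    have "norm (?g (s, z)) = norm (inner_sum (1 - a) \<tau> s) * ?h (s, z)" for z
      using h0[of "(s, z)"] by (simp only: prod.case norm_mult norm_of_real abs_of_nonneg)
    thus ?thesis using has_sum_cmult_right[OF hsum[of s], of "norm (inner_sum (1 - a) \<tau> s)"] by (simp add: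
      mult_ac)
  qed
  have osum: "((\<lambda>s. (W * (1 + T) powr (- a)) * (norm (inner_sum (1 - a) \<tau> s) * x ^ s)) has_sum
      (W * (1 + T) powr (- a)) * (\<Sum>\<^sub>\<infinity>s. norm (inner_sum (1 - a) \<tau> s) * x ^ s)) UNIV"
    by (intro has_sum_cmult_right has_sum_infsum summable_inner_sum c x)
  have ns: "(\<lambda>z. norm (?g z)) summable_on UNIV \<times> UNIV"
    by (rule summable_on_SigmaI[OF gnsum]) (use osum in \<open>auto simp: summable_on_def\<close>)
  have N: "((\<lambda>z. norm (?g z)) has_sum (W * (1 + T) powr (- a)) * (\<Sum>\<^sub>\<infinity>s. norm (inner_sum (1 - a) \<tau> s) * x ^ s))
    (UNIV \<times> UNIV)"
    by (rule has_sum_SigmaI[OF gnsum osum ns])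
  have G: "(?g has_sum of_real (W * (1 + T) powr (- a)) * hyp_0F1 (1 - a) (\<tau> * of_real (1 + T))) (UNIV \<times> UNIV)"
  proof (rule has_sum_SigmaI[OF gsum])
    show "((\<lambda>s. of_real (W * (1 + T) powr (- a)) * (inner_sum (1 - a) \<tau> s * of_real x ^ s)) has_sum
       of_real (W * (1 + T) powr (- a)) * hyp_0F1 (1 - a) (\<tau> * of_real (1 + T))) UNIV"
      using inner_sum_has_sum[OF c x, of \<tau>] unfolding x1 by (rule has_sum_cmult_right)
    show "?g summable_on UNIV \<times> UNIV" using ns by (rule abs_summable_summable)
  qed
  have geq: "f_integrand b1 b2 b3 a \<xi>1 \<xi>2 \<xi>3 \<tau> (l, m, n, s) v = ?g (s, l, m, n)" for l m n s
    by (simp add: f_integrand_def T_def W_def)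
  show "((\<lambda>lmns. norm (f_integrand b1 b2 b3 a \<xi>1 \<xi>2 \<xi>3 \<tau> lmns v)) has_sum
       W * (1 + T) powr (- a) * (\<Sum>\<^sub>\<infinity>s. norm (inner_sum (1 - a) \<tau> s) * (T / (1 + T)) ^ s)) UNIV"
    using N unfolding x_def[symmetric]
    by (subst has_sum_reindex_bij_witness[where i = "\<lambda>(s, l, m, n). (l, m, n, s)" and j = "\<lambda>(l, m, n, s). (s, l,
      m, n)"
          and T = "UNIV \<times> UNIV" and h = "\<lambda>z. norm (?g z)"]) (auto simp: geq)
  show "((\<lambda>lmns. f_integrand b1 b2 b3 a \<xi>1 \<xi>2 \<xi>3 \<tau> lmns v) has_sum
       of_real (W * (1 + T) powr (- a)) * hyp_0F1 (1 - a) (\<tau> * of_real (1 + T))) UNIV"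
    using G
    by (subst has_sum_reindex_bij_witness[where i = "\<lambda>(s, l, m, n). (l, m, n, s)" and j = "\<lambda>(l, m, n, s). (s, l,
      m, n)"
          and T = "UNIV \<times> UNIV" and h = ?g]) (auto simp: geq)
qed

lemma integral_f_integrand_has_sum:
  fixes \<tau> :: complex
  assumes c: "1 - a \<notin> \<int>\<^sub>\<le>\<^sub>0"
    and b: "0 < b1" "0 < b2" "0 < b3" "b1 + b2 + b3 < a"
    and \<xi>: "0 \<le> \<xi>1" "\<xi>1 \<le> 1" "0 \<le> \<xi>2" "\<xi>2 \<le> 1" "0 \<le> \<xi>3" "\<xi>3 \<le> 1"
    and lt: "\<xi>1 < 1 \<and> \<xi>2 < 1 \<and> \<xi>3 < 1 \<or> \<tau> = 0"
  shows "((\<lambda>lmns. LINT v|cube. f_integrand b1 b2 b3 a \<xi>1 \<xi>2 \<xi>3 \<tau> lmns v) has_sum cube_int b1 b2 b3 a \<xi>1 \<xi>2 \<xi>3 \<tau>)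
    UNIV"
proof -
  let ?x = "\<lambda>v. (mob3 \<xi>1 \<xi>2 \<xi>3 v / (1 + mob3 \<xi>1 \<xi>2 \<xi>3 v))"
  let ?V = "\<lambda>v. wgt3 b1 b2 b3 \<xi>1 \<xi>2 \<xi>3 v * (1 + mob3 \<xi>1 \<xi>2 \<xi>3 v) powr (- a)"
  have a: "0 < a" using b by simp
  obtain K where K: "\<And>v. v \<in> space cube \<Longrightarrow> (\<Sum>\<^sub>\<infinity>s. norm (inner_sum (1 - a) \<tau> s) * ?x v ^ s) \<le> K"
    using inner_sum_bound[OF c \<xi> lt] by blast
  show ?thesis
    unfolding cube_int_def
  proof (rule has_sum_lebesgue_integral(2)[OF measurable_f_integrand])
    fix v assume v: "v \<in> space cube"
    note f_integrand_has_sum[OF c \<xi> v a] f_integrand_norm_has_sum[OF c \<xi> v a]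
    show "((\<lambda>lmns. f_integrand b1 b2 b3 a \<xi>1 \<xi>2 \<xi>3 \<tau> lmns v) has_sum
       of_real (?V v) * hyp_0F1 (1 - a) (\<tau> * of_real (1 + mob3 \<xi>1 \<xi>2 \<xi>3 v))) UNIV"
      by fact
    show "((\<lambda>lmns. norm (f_integrand b1 b2 b3 a \<xi>1 \<xi>2 \<xi>3 \<tau> lmns v)) has_sum
       ?V v * (\<Sum>\<^sub>\<infinity>s. norm (inner_sum (1 - a) \<tau> s) * ?x v ^ s)) UNIV"
      by fact
    show "?V v * (\<Sum>\<^sub>\<infinity>s. norm (inner_sum (1 - a) \<tau> s) * ?x v ^ s)
       \<le> ?V v * K"
      using K[OF v] by (intro mult_left_mono mult_nonneg_nonneg wgt3_nonneg) auto
  next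
    show "integrable cube (\<lambda>v. ?V v * K)"
      by (intro integrable_mult_left integrable_wgt3 b \<xi>)
  qed
qed

text \<open>
At \<open>R = 0\<close> the three arguments \<open>1 - R / R\<^sub>j\<close> are \<open>1\<close> and the last argument of \<open>cube_int\<close> is \<open>0\<close>.
This is the case that gives the value of \<open>f\<close> for coinciding points.
\<close>
lemma f_term_has_sum:
  assumes c: "1 - alpha_tot p \<alpha> \<notin> \<int>\<^sub>\<le>\<^sub>0"
    and b: "0 < \<alpha> 1" "0 < \<alpha> 2" "0 < \<alpha> 3" "\<alpha> 1 + \<alpha> 2 + \<alpha> 3 < alpha_tot p \<alpha>"
    and R: "0 \<le> R" "R \<le> R1" "R \<le> R2" "R \<le> R3" "0 < R1" "0 < R2" "0 < R3"
  shows "(f_term p \<alpha> lam R R1 R2 R3 has_sum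
     cube_int (\<alpha> 1) (\<alpha> 2) (\<alpha> 3) (alpha_tot p \<alpha>) (1 - R / R1) (1 - R / R2) (1 - R / R3) (lam\<^sup>2 * of_real R / 4)
      / of_real (Beta (\<alpha> 1) (\<alpha> 1) * Beta (\<alpha> 2) (\<alpha> 2) * Beta (\<alpha> 3) (\<alpha> 3))) UNIV"
proof -
  let ?B = "complex_of_real (Beta (\<alpha> 1) (\<alpha> 1) * Beta (\<alpha> 2) (\<alpha> 2) * Beta (\<alpha> 3) (\<alpha> 3))"
  have B: "?B \<noteq> 0" using Beta_real_pos[OF b(1) b(1)] Beta_real_pos[OF b(2) b(2)] Beta_real_pos[OF b(3) b(3)] by
    simp
  have "((\<lambda>lmns. LINT v|cube. f_integrand (\<alpha> 1) (\<alpha> 2) (\<alpha> 3) (alpha_tot p \<alpha>) (1 - R / R1) (1 - R / R2) (1 - R /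
    R3)
        (lam\<^sup>2 * of_real R / 4) lmns v) has_sum
     cube_int (\<alpha> 1) (\<alpha> 2) (\<alpha> 3) (alpha_tot p \<alpha>) (1 - R / R1) (1 - R / R2) (1 - R / R3) (lam\<^sup>2 * of_real R / 4))
       UNIV"
    by (rule integral_f_integrand_has_sum[OF c b]) (use R in \<open>auto simp: divide_simps\<close>)
  from has_sum_cmult_right[OF this, of "1 / ?B"] show ?thesis
    unfolding f_term_eq_integral[OF b R, symmetric] using B by simp
qed

section \<open>The integral at coinciding points\<close>

lemma hyp_0F1_holomorphic:
  assumes "c \<notin> \<int>\<^sub>\<le>\<^sub>0"
  shows "hyp_0F1 c holomorphic_on S"
proof -
  have 1: "hyp_0F1 c = (\<lambda>z. \<Sum>n. (of_real (1 / pochhammer c n) / fact n) * z ^ n)"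
    by (simp add: hyp_0F1_def fun_eq_iff)
  have "summable (\<lambda>n. (of_real (1 / pochhammer c n) / fact n) * z ^ n)" for z :: complex
    using sums_summable[OF has_sum_imp_sums[OF hyp_0F1_has_sum[OF assms, of z]]] by simp
  from termdiffs_strong_converges_everywhere[OF this]
  show ?thesis unfolding 1 by (auto simp: holomorphic_on_def field_differentiable_def intro:
    has_field_derivative_at_within)
qed

lemma isCont_hyp_0F1: "c \<notin> \<int>\<^sub>\<le>\<^sub>0 \<Longrightarrow> isCont (hyp_0F1 c) z"
  using holomorphic_on_imp_continuous_on[OF hyp_0F1_holomorphic[of c UNIV]]
  by (simp add: continuous_on_eq_continuous_at)

lemma measurable_hyp_0F1: "c \<notin> \<int>\<^sub>\<le>\<^sub>0 \<Longrightarrow> hyp_0F1 c \<in> borel_measurable borel"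
  by (intro borel_measurable_continuous_onI holomorphic_on_imp_continuous_on hyp_0F1_holomorphic)

lemma hyp_0F1_bounded:
  assumes "c \<notin> \<int>\<^sub>\<le>\<^sub>0"
  shows "\<exists>M\<ge>0. \<forall>z. norm z \<le> K \<longrightarrow> norm (hyp_0F1 c z) \<le> M"
proof -
  have "compact (hyp_0F1 c ` cball 0 K)"
    by (intro compact_continuous_image holomorphic_on_imp_continuous_on hyp_0F1_holomorphic assms compact_cball)
  then obtain M where "M > 0" "\<And>w. w \<in> hyp_0F1 c ` cball 0 K \<Longrightarrow> norm w \<le> M"
    using compact_imp_bounded bounded_pos by metis
  thus ?thesis by (intro exI[of _ M]) auto
qed

lemma measurable_cube_int_integrand:
  assumes "1 - a \<notin> \<int>\<^sub>\<le>\<^sub>0"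
  shows "(\<lambda>v. of_real (wgt3 b1 b2 b3 \<xi>1 \<xi>2 \<xi>3 v * (1 + mob3 \<xi>1 \<xi>2 \<xi>3 v) powr (- a))
       * hyp_0F1 (1 - a) (\<tau> * of_real (1 + mob3 \<xi>1 \<xi>2 \<xi>3 v))) \<in> borel_measurable cube"
proof -
  note [measurable] = measurable_hyp_0F1[OF assms]
  have [measurable]: "(\<lambda>v. \<tau> * of_real (1 + mob3 \<xi>1 \<xi>2 \<xi>3 v)) \<in> borel_measurable cube" by measurable
  have [measurable]: "(\<lambda>v. wgt3 b1 b2 b3 \<xi>1 \<xi>2 \<xi>3 v * (1 + mob3 \<xi>1 \<xi>2 \<xi>3 v) powr (- a)) \<in> borel_measurable cube"
    by measurable
  show ?thesis by measurable
qed

text \<open>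
Sequences suffice, as the filter at a point of \<open>R\<^sup>p\<close> is first countable. The last hypothesis bounds the
argument of \<open>\<^sub>0F\<^sub>1\<close>; in the application it holds because \<open>r\<^sup>2 (1 + T)\<close> lies between \<open>0\<close> and
\<open>r\<^sub>1\<^sup>2 + r\<^sub>2\<^sup>2 + r\<^sub>3\<^sup>2\<close>, although \<open>T\<close> itself is unbounded.
\<close>
lemma cube_int_tendsto:
  fixes \<tau> :: "nat \<Rightarrow> complex" and \<xi>1 \<xi>2 \<xi>3 :: "nat \<Rightarrow> real"
  assumes c: "1 - a \<notin> \<int>\<^sub>\<le>\<^sub>0"
    and b: "0 < b1" "0 < b2" "0 < b3" "b1 + b2 + b3 < a"
    and \<xi>: "\<And>n. 0 \<le> \<xi>1 n" "\<And>n. \<xi>1 n \<le> 1" "\<And>n. 0 \<le> \<xi>2 n" "\<And>n. \<xi>2 n \<le> 1" "\<And>n. 0 \<le> \<xi>3 n" "\<And>n. \<xi>3 n \<le> 1"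
    and lim: "\<xi>1 \<longlonglongrightarrow> 1" "\<xi>2 \<longlonglongrightarrow> 1" "\<xi>3 \<longlonglongrightarrow> 1" "\<tau> \<longlonglongrightarrow> 0"
    and K: "\<And>n v. v \<in> space cube \<Longrightarrow> norm (\<tau> n) * (1 + mob3 (\<xi>1 n) (\<xi>2 n) (\<xi>3 n) v) \<le> K"
  shows "(\<lambda>n. cube_int b1 b2 b3 a (\<xi>1 n) (\<xi>2 n) (\<xi>3 n) (\<tau> n)) \<longlonglongrightarrow> cube_int b1 b2 b3 a 1 1 1 0"
proof -
  let ?T = "\<lambda>n v. mob3 (\<xi>1 n) (\<xi>2 n) (\<xi>3 n) v" and ?W = "\<lambda>n v. wgt3 b1 b2 b3 (\<xi>1 n) (\<xi>2 n) (\<xi>3 n) v"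
  obtain M where M: "M \<ge> 0" "\<And>z. norm z \<le> K \<Longrightarrow> norm (hyp_0F1 (1 - a) z) \<le> M"
    using hyp_0F1_bounded[OF c, of K] by blast
  show ?thesis
    unfolding cube_int_def
  proof (rule integral_dominated_convergence[where w = "\<lambda>v. wgt3_majorant b1 b2 b3 a v * M"])
    show "integrable cube (\<lambda>v. wgt3_majorant b1 b2 b3 a v * M)"
      by (intro integrable_mult_left integrable_wgt3_majorant b)
    show "AE v in cube. norm (of_real (?W n v * (1 + ?T n v) powr (- a))
       * hyp_0F1 (1 - a) (\<tau> n * of_real (1 + ?T n v))) \<le> wgt3_majorant b1 b2 b3 a v * M" for n
    proof (rule AE_I2)
      fix v assume v: "v \<in> space cube"
      have T: "0 \<le> ?T n v" using mob3_nonneg \<xi> v by blast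
      have "norm (\<tau> n * of_real (1 + ?T n v)) = norm (\<tau> n) * (1 + ?T n v)"
        using T unfolding norm_mult norm_of_real by simp
      hence "norm (hyp_0F1 (1 - a) (\<tau> n * of_real (1 + ?T n v))) \<le> M"
        using K[OF v, of n] by (intro M) simp
      moreover have "norm (complex_of_real (?W n v * (1 + ?T n v) powr (- a))) \<le> wgt3_majorant b1 b2 b3 a v"
        using wgt3_le_wgt3_majorant[OF b \<xi>(1)[of n] \<xi>(2)[of n] \<xi>(3)[of n] \<xi>(4)[of n] \<xi>(5)[of n] \<xi>(6)[of n] v]
        unfolding norm_of_real by (simp add: wgt3_nonneg)
      ultimately show "norm (of_real (?W n v * (1 + ?T n v) powr (- a))
       * hyp_0F1 (1 - a) (\<tau> n * of_real (1 + ?T n v))) \<le> wgt3_majorant b1 b2 b3 a v * M"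
        unfolding norm_mult by (intro mult_mono') auto
    qed
    show "AE v in cube. (\<lambda>n. of_real (?W n v * (1 + ?T n v) powr (- a))
       * hyp_0F1 (1 - a) (\<tau> n * of_real (1 + ?T n v))) \<longlonglongrightarrow>
       of_real (wgt3 b1 b2 b3 1 1 1 v * (1 + mob3 1 1 1 v) powr (- a)) * hyp_0F1 (1 - a) (0 * of_real (1 + mob3
         1 1 1 v))"
    proof (rule AE_I2)
      fix v assume v: "v \<in> space cube"
      have v': "fst v < 1" "fst (snd v) < 1" "snd (snd v) < 1" using v by (auto simp: space_cube)
      have T: "(\<lambda>n. ?T n v) \<longlonglongrightarrow> mob3 1 1 1 v"
        unfolding mob3_def mob_def by (intro tendsto_intros lim) (use v' in auto)
      have W: "(\<lambda>n. ?W n v) \<longlonglongrightarrow> wgt3 b1 b2 b3 1 1 1 v"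
        unfolding wgt3_def wgt_def by (intro tendsto_intros lim) (use v' in auto)
      have "0 \<le> mob3 1 1 1 v" using mob3_nonneg[OF _ _ _ _ _ _ v, of 1 1 1] by simp
      hence P: "(\<lambda>n. (1 + ?T n v) powr (- a)) \<longlonglongrightarrow> (1 + mob3 1 1 1 v) powr (- a)"
        by (intro tendsto_intros T) auto
      have H: "(\<lambda>n. hyp_0F1 (1 - a) (\<tau> n * of_real (1 + ?T n v))) \<longlonglongrightarrow> hyp_0F1 (1 - a) (0 * of_real (1 + mob3 1 1 1
        v))"
        by (rule isCont_tendsto_compose[OF isCont_hyp_0F1[OF c]]) (intro tendsto_intros lim T)
      show "(\<lambda>n. of_real (?W n v * (1 + ?T n v) powr (- a))
       * hyp_0F1 (1 - a) (\<tau> n * of_real (1 + ?T n v))) \<longlonglongrightarrow>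
       of_real (wgt3 b1 b2 b3 1 1 1 v * (1 + mob3 1 1 1 v) powr (- a)) * hyp_0F1 (1 - a) (0 * of_real (1 + mob3
         1 1 1 v))"
        by (intro tendsto_mult tendsto_of_real W P H)
    qed
  qed (use measurable_cube_int_integrand[OF c] in auto)
qed

text \<open>
This is \<open>\<integral> t\<^sup>b\<^sup>-\<^sup>1 (A + t)\<^sup>-\<^sup>c dt = A\<^sup>b\<^sup>-\<^sup>c B(b, c - b)\<close> over \<open>(0, \<infinity>)\<close>, written in
\<open>v = t / (1 + t)\<close>. It is again an Euler integral with coinciding first and third parameter.
\<close>
lemma Dirichlet_1D:
  assumes b: "0 < b" "b < c" and A: "1 \<le> A"
  shows "(\<integral>\<^sup>+v. ennreal (wgt b 1 v * (A + mob 1 v) powr (- c)) \<partial>lborel01) = ennreal (A powr (b - c) * Beta b (c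
    - b))"
proof -
  \<comment> \<open>then \<open>A + v / (1 - v) = A (1 - \<xi> v) / (1 - v)\<close>\<close>
  define \<xi> where "\<xi> = 1 - 1 / A"
  have \<xi>: "0 \<le> \<xi>" "\<xi> < 1" using A by (auto simp: \<xi>_def)
  let ?g = "\<lambda>v. A powr (- c) * (v powr (b - 1) * (1 - v) powr (c - b - 1) * (1 - \<xi> * v) powr (- c))"
  have eq: "wgt b 1 v * (A + mob 1 v) powr (- c) = ?g v" if v: "v \<in> space lborel01" for v
  proof -
    have v': "0 < v" "v < 1" using v by auto
    have lt: "0 < 1 - \<xi> * v" using xi_v_less_1[of \<xi> v] \<xi> v' by simp
    have "A + mob 1 v = A * (1 - \<xi> * v) / (1 - v)"
      using v' A by (simp add: mob_def \<xi>_def field_simps)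
    also have "\<dots> powr (- c) = A powr (- c) * (1 - \<xi> * v) powr (- c) * (1 - v) powr c"
      using v' A lt by (simp add: powr_mult powr_divide powr_minus inverse_eq_divide)
    finally have "(A + mob 1 v) powr (- c) = A powr (- c) * (1 - \<xi> * v) powr (- c) * (1 - v) powr c" .
    moreover have "(1 - v) powr (b - 1) * (1 - v) powr (- 2 * b) * (1 - v) powr c = (1 - v) powr (c - b - 1)"
      by (simp add: powr_add[symmetric]) (simp add: algebra_simps)
    ultimately show ?thesis by (simp add: wgt_def mult_ac)
  qed
  have int: "integrable lborel01 ?g"
    by (intro integrable_mult_right integrable_Euler) (use b \<xi> in auto)
  have "(\<integral>\<^sup>+v. ennreal (wgt b 1 v * (A + mob 1 v) powr (- c)) \<partial>lborel01) = (\<integral>\<^sup>+v. ennreal (?g v) \<partial>lborel01)"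
    by (intro nn_integral_cong) (use eq in simp)
  also have "\<dots> = ennreal (LINT v|lborel01. ?g v)"
    by (rule nn_integral_eq_integral[OF int]) auto
  also have "(LINT v|lborel01. ?g v) = A powr (- c) * (Beta b (c - b) * gauss_F c b c \<xi>)"
    by (subst integral_mult_right_zero, subst Euler_integral) (use b \<xi> in auto)
  also have "gauss_F c b c \<xi> = A powr b"
    using b \<xi> A by (subst gauss_F_cancel) (auto simp: \<xi>_def powr_minus powr_divide)
  also have "A powr (- c) * (Beta b (c - b) * A powr b) = A powr (b - c) * Beta b (c - b)"
    by (simp add: powr_diff powr_minus divide_inverse)
  finally show ?thesis .
qed

lemma Dirichlet_1D_cmult:
  assumes "0 < b" "b < c" "1 \<le> A"
  shows "(\<integral>\<^sup>+v. k * ennreal (wgt b 1 v * (A + mob 1 v) powr (- c)) \<partial>lborel01) = k * ennreal (A powr (b - c) *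
    Beta b (c - b))"
proof -
  have "(\<lambda>v. ennreal (wgt b 1 v * (A + mob 1 v) powr (- c))) \<in> borel_measurable lborel01"
    by (rule measurable_compose[OF _ measurable_ennreal], rule measurable_lborel01) measurable
  thus ?thesis unfolding Dirichlet_1D[OF assms, symmetric] by (rule nn_integral_cmult)
qed

text \<open>
In \<open>t\<^sub>j = v\<^sub>j / (1 - v\<^sub>j)\<close> this is the Dirichlet integral over the positive octant of
\<open>(1 + t\<^sub>1 + t\<^sub>2 + t\<^sub>3)\<^sup>-\<^sup>a\<close> times the powers of \<open>t\<^sub>j\<close> with exponent \<open>b\<^sub>j - 1\<close>,
evaluated one variable at a time. Nonnegative integrals are used so that Tonelli's theorem needs no
integrability of the sections.
\<close>
lemma cube_int_limit_value:
  assumes b: "0 < b1" "0 < b2" "0 < b3" "b1 + b2 + b3 < a"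
  shows "cube_int b1 b2 b3 a 1 1 1 0 = of_real (Gamma b1 * Gamma b2 * Gamma b3 * Gamma (a - b1 - b2 - b3) /
    Gamma a)"
proof -
  let ?B = "Beta b3 (a - b3) * Beta b2 (a - b3 - b2)"
  interpret II: sigma_finite_measure "lborel01 \<Otimes>\<^sub>M lborel01" by (rule sigma_finite_lborel01_lborel01)
  note Bpos = Beta_real_pos[of b3 "a - b3"] Beta_real_pos[of b2 "a - b3 - b2"] Beta_real_pos[of b1 "a - b2 - b3
    - b1"]
  let ?F = "\<lambda>v. wgt3 b1 b2 b3 1 1 1 v * (1 + mob3 1 1 1 v) powr (- a)"
  have id: "(\<lambda>x. x) \<in> measurable lborel01 borel" by (rule measurable_lborel01) measurable
  have F[measurable]: "?F \<in> borel_measurable cube" by measurable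
  have m2[measurable]: "(\<lambda>w. fst w) \<in> borel_measurable (lborel01 \<Otimes>\<^sub>M lborel01)" "(\<lambda>w. snd w) \<in> borel_measurable
    (lborel01 \<Otimes>\<^sub>M lborel01)"
    by (rule measurable_compose[OF _ id], simp)+
  have tp: "0 \<le> mob 1 v" if "v \<in> space lborel01" for v using mob_nonneg[of 1 v] that by simp
  have wm: "(\<lambda>v. wgt b 1 v * (A + mob 1 v) powr e) \<in> borel_measurable lborel01" for b A e
    by (rule measurable_lborel01) measurable
  have "(\<integral>\<^sup>+v. ennreal (?F v) \<partial>cube) = (\<integral>\<^sup>+v1. (\<integral>\<^sup>+w. ennreal (?F (v1, w)) \<partial>(lborel01 \<Otimes>\<^sub>M lborel01)) \<partial>lborel01)"
    unfolding cube_def by (rule II.nn_integral_fst[symmetric]) (use F in \<open>simp add: cube_def\<close>)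
  also have "\<dots> = (\<integral>\<^sup>+v1. ennreal (wgt b1 1 v1 * (1 + mob 1 v1) powr (b2 + b3 - a)) * ennreal (?B) \<partial>lborel01)"
  proof (rule nn_integral_cong)
    fix v1 assume v1: "v1 \<in> space lborel01"
    have "(\<integral>\<^sup>+w. ennreal (?F (v1, w)) \<partial>(lborel01 \<Otimes>\<^sub>M lborel01)) = (\<integral>\<^sup>+v2. (\<integral>\<^sup>+v3. ennreal (?F (v1, (v2, v3)))
      \<partial>lborel01) \<partial>lborel01)"
    proof (rule lborel01.nn_integral_fst[symmetric])
      show "(\<lambda>w. ennreal (?F (v1, w))) \<in> borel_measurable (lborel01 \<Otimes>\<^sub>M lborel01)"
        unfolding wgt3_def mob3_def fst_conv snd_conv by measurable
    qed
    also have "\<dots> = (\<integral>\<^sup>+v2. ennreal (wgt b1 1 v1 * Beta b3 (a - b3)) * ennreal (wgt b2 1 v2 * ((1 + mob 1 v1) +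
      mob 1 v2) powr (- (a - b3))) \<partial>lborel01)"
    proof (rule nn_integral_cong)
      fix v2 assume v2: "v2 \<in> space lborel01"
      have "(\<integral>\<^sup>+v3. ennreal (?F (v1, (v2, v3))) \<partial>lborel01) =
         (\<integral>\<^sup>+v3. ennreal (wgt b1 1 v1 * wgt b2 1 v2) * ennreal (wgt b3 1 v3 * ((1 + mob 1 v1 + mob 1 v2) + mob 1
           v3) powr (- a)) \<partial>lborel01)"
        by (intro nn_integral_cong) (simp add: wgt3_def mob3_def wgt_nonneg ennreal_mult[symmetric] add_ac
          mult_ac)
      also have "\<dots> = ennreal (wgt b1 1 v1 * wgt b2 1 v2) * ennreal ((1 + mob 1 v1 + mob 1 v2) powr (b3 - a) *
        Beta b3 (a - b3))"
        by (rule Dirichlet_1D_cmult) (use b tp[OF v1] tp[OF v2] in linarith)+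
      also have "\<dots> = ennreal (wgt b1 1 v1 * Beta b3 (a - b3)) * ennreal (wgt b2 1 v2 * ((1 + mob 1 v1) + mob 1
        v2) powr (- (a - b3)))"
        using Bpos b by (simp add: wgt_nonneg ennreal_mult[symmetric] mult_ac)
      finally show "(\<integral>\<^sup>+v3. ennreal (?F (v1, (v2, v3))) \<partial>lborel01) = \<dots>" .
    qed
    also have "\<dots> = ennreal (wgt b1 1 v1 * Beta b3 (a - b3)) * ennreal ((1 + mob 1 v1) powr (b2 - (a - b3)) *
      Beta b2 ((a - b3) - b2))"
      by (rule Dirichlet_1D_cmult) (use b tp[OF v1] in linarith)+
    also have "\<dots> = ennreal (wgt b1 1 v1 * (1 + mob 1 v1) powr (b2 + b3 - a)) * ennreal (?B)"
      using Bpos b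
      by (simp add: wgt_nonneg ennreal_mult[symmetric] mult_ac add_ac diff_diff_eq2)
    finally show "(\<integral>\<^sup>+w. ennreal (?F (v1, w)) \<partial>(lborel01 \<Otimes>\<^sub>M lborel01)) = \<dots>" .
  qed
  also have "\<dots> = (\<integral>\<^sup>+v1. ennreal (wgt b1 1 v1 * (1 + mob 1 v1) powr (- (a - b2 - b3))) \<partial>lborel01) * ennreal
    (?B)"
    by (subst nn_integral_multc) (use wm[of b1 1 "b2 + b3 - a"] in \<open>auto simp: algebra_simps\<close>)
  also have "\<dots> = ennreal (Beta b1 (a - b2 - b3 - b1) * (?B))"
    using Bpos b
    by (subst Dirichlet_1D) (auto simp: ennreal_mult[symmetric])
  finally have nn: "(\<integral>\<^sup>+v. ennreal (?F v) \<partial>cube) = ennreal (Beta b1 (a - b2 - b3 - b1) * (?B))" .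
  have "(LINT v|cube. ?F v) = Beta b1 (a - b2 - b3 - b1) * (?B)"
    using Bpos b
    by (subst integral_eq_nn_integral) (auto simp: wgt3_nonneg nn)
  also have "\<dots> = Gamma b1 * Gamma b2 * Gamma b3 * Gamma (a - b1 - b2 - b3) / Gamma a"
  proof -
    have nz: "Gamma (a - b3) \<noteq> 0" "Gamma (a - b3 - b2) \<noteq> 0"
      by (rule less_imp_neq[THEN not_sym], rule Gamma_real_pos, use b in linarith)+
    have e: "a - b2 - b3 - b1 = a - b1 - b2 - b3" "b1 + (a - b1 - b2 - b3) = a - b3 - b2"
      "b3 + (a - b3) = a" "b2 + (a - b3 - b2) = a - b3" by auto
    show ?thesis unfolding Beta_def e using nz by simp
  qed
  finally show ?thesis
    unfolding cube_int_def mult_zero_left hyp_0F1_0 mult_1_right integral_complex_of_real by simp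
qed

section \<open>Integrals depending on a complex parameter\<close>

text \<open>
Differentiation under the integral sign. The set of parameters \<open>s\<close> is exactly the one on which
\<open>1 + s T\<close> has positive real part for all \<open>0 \<le> T \<le> K\<close>. For fixed \<open>T\<close> the arguments \<open>1 + s T\<close> fill a convex
set when \<open>s\<close> runs through a disc, so a bound on the derivative bounds the difference quotients.
\<close>
lemma holomorphic_integral_affine:
  fixes M :: "'a measure" and w T :: "'a \<Rightarrow> real" and \<phi> :: "complex \<Rightarrow> complex"
  assumes w: "integrable M w" and T[measurable]: "T \<in> borel_measurable M"
    and TK: "\<And>v. v \<in> space M \<Longrightarrow> 0 \<le> T v" "\<And>v. v \<in> space M \<Longrightarrow> T v \<le> K" and K: "0 \<le> K"
    and \<phi>: "\<phi> holomorphic_on {z. Re z > 0}"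
  shows "(\<lambda>s. LINT v|M. of_real (w v) * \<phi> (1 + s * of_real (T v))) holomorphic_on {s. -1 < K * Re s}"
proof -
  let ?z = "\<lambda>s v. 1 + s * complex_of_real (T v)"
  define S where "S = {s. -1 < K * Re s}"
  define H where "H = {z. Re z > 0}"
  have oH: "open H" unfolding H_def by (rule open_halfspace_Re_gt)
  have oS: "open S"
    unfolding S_def by (intro open_Collect_less continuous_intros)
  have inH: "1 + s * of_real u \<in> H" if "s \<in> S" "0 \<le> u" "u \<le> K" for s u
  proof (cases "Re s \<ge> 0")
    case True
    hence "0 \<le> Re s * u" using that by simp
    thus ?thesis by (simp add: H_def)
  next
    case False
    hence "K * Re s \<le> u * Re s" using that by (intro mult_right_mono_neg) auto
    thus ?thesis using that by (simp add: H_def S_def mult.commute)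
  qed
  have \<phi>d: "(\<phi> has_field_derivative deriv \<phi> z) (at z)" if "z \<in> H" for z
    using \<phi> oH that holomorphic_derivI unfolding H_def by blast
  have d\<phi>: "deriv \<phi> holomorphic_on H" using \<phi> oH unfolding H_def by (rule holomorphic_deriv)
  \<comment> \<open>\<open>\<phi>\<close> need not be measurable outside the half-plane\<close>
  let ?\<phi>' = "\<lambda>z. if z \<in> H then \<phi> z else 0" and ?d' = "\<lambda>z. if z \<in> H then deriv \<phi> z else 0"
  have [measurable]: "?\<phi>' \<in> borel_measurable borel" "?d' \<in> borel_measurable borel"
    using oH \<phi> d\<phi> unfolding H_def
    by (intro borel_measurable_continuous_on_if holomorphic_on_imp_continuous_on continuous_on_const; auto)+
  note [measurable] = borel_measurable_integrable[OF w]
  have [measurable]: "(\<lambda>v. 1 + s * of_real (T v)) \<in> borel_measurable M" for s :: complex by measurable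
  have meas: "(\<lambda>v. of_real (w v) * \<phi> (?z s v)) \<in> borel_measurable M"
       "(\<lambda>v. of_real (w v) * (of_real (T v) * deriv \<phi> (?z s v))) \<in> borel_measurable M" if s: "s \<in> S" for s
  proof -
    have "(\<lambda>v. of_real (w v) * ?\<phi>' (?z s v)) \<in> borel_measurable M"
       "(\<lambda>v. of_real (w v) * (of_real (T v) * ?d' (?z s v))) \<in> borel_measurable M" by measurable
    thus "(\<lambda>v. of_real (w v) * \<phi> (?z s v)) \<in> borel_measurable M"
       "(\<lambda>v. of_real (w v) * (of_real (T v) * deriv \<phi> (?z s v))) \<in> borel_measurable M"
      using inH[OF s] TK by (simp_all cong: measurable_cong)
  qed
  define g where "g s = (LINT v|M. of_real (w v) * \<phi> (?z s v))" for s
  have "\<exists>D. (g has_field_derivative D) (at s0)" if s0: "s0 \<in> S" for s0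
  proof -
    obtain \<rho> where \<rho>: "\<rho> > 0" "cball s0 \<rho> \<subseteq> S" using oS s0 open_contains_cball by blast
    define C where "C = (\<lambda>(s, u). 1 + s * complex_of_real u) ` (cball s0 \<rho> \<times> {0..K})"
    have "compact C" unfolding C_def
      by (intro compact_continuous_image compact_Times compact_cball)
         (auto simp: case_prod_unfold intro!: continuous_intros)
    moreover have CH: "C \<subseteq> H" unfolding C_def using inH \<rho>(2) by auto
    ultimately have "compact (\<phi> ` C)" "compact (deriv \<phi> ` C)"
      using \<phi> d\<phi> unfolding H_def
      by (meson compact_continuous_image continuous_on_subset holomorphic_on_imp_continuous_on)+
    then obtain B1 B2 where B: "B1 > 0" "B2 > 0" "\<And>z. z \<in> C \<Longrightarrow> norm (\<phi> z) \<le> B1" "\<And>z. z \<in> C \<Longrightarrow> norm (deriv \<phi> z) \<le>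
      B2"
      using compact_imp_bounded bounded_pos by (metis (no_types, lifting) imageI)
    have inC: "1 + s * of_real (T v) \<in> C" if "s \<in> cball s0 \<rho>" "v \<in> space M" for s v
      unfolding C_def using TK that by (intro image_eqI[of _ _ "(s, T v)"]) auto
    have int: "integrable M (\<lambda>v. of_real (w v) * \<phi> (?z s v))" if s: "s \<in> cball s0 \<rho>" for s
    proof (rule Bochner_Integration.integrable_bound)
      show "integrable M (\<lambda>v. B1 * \<bar>w v\<bar>)" using w by (intro integrable_mult_right integrable_abs)
      show "(\<lambda>v. of_real (w v) * \<phi> (?z s v)) \<in> borel_measurable M"
        using meas s \<rho>(2) by blast
      show "AE v in M. norm (of_real (w v) * \<phi> (?z s v)) \<le> norm (B1 * \<bar>w v\<bar>)"
        using B inC[OF s] by (auto intro!: AE_I2 mult_left_mono simp: norm_mult mult.commute[of B1] abs_mult)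
    qed
    have lip: "norm (\<phi> (?z s v) - \<phi> (?z s0 v)) \<le> B2 * K * norm (s - s0)"
      if s: "s \<in> cball s0 \<rho>" and v: "v \<in> space M" for s v
    proof -
      let ?Z = "(\<lambda>s. 1 + s * of_real (T v)) ` cball s0 \<rho>"
      have "convex ?Z"
        using convex_translation[OF convex_linear_image[OF linear_times[of "complex_of_real (T v)"]
          convex_cball[of s0 \<rho>]], of 1]
        by (simp add: image_image mult.commute)
      moreover have "?Z \<subseteq> C" using inC v by auto
      ultimately have "norm (\<phi> (?z s v) - \<phi> (?z s0 v)) \<le> B2 * norm ((?z s v) - (?z s0 v))"
        by (intro field_differentiable_bound[of ?Z \<phi> "deriv \<phi>" B2])
           (use B CH s \<rho>(1) in \<open>auto intro!: has_field_derivative_at_within[OF \<phi>d] dest: subsetD\<close>)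
      also have "(?z s v) - (?z s0 v) = (s - s0) * of_real (T v)"
        by (simp add: algebra_simps)
      also have "B2 * norm ((s - s0) * of_real (T v)) \<le> B2 * (norm (s - s0) * K)"
        unfolding norm_mult norm_of_real using TK[OF v] B(2) by (intro mult_left_mono) auto
      finally show ?thesis by (simp add: mult_ac)
    qed
    let ?D = "LINT v|M. of_real (w v) * (of_real (T v) * deriv \<phi> (?z s0 v))"
    have "((\<lambda>s. (g s - g s0) / (s - s0)) \<longlongrightarrow> ?D) (at s0 within ball s0 \<rho>)"
      unfolding tendsto_at_iff_sequentially
    proof (intro allI impI)
      fix X :: "nat \<Rightarrow> complex" assume X: "\<forall>i. X i \<in> ball s0 \<rho> - {s0}" "X \<longlonglongrightarrow> s0"
      have Xb: "X i \<in> cball s0 \<rho>" "X i \<noteq> s0" for i using X(1) by (auto simp: less_imp_le)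
      have s0b: "s0 \<in> cball s0 \<rho>" using \<rho> by simp
      let ?q = "\<lambda>i v. of_real (w v) * ((\<phi> (?z (X i) v) - \<phi> (?z s0 v)) / (X i - s0))"
      have qeq: "?q i v = (of_real (w v) * \<phi> (?z (X i) v) - of_real (w v) * \<phi> (?z s0 v)) / (X i - s0)" for i v
        by (simp add: algebra_simps)
      have Q: "(g (X i) - g s0) / (X i - s0) = (LINT v|M. ?q i v)" for i
        unfolding g_def qeq by (subst Bochner_Integration.integral_diff[symmetric]) (use int Xb s0b in auto)
      have "(\<lambda>i. LINT v|M. ?q i v) \<longlonglongrightarrow> ?D"
      proof (rule integral_dominated_convergence[where w = "\<lambda>v. B2 * K * \<bar>w v\<bar>"])
        show "integrable M (\<lambda>v. B2 * K * \<bar>w v\<bar>)" using w by (intro integrable_mult_right integrable_abs)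
        show "?q i \<in> borel_measurable M" for i
          unfolding qeq using meas(1)[of "X i"] meas(1)[OF s0] Xb(1)[of i] \<rho>(2)
          by (intro borel_measurable_divide borel_measurable_diff) auto
        show "(\<lambda>v. of_real (w v) * (of_real (T v) * deriv \<phi> (?z s0 v))) \<in> borel_measurable M"
          by (rule meas(2)[OF s0])
        show "AE v in M. norm (?q i v) \<le> B2 * K * \<bar>w v\<bar>" for i
        proof (rule AE_I2)
          fix v assume v: "v \<in> space M"
          have "norm ((\<phi> (?z (X i) v) - \<phi> (?z s0 v)) / (X i - s0)) \<le> B2 * K"
            using lip[OF Xb(1)[of i] v] Xb(2)[of i] by (simp add: norm_divide divide_le_eq)
          thus "norm (?q i v) \<le> B2 * K * \<bar>w v\<bar>"
            unfolding norm_mult[of "of_real (w v)"] norm_of_real mult.commute[of "B2 * K"] by (intro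
              mult_left_mono) auto
        qed
        show "AE v in M. (\<lambda>i. ?q i v) \<longlonglongrightarrow> of_real (w v) * (of_real (T v) * deriv \<phi> (?z s0 v))"
        proof (rule AE_I2)
          fix v assume v: "v \<in> space M"
          have "((\<lambda>s. \<phi> (?z s v)) has_field_derivative deriv \<phi> (?z s0 v) * of_real (T v)) (at s0)"
            by (rule DERIV_chain2[where f = \<phi> and g = "\<lambda>s. 1 + s * of_real (T v)", OF \<phi>d[OF inH]]) (use s0 TK[OF
              v] in \<open>auto intro!: derivative_eq_intros\<close>)
          hence "((\<lambda>s. (\<phi> (?z s v) - \<phi> (?z s0 v)) / (s - s0)) \<longlongrightarrow> deriv \<phi> (?z s0 v) * of_real (T v)) (at s0)"
            unfolding has_field_derivative_iff .
          hence "((\<lambda>s. (\<phi> (?z s v) - \<phi> (?z s0 v)) / (s - s0)) \<circ> X) \<longlonglongrightarrow> deriv \<phi> (?z s0 v) * of_real (T v)"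
            using X Xb(2) unfolding tendsto_at_iff_sequentially by blast
          thus "(\<lambda>i. ?q i v) \<longlonglongrightarrow> of_real (w v) * (of_real (T v) * deriv \<phi> (?z s0 v))"
            unfolding o_def mult.commute[of "of_real (T v)"] by (intro tendsto_mult tendsto_const)
        qed
      qed
      thus "((\<lambda>s. (g s - g s0) / (s - s0)) \<circ> X) \<longlonglongrightarrow> ?D" unfolding o_def Q .
    qed
    hence "(g has_field_derivative ?D) (at s0)"
      unfolding has_field_derivative_iff using \<rho>(1) at_within_open[of s0 "ball s0 \<rho>"] by simp
    thus ?thesis by blast
  qed
  thus ?thesis
    unfolding S_def[symmetric] g_def[symmetric] holomorphic_on_def field_differentiable_def
    by (blast intro: has_field_derivative_at_within)
qed

text \<open>
\<open>\<Gamma>(a + N - l) / \<Gamma>(a)\<close> is written with \<open>\<Gamma>(a - l)\<close> in between. This separates the confluent index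
\<open>l\<close> from the other three.
\<close>
lemma poch_diff:
  fixes a :: real
  assumes a: "0 < a" and c: "1 - a \<notin> \<int>\<^sub>\<le>\<^sub>0"
  shows "poch a (int N - int l) = pochhammer (a - real l) N * ((- 1) ^ l / pochhammer (1 - a) l)"
proof -
  have a0: "a \<notin> \<int>\<^sub>\<le>\<^sub>0" using a by (auto elim!: nonpos_Ints_cases)
  have al: "a - real l \<notin> \<int>\<^sub>\<le>\<^sub>0"
  proof
    assume "a - real l \<in> \<int>\<^sub>\<le>\<^sub>0"
    then obtain z where "a - real l = of_int z" by (auto elim: nonpos_Ints_cases)
    hence e: "a = of_int (z + int l)" by simp
    hence "z + int l \<ge> 1" using a by linarith
    hence "1 - a \<in> \<int>\<^sub>\<le>\<^sub>0" using e nonpos_Ints_of_int[of "1 - (z + int l)"] by simp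
    thus False using c by simp
  qed
  have nz: "Gamma (a - real l) \<noteq> 0" using al by (simp add: Gamma_eq_zero_iff)
  have 1: "pochhammer (a - real l) N = Gamma (a + real N - real l) / Gamma (a - real l)"
    using pochhammer_Gamma[OF al, of N] by (simp add: algebra_simps)
  have "pochhammer (a - real l) l = Gamma a / Gamma (a - real l)"
    using pochhammer_Gamma[OF al, of l] by simp
  moreover have "pochhammer (1 - a) l = (- 1) ^ l * pochhammer (a - real l) l"
    using pochhammer_minus[of "a - 1" l] by simp
  ultimately have 2: "pochhammer (1 - a) l = (- 1) ^ l * (Gamma a / Gamma (a - real l))" by simp
  show ?thesis
    unfolding poch_eq_Gamma[OF a0] 1 2 using nz by (simp add: add_diff_eq power_mult_distrib[symmetric]
      divide_simps)
qed

text \<open>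
The summand of \<open>H\<close> without the quotients \<open>(b)\<^sub>m / (d)\<^sub>m\<close>; these are supplied by integration.
\<close>
definition H_summand :: "real \<Rightarrow> complex \<Rightarrow> complex \<Rightarrow> complex \<Rightarrow> complex \<Rightarrow> nat \<times> nat \<times> nat \<times> nat \<Rightarrow> complex" where
  "H_summand a X Y Z t = (\<lambda>(m, n, k, l). of_real (poch a (int m + int n + int k - int l) / (fact m * fact n *
    fact k * fact l))
     * X ^ m * Y ^ n * Z ^ k * t ^ l)"

text \<open>
For fixed \<open>l\<close> this is the trinomial series with exponent \<open>-(a - l)\<close>; the extra factor
\<open>(1 - X - Y - Z)\<^sup>l\<close> then enters the argument of \<open>\<^sub>0F\<^sub>1\<close>.
\<close>
lemma
  fixes X Y Z t :: complex
  assumes a: "0 < a" and c: "1 - a \<notin> \<int>\<^sub>\<le>\<^sub>0" and lt: "norm X + norm Y + norm Z \<le> 1 / 2"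
  shows H_summand_has_sum: "(H_summand a X Y Z t has_sum
      (1 - (X + Y + Z)) powr (- of_real a) * hyp_0F1 (1 - a) (- t * (1 - (X + Y + Z)))) UNIV"
    and H_summand_norm_summable: "(\<lambda>z. norm (H_summand a X Y Z t z)) summable_on UNIV"
    and H_summand_norm_bound: "(\<Sum>\<^sub>\<infinity>z. norm (H_summand a X Y Z t z)) \<le>
        2 powr a * (\<Sum>\<^sub>\<infinity>l. \<bar>1 / pochhammer (1 - a) l\<bar> * (2 * norm t) ^ l / fact l)"
proof -
  define x where "x = 1 - (X + Y + Z)"
  define \<rho> where "\<rho> = norm X + norm Y + norm Z"
  have \<rho>: "0 \<le> \<rho>" "\<rho> \<le> 1 / 2" using lt by (auto simp: \<rho>_def)
  let ?m = "\<lambda>l. 2 powr a * (\<bar>1 / pochhammer (1 - a) l\<bar> * (2 * norm t) ^ l / fact l)"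
  let ?c = "\<lambda>l p. \<bar>pochhammer (a - real l) p\<bar> * \<rho> ^ p / fact p"
  have nle: "norm (X + Y + Z) \<le> \<rho>"
    unfolding \<rho>_def by (meson norm_triangle_ineq norm_triangle_mono order.refl)
  have x0: "x \<noteq> 0"
  proof
    assume "x = 0"
    hence "X + Y + Z = 1" by (simp add: x_def)
    thus False using nle \<rho> by simp
  qed
  define d where "d l = (- 1) ^ l / pochhammer (1 - a) l / fact l" for l
  define h where "h = (\<lambda>(l, m, n, k). (of_real (d l) * t ^ l) *
      (of_real (pochhammer (a - real l) (m + n + k)) * X ^ m * Y ^ n * Z ^ k / (fact m * fact n * fact k)))"
  have heq: "H_summand a X Y Z t (m, n, k, l) = h (l, m, n, k)" for m n k l
  proof -
    have e: "int m + int n + int k - int l = int (m + n + k) - int l" by simp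
    show ?thesis
      unfolding H_summand_def h_def prod.case e poch_diff[OF a c] by (simp add: d_def mult_ac)
  qed
  have summ: "(\<lambda>p. ?c l p) summable_on UNIV" for l
  proof (rule norm_summable_imp_summable_on)
    have "summable (\<lambda>p. \<bar>pochhammer (a - real l) p\<bar> * \<bar>\<rho>\<bar> ^ p / fact p)"
      by (rule summable_abs_pochhammer) (use \<rho> in auto)
    thus "summable (\<lambda>p. norm (?c l p))"
      using \<rho>(1) by (simp add: abs_mult power_abs)
  qed
  have in1: "((\<lambda>z. h (l, z)) has_sum (x powr (- of_real a) * (of_real (1 / pochhammer (1 - a) l) * (- t * x) ^ l
    / fact l))) UNIV" for l
  proof -
    have "((\<lambda>(m, n, k). of_real (pochhammer (a - real l) (m + n + k)) * X ^ m * Y ^ n * Z ^ k / (fact m * fact n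
      * fact k)) has_sum
        (1 - (X + Y + Z)) powr (- of_real (a - real l))) UNIV"
    proof (rule exp_generating_3)
      show "((\<lambda>p. complex_of_real (pochhammer (a - real l) p) * (X + Y + Z) ^ p / fact p) has_sum (1 - (X + Y +
        Z)) powr - complex_of_real (a - real l)) UNIV"
        by (rule pochhammer_binomial_has_sum_complex) (use nle \<rho> in linarith)
      show "(\<lambda>p. norm (complex_of_real (pochhammer (a - real l) p)) * (norm X + norm Y + norm Z) ^ p / fact p)
        summable_on UNIV"
        using summ[of l] by (simp add: \<rho>_def)
    qed
    from has_sum_cmult_right[OF this, of "of_real (d l) * t ^ l"]
    have "((\<lambda>z. h (l, z)) has_sum (of_real (d l) * t ^ l) * x powr (- of_real (a - real l))) UNIV"
      by (simp add: h_def x_def case_prod_unfold)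
    also have "x powr (- of_real (a - real l)) = x powr (- of_real a) * x ^ l"
    proof -
      have "x powr (- of_real (a - real l)) = x powr (- of_real a + of_nat l)" by simp
      also have "\<dots> = x powr (- of_real a) * x powr of_nat l" by (rule powr_add)
      also have "x powr of_nat l = x ^ l" using x0 by (simp add: powr_nat')
      finally show ?thesis .
    qed
    also have "of_real (d l) * t ^ l * (x powr (- of_real a) * x ^ l) = x powr (- of_real a) * (of_real (1 /
      pochhammer (1 - a) l) * (- t * x) ^ l / fact l)"
    proof -
      have neg: "(- t * x) ^ l = (- 1) ^ l * t ^ l * x ^ l"
        by (simp add: power_mult_distrib[symmetric])
      show ?thesis unfolding neg by (simp add: d_def mult_ac)
    qed
    finally show ?thesis .
  qed
  have in1n: "((\<lambda>z. norm (h (l, z))) has_sum (\<bar>d l\<bar> * norm t ^ l * (\<Sum>\<^sub>\<infinity>p. ?c l p))) UNIV" for l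
  proof -
    have "((\<lambda>(m, n, k). \<bar>pochhammer (a - real l) (m + n + k)\<bar> * norm X ^ m * norm Y ^ n * norm Z ^ k / (fact m *
      fact n * fact k)) has_sum
        (\<Sum>\<^sub>\<infinity>p. ?c l p)) UNIV"
      by (rule exp_generating_3) (use has_sum_infsum[OF summ[of l]] summ[of l] in \<open>simp_all add: \<rho>_def\<close>)
    from has_sum_cmult_right[OF this, of "\<bar>d l\<bar> * norm t ^ l"] show ?thesis
      by (simp add: h_def case_prod_unfold norm_mult norm_divide norm_power)
  qed
  define q where "q l = \<bar>d l\<bar> * norm t ^ l * (\<Sum>\<^sub>\<infinity>p. ?c l p)" for l
  have q0: "0 \<le> q l" for l unfolding q_def using \<rho>(1) by (intro mult_nonneg_nonneg infsum_nonneg) auto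
  \<comment> \<open>As \<open>1 - \<rho> \<ge> 1/2\<close>, the inner sum costs only a factor \<open>2\<^sup>l\<close>, which \<open>l!\<close> absorbs.\<close>
  have qle: "q l \<le> ?m l" for l
  proof -
    have hs2: "((\<lambda>p. pochhammer (a + real l) p * \<rho> ^ p / fact p) has_sum (1 - \<rho>) powr (- (a + real l))) UNIV"
      by (rule pochhammer_binomial_has_sum) (use \<rho> in auto)
    have "(\<Sum>\<^sub>\<infinity>p. ?c l p) \<le> (1 - \<rho>) powr (- (a + real l))"
    proof (rule has_sum_mono[OF has_sum_infsum[OF summ] hs2])
      fix p
      have "\<bar>pochhammer (a - real l) p\<bar> \<le> pochhammer (a + real l) p"
        by (rule abs_pochhammer_le) (use a in auto)
      thus "?c l p \<le> pochhammer (a + real l) p * \<rho> ^ p / fact p"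
        using \<rho>(1) by (intro divide_right_mono mult_right_mono) auto
    qed
    also have "\<dots> \<le> (1 / 2) powr (- (a + real l))"
      by (rule powr_mono2') (use \<rho> a in auto)
    also have "\<dots> = 2 powr (a + real l)"
      by (simp add: powr_divide powr_minus_divide[of 2 "a + real l"] del: minus_add_distrib)
    also have "\<dots> = 2 powr a * 2 ^ l"
      by (simp add: powr_add powr_realpow)
    finally have "q l \<le> \<bar>d l\<bar> * norm t ^ l * (2 powr a * 2 ^ l)"
      unfolding q_def by (intro mult_left_mono) auto
    thus ?thesis by (simp add: d_def abs_mult abs_divide power_mult_distrib mult_ac)
  qed
  have sq': "(\<lambda>l. \<bar>1 / pochhammer (1 - a) l\<bar> * (2 * norm t) ^ l / fact l) summable_on UNIV"
    using summable_on_0F1[OF c, of "2 * norm t"] unfolding norm_of_real by simp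
  hence sq'': "(\<lambda>l. ?m l) summable_on UNIV"
    by (rule summable_on_cmult_right)
  have sq: "q summable_on UNIV"
    by (rule summable_on_comparison_test[OF sq'']) (use qle q0 in auto)
  have in1n': "((\<lambda>z. norm (h (l, z))) has_sum q l) UNIV" for l
    using in1n[of l] unfolding q_def .
  have ns: "(\<lambda>z. norm (h z)) summable_on UNIV \<times> UNIV"
    by (rule summable_on_SigmaI[OF in1n' sq]) auto
  have N: "((\<lambda>z. norm (h z)) has_sum (\<Sum>\<^sub>\<infinity>l. q l)) (UNIV \<times> UNIV)"
    by (rule has_sum_SigmaI[OF in1n' has_sum_infsum[OF sq] ns])
  have G: "(h has_sum x powr (- of_real a) * hyp_0F1 (1 - a) (- t * x)) (UNIV \<times> UNIV)"
    by (rule has_sum_SigmaI[OF in1 has_sum_cmult_right[OF hyp_0F1_has_sum[OF c]] abs_summable_summable[OF ns]])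
  have N': "((\<lambda>z. norm (H_summand a X Y Z t z)) has_sum (\<Sum>\<^sub>\<infinity>l. q l)) UNIV"
    using N
    by (subst has_sum_reindex_bij_witness[where i = "\<lambda>(l, m, n, k). (m, n, k, l)" and j = "\<lambda>(m, n, k, l). (l, m,
      n, k)"
          and T = "UNIV \<times> UNIV" and h = "\<lambda>z. norm (h z)"]) (auto simp: heq)
  show "(H_summand a X Y Z t has_sum
      (1 - (X + Y + Z)) powr (- of_real a) * hyp_0F1 (1 - a) (- t * (1 - (X + Y + Z)))) UNIV"
    using G unfolding x_def[symmetric]
    by (subst has_sum_reindex_bij_witness[where i = "\<lambda>(l, m, n, k). (m, n, k, l)" and j = "\<lambda>(m, n, k, l). (l, m,
      n, k)"
          and T = "UNIV \<times> UNIV" and h = h]) (auto simp: heq)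
  show "(\<lambda>z. norm (H_summand a X Y Z t z)) summable_on UNIV" using N' by (auto simp: summable_on_def)
  have "(\<Sum>\<^sub>\<infinity>z. norm (H_summand a X Y Z t z)) = (\<Sum>\<^sub>\<infinity>l. q l)" using N' by (rule infsumI)
  also have "\<dots> \<le> (\<Sum>\<^sub>\<infinity>l. ?m l)"
    by (rule infsum_mono[OF sq sq'' qle])
  also have "\<dots> = 2 powr a * (\<Sum>\<^sub>\<infinity>l. \<bar>1 / pochhammer (1 - a) l\<bar> * (2 * norm t) ^ l / fact l)"
    by (rule infsum_cmult_right')
  finally show "(\<Sum>\<^sub>\<infinity>z. norm (H_summand a X Y Z t z)) \<le>
        2 powr a * (\<Sum>\<^sub>\<infinity>l. \<bar>1 / pochhammer (1 - a) l\<bar> * (2 * norm t) ^ l / fact l)" .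
qed

section \<open>The continuation of H as an integral over the cube\<close>

lemma mob_le:
  assumes "0 \<le> \<xi>" "\<xi> < 1" "0 < w" "w < 1"
  shows "mob \<xi> w \<le> \<xi> / (1 - \<xi>)"
  unfolding mob_def by (rule frac_le) (use assms in \<open>auto simp: mult_left_le\<close>)

lemma mob3_le:
  assumes \<xi>: "0 \<le> \<xi>1" "\<xi>1 < 1" "0 \<le> \<xi>2" "\<xi>2 < 1" "0 \<le> \<xi>3" "\<xi>3 < 1" and v: "v \<in> space cube"
  shows "mob3 \<xi>1 \<xi>2 \<xi>3 v \<le> \<xi>1 / (1 - \<xi>1) + \<xi>2 / (1 - \<xi>2) + \<xi>3 / (1 - \<xi>3)"
  unfolding mob3_def using v \<xi> by (intro add_mono mob_le) (auto simp: space_cube)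

lemma
  assumes b: "0 < b1" "0 < b2" "0 < b3"
    and \<xi>: "0 \<le> \<xi>1" "\<xi>1 < 1" "0 \<le> \<xi>2" "\<xi>2 < 1" "0 \<le> \<xi>3" "\<xi>3 < 1"
  shows integrable_wgt3_mob_monomial: "integrable cube (\<lambda>v. wgt3 b1 b2 b3 \<xi>1 \<xi>2 \<xi>3 v * mob_monomial \<xi>1 \<xi>2 \<xi>3 m n
    k v)"
    and integral_wgt3_mob_monomial: "(LINT v|cube. wgt3 b1 b2 b3 \<xi>1 \<xi>2 \<xi>3 v * mob_monomial \<xi>1 \<xi>2 \<xi>3 m n k v) =
      Beta b1 b1 * (pochhammer b1 m / pochhammer (2 * b1) m * (\<xi>1 / (1 - \<xi>1)) ^ m * (1 - \<xi>1) powr (- b1)) *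
      (Beta b2 b2 * (pochhammer b2 n / pochhammer (2 * b2) n * (\<xi>2 / (1 - \<xi>2)) ^ n * (1 - \<xi>2) powr (- b2))) *
      (Beta b3 b3 * (pochhammer b3 k / pochhammer (2 * b3) k * (\<xi>3 / (1 - \<xi>3)) ^ k * (1 - \<xi>3) powr (- b3)))"
proof -
  have eq: "(\<lambda>v. wgt3 b1 b2 b3 \<xi>1 \<xi>2 \<xi>3 v * mob_monomial \<xi>1 \<xi>2 \<xi>3 m n k v) =
     (\<lambda>v. (wgt b1 \<xi>1 (fst v) * mob \<xi>1 (fst v) ^ m) * (wgt b2 \<xi>2 (fst (snd v)) * mob \<xi>2 (fst (snd v)) ^ n)
        * (wgt b3 \<xi>3 (snd (snd v)) * mob \<xi>3 (snd (snd v)) ^ k))"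
    by (simp add: fun_eq_iff wgt3_def mob_monomial_def mult_ac)
  note int = integrable_wgt_power[OF b(1) \<xi>(1,2), of m] integrable_wgt_power[OF b(2) \<xi>(3,4), of n]
    integrable_wgt_power[OF b(3) \<xi>(5,6), of k]
  show "integrable cube (\<lambda>v. wgt3 b1 b2 b3 \<xi>1 \<xi>2 \<xi>3 v * mob_monomial \<xi>1 \<xi>2 \<xi>3 m n k v)"
    unfolding eq by (rule integrable_cube_product[OF int])
  show "(LINT v|cube. wgt3 b1 b2 b3 \<xi>1 \<xi>2 \<xi>3 v * mob_monomial \<xi>1 \<xi>2 \<xi>3 m n k v) =
      Beta b1 b1 * (pochhammer b1 m / pochhammer (2 * b1) m * (\<xi>1 / (1 - \<xi>1)) ^ m * (1 - \<xi>1) powr (- b1)) *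
      (Beta b2 b2 * (pochhammer b2 n / pochhammer (2 * b2) n * (\<xi>2 / (1 - \<xi>2)) ^ n * (1 - \<xi>2) powr (- b2))) *
      (Beta b3 b3 * (pochhammer b3 k / pochhammer (2 * b3) k * (\<xi>3 / (1 - \<xi>3)) ^ k * (1 - \<xi>3) powr (- b3)))"
    unfolding eq integral_cube_product[OF int]
      integral_wgt_power[OF b(1) \<xi>(1,2)] integral_wgt_power[OF b(2) \<xi>(3,4)] integral_wgt_power[OF b(3) \<xi>(5,6)]
        ..
qed

lemma H_summand_scaled:
  "H_summand a (- s * of_real x) (- s * of_real y) (- s * of_real z) t (m, n, k, l) =
     (of_real (poch a (int m + int n + int k - int l) / (fact m * fact n * fact k * fact l)) * (- s) ^ (m + n +
       k) * t ^ l)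
       * of_real (x ^ m * y ^ n * z ^ k)"
  unfolding H_summand_def prod.case power_mult_distrib power_add of_real_mult of_real_power by (simp only:
    mult_ac)

text \<open>
\<open>H\<close> is defined by continuation in \<open>s\<close> along \<open>s \<sigma>\<close>. The integral with \<open>1 + s T\<close> in place of \<open>1 + T\<close> is
holomorphic near \<open>[0, 1]\<close>, and integrating \<open>H_summand\<close> term by term shows that it equals the series for
small \<open>s\<close>.
\<close>
lemma H430_eq_cube_int:
  fixes t :: complex
  assumes c: "1 - a \<notin> \<int>\<^sub>\<le>\<^sub>0" and a: "0 < a"
    and b: "0 < b1" "0 < b2" "0 < b3"
    and \<xi>: "0 \<le> \<xi>1" "\<xi>1 < 1" "0 \<le> \<xi>2" "\<xi>2 < 1" "0 \<le> \<xi>3" "\<xi>3 < 1"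
  shows "H430 a b1 b2 b3 (2 * b1) (2 * b2) (2 * b3)
      (of_real (- (\<xi>1 / (1 - \<xi>1)))) (of_real (- (\<xi>2 / (1 - \<xi>2)))) (of_real (- (\<xi>3 / (1 - \<xi>3)))) t =
    of_real ((1 - \<xi>1) powr b1 / Beta b1 b1 * ((1 - \<xi>2) powr b2 / Beta b2 b2) * ((1 - \<xi>3) powr b3 / Beta b3 b3))
      * cube_int b1 b2 b3 a \<xi>1 \<xi>2 \<xi>3 (- t)"
proof (rule H430_eqI)
  define u1 u2 u3 where u_def: "u1 = \<xi>1 / (1 - \<xi>1)" "u2 = \<xi>2 / (1 - \<xi>2)" "u3 = \<xi>3 / (1 - \<xi>3)"
  have u: "0 \<le> u1" "0 \<le> u2" "0 \<le> u3" using \<xi> by (auto simp: u_def)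
  define K where "K = u1 + u2 + u3"
  have K: "0 \<le> K" using u by (simp add: K_def)
  define kap where "kap = (1 - \<xi>1) powr b1 / Beta b1 b1 * ((1 - \<xi>2) powr b2 / Beta b2 b2) * ((1 - \<xi>3) powr b3 /
    Beta b3 b3)"
  define W T where "W = wgt3 b1 b2 b3 \<xi>1 \<xi>2 \<xi>3" and "T = mob3 \<xi>1 \<xi>2 \<xi>3"
  define \<phi> where "\<phi> z = z powr (- of_real a) * hyp_0F1 (1 - a) (- t * z)" for z
  define g where "g s = of_real kap * (LINT v|cube. of_real (W v) * \<phi> (1 + s * of_real (T v)))" for s
  define S where "S = {s. - 1 < K * Re s}"
  let ?H = "\<lambda>s. H430_series a b1 b2 b3 (2 * b1) (2 * b2) (2 * b3)
      (s * of_real (- u1)) (s * of_real (- u2)) (s * of_real (- u3)) t"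
  have \<xi>': "\<xi>1 \<le> 1" "\<xi>2 \<le> 1" "\<xi>3 \<le> 1" using \<xi> by auto
  have [measurable]: "W \<in> borel_measurable cube" "T \<in> borel_measurable cube" unfolding W_def T_def by measurable
  have T0: "0 \<le> T v" and TK: "T v \<le> K" if "v \<in> space cube" for v
    using mob3_nonneg[OF \<xi>(1) \<xi>'(1) \<xi>(3) \<xi>'(2) \<xi>(5) \<xi>'(3) that] mob3_le[OF \<xi> that] by (simp_all add: T_def K_def
      u_def)
  have Wint: "integrable cube W"
    using integrable_wgt3_mob_monomial[OF b \<xi>, of 0 0 0] by (simp add: mob_monomial_def W_def)
  have \<phi>: "\<phi> holomorphic_on {z. Re z > 0}"
    unfolding \<phi>_def
  proof (intro holomorphic_intros)
    show "z \<notin> \<real>\<^sub>\<le>\<^sub>0" if "z \<in> {z. Re z > 0}" for z using that by (auto simp: complex_nonpos_Reals_iff)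
    have "(hyp_0F1 (1 - a) \<circ> (\<lambda>z. - t * z)) holomorphic_on {z. Re z > 0}"
      by (intro holomorphic_on_compose hyp_0F1_holomorphic c holomorphic_intros)
    thus "(\<lambda>z. hyp_0F1 (1 - a) (- t * z)) holomorphic_on {z. Re z > 0}" by (simp add: o_def)
  qed
  have gh: "g holomorphic_on S"
    unfolding g_def S_def
    by (intro holomorphic_on_mult holomorphic_on_const holomorphic_integral_affine Wint \<phi> K) (use T0 TK in auto)
  have oS: "open S"
    unfolding S_def by (intro open_Collect_less continuous_intros)
  have seg: "closed_segment 0 1 \<subseteq> S"
  proof
    fix s :: complex assume "s \<in> closed_segment 0 1"
    then obtain r where r: "0 \<le> r" "r \<le> 1" "s = of_real r" by (auto simp: closed_segment_def
      scaleR_conv_of_real)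
    have "0 \<le> K * r" using K r by simp
    thus "s \<in> S" using r(3) by (simp add: S_def)
  qed
  have ser: "g s = ?H s" if s: "norm s * K \<le> 1 / 2" for s
  proof -
    define f where "f z v = of_real (W v) * H_summand a (- s * of_real (mob \<xi>1 (fst v))) (- s * of_real (mob \<xi>2
      (fst (snd v)))) (- s * of_real (mob \<xi>3 (snd (snd v)))) t z" for z v
    have feq: "f (m, n, k, l) v = (of_real (poch a (int m + int n + int k - int l) / (fact m * fact n * fact k *
      fact l)) * (- s) ^ (m + n + k) * t ^ l)
       * of_real (W v * mob_monomial \<xi>1 \<xi>2 \<xi>3 m n k v)" for m n k l v
      unfolding f_def H_summand_scaled mob_monomial_def by (simp add: mult_ac)
    let ?B = "2 powr a * (\<Sum>\<^sub>\<infinity>l. \<bar>1 / pochhammer (1 - a) l\<bar> * (2 * norm t) ^ l / fact l)"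
    have hs: "((\<lambda>z. LINT v|cube. f z v) has_sum (LINT v|cube. of_real (W v) * \<phi> (1 + s * of_real (T v)))) UNIV"
    proof (rule has_sum_lebesgue_integral(2)[where h = "\<lambda>v. W v * ?B"])
      show "f z \<in> borel_measurable cube" for z
      proof -
        obtain m n k l where z: "z = (m, n, k, l)" by (cases z)
        show ?thesis unfolding z feq by measurable
      qed
      fix v assume v: "v \<in> space cube"
      let ?X = "- s * of_real (mob \<xi>1 (fst v))" and ?Y = "- s * of_real (mob \<xi>2 (fst (snd v)))" and ?Z = "- s *
        of_real (mob \<xi>3 (snd (snd v)))"
      have tts: "0 \<le> mob \<xi>1 (fst v)" "0 \<le> mob \<xi>2 (fst (snd v))" "0 \<le> mob \<xi>3 (snd (snd v))"
        using \<xi> \<xi>' v by (auto simp: space_cube intro!: mob_nonneg)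
      have W0: "0 \<le> W v" by (simp add: W_def wgt3_nonneg)
      have "norm ?X + norm ?Y + norm ?Z = norm s * T v"
        using tts by (simp add: norm_mult T_def mob3_def distrib_left)
      also have "\<dots> \<le> norm s * K" using TK[OF v] by (intro mult_left_mono) auto
      finally have le: "norm ?X + norm ?Y + norm ?Z \<le> 1 / 2" using s by linarith
      have x: "1 - (?X + ?Y + ?Z) = 1 + s * of_real (T v)"
        by (simp add: T_def mob3_def algebra_simps)
      show "((\<lambda>z. f z v) has_sum of_real (W v) * \<phi> (1 + s * of_real (T v))) UNIV"
        using H_summand_has_sum[OF a c le, of t] unfolding f_def \<phi>_def x by (rule has_sum_cmult_right)
      show "((\<lambda>z. norm (f z v)) has_sum W v * (\<Sum>\<^sub>\<infinity>z. norm (H_summand a ?X ?Y ?Z t z))) UNIV"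
        using has_sum_cmult_right[OF has_sum_infsum[OF H_summand_norm_summable[OF a c le, of t]], of "W v"] W0
        unfolding f_def norm_mult[of "of_real (W v)"] norm_of_real by simp
      show "W v * (\<Sum>\<^sub>\<infinity>z. norm (H_summand a ?X ?Y ?Z t z)) \<le> W v * ?B"
        using H_summand_norm_bound[OF a c le, of t] W0 by (rule mult_left_mono)
    next
      show "integrable cube (\<lambda>v. W v * ?B)" using Wint by (rule integrable_mult_left)
    qed
    have term_eq: "of_real kap * (LINT v|cube. f (m, n, k, l) v) =
        of_real (poch a (int m + int n + int k - int l) * pochhammer b1 m * pochhammer b2 n * pochhammer b3 k
                 / (pochhammer (2 * b1) m * pochhammer (2 * b2) n * pochhammer (2 * b3) k
                   * fact m * fact n * fact k * fact l))
        * (s * of_real (- u1)) ^ m * (s * of_real (- u2)) ^ n * (s * of_real (- u3)) ^ k * t ^ l" for m n k l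
    proof -
      let ?p = "poch a (int m + int n + int k - int l)"
      have cancel: "B * (p / d * u ^ r * x powr (- e)) * (x powr e / B) = p / d * u ^ r"
        if "B \<noteq> 0" "x > 0" for B p d u x e :: real and r :: nat
        using that by (simp add: powr_minus)
      have Bn: "Beta b1 b1 \<noteq> 0" "Beta b2 b2 \<noteq> 0" "Beta b3 b3 \<noteq> 0"
        using Beta_real_pos[OF b(1) b(1)] Beta_real_pos[OF b(2) b(2)] Beta_real_pos[OF b(3) b(3)] by auto
      have "kap * (LINT v|cube. W v * mob_monomial \<xi>1 \<xi>2 \<xi>3 m n k v) =
         (Beta b1 b1 * (pochhammer b1 m / pochhammer (2 * b1) m * u1 ^ m * (1 - \<xi>1) powr (- b1)) * ((1 - \<xi>1)
           powr b1 / Beta b1 b1)) *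
         (Beta b2 b2 * (pochhammer b2 n / pochhammer (2 * b2) n * u2 ^ n * (1 - \<xi>2) powr (- b2)) * ((1 - \<xi>2)
           powr b2 / Beta b2 b2)) *
         (Beta b3 b3 * (pochhammer b3 k / pochhammer (2 * b3) k * u3 ^ k * (1 - \<xi>3) powr (- b3)) * ((1 - \<xi>3)
           powr b3 / Beta b3 b3))"
        unfolding W_def integral_wgt3_mob_monomial[OF b \<xi>] kap_def u_def by (simp only: mult_ac)
      also have "\<dots> = (pochhammer b1 m / pochhammer (2 * b1) m * u1 ^ m) * (pochhammer b2 n / pochhammer (2 * b2)
        n * u2 ^ n) * (pochhammer b3 k / pochhammer (2 * b3) k * u3 ^ k)"
        using \<xi> by (subst cancel[OF Bn(1)], simp, subst cancel[OF Bn(2)], simp, subst cancel[OF Bn(3)],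
          simp_all)
      finally have I: "kap * (LINT v|cube. W v * mob_monomial \<xi>1 \<xi>2 \<xi>3 m n k v) = \<dots>" .
      have sg: "(s * of_real (- w)) ^ r = (- s) ^ r * of_real (w ^ r)" for w r
        by (simp add: power_mult_distrib[symmetric])
      have "of_real kap * (LINT v|cube. f (m, n, k, l) v) =
         (of_real (?p / (fact m * fact n * fact k * fact l)) * (- s) ^ (m + n + k) * t ^ l) * of_real (kap *
           (LINT v|cube. W v * mob_monomial \<xi>1 \<xi>2 \<xi>3 m n k v))"
        unfolding feq integral_mult_right_zero integral_complex_of_real by (simp add: mult_ac)
      thus ?thesis unfolding I sg by (simp add: power_add mult_ac)
    qed
    have "((\<lambda>z. of_real kap * (LINT v|cube. f z v)) has_sum g s) UNIV"
      unfolding g_def by (rule has_sum_cmult_right[OF hs])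
    hence "(\<Sum>\<^sub>\<infinity>z. of_real kap * (LINT v|cube. f z v)) = g s" by (rule infsumI)
    moreover have "(\<Sum>\<^sub>\<infinity>z. of_real kap * (LINT v|cube. f z v)) = ?H s"
      unfolding H430_series_def by (intro infsum_cong) (auto simp only: term_eq split: prod.split)
    ultimately show ?thesis by simp
  qed
  have ev: "\<forall>\<^sub>F s in nhds 0. g s = ?H s"
  proof -
    have "((\<lambda>s::complex. norm s * K) \<longlongrightarrow> norm (0::complex) * K) (nhds 0)"
      by (intro tendsto_intros filterlim_ident)
    hence "\<forall>\<^sub>F s::complex in nhds 0. norm s * K < 1 / 2"
      by (rule order_tendstoD) auto
    thus ?thesis by eventually_elim (rule ser, simp)
  qed
  have g1: "g 1 = of_real kap * cube_int b1 b2 b3 a \<xi>1 \<xi>2 \<xi>3 (- t)"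
  proof -
    have "(LINT v|cube. of_real (W v) * \<phi> (1 + 1 * of_real (T v))) = cube_int b1 b2 b3 a \<xi>1 \<xi>2 \<xi>3 (- t)"
      unfolding cube_int_def
    proof (rule Bochner_Integration.integral_cong[OF refl])
      fix v assume v: "v \<in> space cube"
      have "(1 + 1 * of_real (T v) :: complex) = of_real (1 + T v)" by simp
      moreover have "complex_of_real (1 + T v) powr (- of_real a) = of_real ((1 + T v) powr (- a))"
        using powr_of_real[of "1 + T v" "- a"] T0[OF v] by simp
      ultimately show "of_real (W v) * \<phi> (1 + 1 * of_real (T v)) =
         of_real (wgt3 b1 b2 b3 \<xi>1 \<xi>2 \<xi>3 v * (1 + mob3 \<xi>1 \<xi>2 \<xi>3 v) powr (- a)) * hyp_0F1 (1 - a) (- t * of_real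
           (1 + mob3 \<xi>1 \<xi>2 \<xi>3 v))"
        unfolding \<phi>_def W_def T_def by (simp only: of_real_mult mult_ac)
    qed
    thus ?thesis by (simp add: g_def)
  qed
  show "H430_continues_to a b1 b2 b3 (2 * b1) (2 * b2) (2 * b3)
      (of_real (- (\<xi>1 / (1 - \<xi>1)))) (of_real (- (\<xi>2 / (1 - \<xi>2)))) (of_real (- (\<xi>3 / (1 - \<xi>3)))) t
    (of_real ((1 - \<xi>1) powr b1 / Beta b1 b1 * ((1 - \<xi>2) powr b2 / Beta b2 b2) * ((1 - \<xi>3) powr b3 / Beta b3 b3))
      * cube_int b1 b2 b3 a \<xi>1 \<xi>2 \<xi>3 (- t))"
    unfolding H430_continues_to_def u_def[symmetric] kap_def[symmetric]
    using oS seg gh ev g1 by blast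
qed

section \<open>Geometry and order of growth\<close>

lemma rsq_pos: "x \<noteq> x0 \<Longrightarrow> 0 < rsq x x0"
proof -
  assume "x \<noteq> x0"
  then obtain i where "x $ i \<noteq> x0 $ i" by (auto simp: vec_eq_iff)
  hence "0 < (x $ i - x0 $ i)\<^sup>2" by simp
  also have "\<dots> \<le> rsq x x0" unfolding rsq_def by (rule member_le_sum) auto
  finally show ?thesis .
qed

lemma rsqk_eq: "rsqk e j x x0 = rsq x x0 + 4 * x $ e j * x0 $ e j"
proof -
  have "rsq x x0 = (x $ e j - x0 $ e j)\<^sup>2 + (\<Sum>i\<in>UNIV - {e j}. (x $ i - x0 $ i)\<^sup>2)"
    unfolding rsq_def by (subst sum.remove[of _ "e j"]) auto
  thus ?thesis unfolding rsqk_def by (simp add: power2_eq_square algebra_simps)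
qed

lemma rsq_self [simp]: "rsq x x = 0"
  by (simp add: rsq_def)

lemma tendsto_rsq: "((\<lambda>x. rsq x x0) \<longlongrightarrow> 0) (at x0 within S)"
proof -
  have "((\<lambda>x. rsq x x0) \<longlongrightarrow> rsq x0 x0) (at x0 within S)"
    unfolding rsq_def by (intro tendsto_intros)
  thus ?thesis by simp
qed

lemma tendsto_rsqk: "((\<lambda>x. rsqk e j x x0) \<longlongrightarrow> rsqk e j x0 x0) (at x0 within S)"
  unfolding rsqk_def by (intro tendsto_intros)

lemma rsqk_gt:
  assumes "x \<in> Rp3 e" "x0 \<in> Rp3 e" "j \<in> {1, 2, 3}"
  shows "rsq x x0 < rsqk e j x x0"
proof -
  have "0 < x $ e j" "0 < x0 $ e j" using assms by (auto simp: Rp3_def)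
  thus ?thesis by (simp add: rsqk_eq)
qed

lemma rsq_nonneg: "0 \<le> rsq x x0" unfolding rsq_def by (intro sum_nonneg) auto

lemma eventually_in_punctured:
  fixes y :: "'a::topological_space" and S :: "'a set"
  shows "\<forall>\<^sub>F x in at y within S. x \<in> S \<and> x \<noteq> y"
  by (simp add: eventually_at_filter)

definition cube_int_at :: "(nat \<Rightarrow> 'p::finite) \<Rightarrow> real \<Rightarrow> real \<Rightarrow> real \<Rightarrow> real \<Rightarrow> complex \<Rightarrow> real ^ 'p \<Rightarrow> real ^ 'p \<Rightarrow>
  complex" where
  "cube_int_at e b1 b2 b3 a lam x0 x = cube_int b1 b2 b3 a (1 - rsq x x0 / rsqk e 1 x x0) (1 - rsq x x0 / rsqk e
    2 x x0)
     (1 - rsq x x0 / rsqk e 3 x x0) (lam\<^sup>2 * of_real (rsq x x0) / 4)"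

lemma cube_int_at_tendsto:
  fixes e :: "nat \<Rightarrow> 'p::finite"
  assumes c: "1 - a \<notin> \<int>\<^sub>\<le>\<^sub>0"
    and b: "0 < b1" "0 < b2" "0 < b3" "b1 + b2 + b3 < a"
    and x0: "x0 \<in> Rp3 e"
  shows "(cube_int_at e b1 b2 b3 a lam x0 \<longlongrightarrow> cube_int b1 b2 b3 a 1 1 1 0) (at x0 within Rp3 e)"
  unfolding tendsto_at_iff_sequentially
proof (intro allI impI)
  fix X :: "nat \<Rightarrow> real ^ 'p"
  assume X: "\<forall>i. X i \<in> Rp3 e - {x0}" "X \<longlonglongrightarrow> x0"
  define R where "R n = rsq (X n) x0" for n
  define Q where "Q j n = rsqk e j (X n) x0" for j n
  let ?T = "\<lambda>n v. mob3 (1 - R n / Q 1 n) (1 - R n / Q 2 n) (1 - R n / Q 3 n) v"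
  have Xat: "filterlim X (at x0 within Rp3 e) sequentially"
    using X by (auto simp: filterlim_at)
  have R: "0 < R n" for n unfolding R_def using X(1) by (intro rsq_pos) auto
  have Q: "R n < Q j n" if "j \<in> {1, 2, 3}" for j n
    unfolding R_def Q_def using X(1) x0 that by (intro rsqk_gt) auto
  have Rlim: "R \<longlonglongrightarrow> 0" unfolding R_def by (rule filterlim_compose[OF tendsto_rsq Xat])
  have Qlim: "Q j \<longlonglongrightarrow> rsqk e j x0 x0" for j unfolding Q_def by (rule filterlim_compose[OF tendsto_rsqk Xat])
  have Q0: "rsqk e j x0 x0 \<noteq> 0" if "j \<in> {1, 2, 3}" for j
    using rsqk_gt[OF x0 x0 that] by simp
  have \<xi>lim: "(\<lambda>n. 1 - R n / Q j n) \<longlonglongrightarrow> 1" if "j \<in> {1, 2, 3}" for j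
  proof -
    have "(\<lambda>n. 1 - R n / Q j n) \<longlonglongrightarrow> 1 - 0 / rsqk e j x0 x0"
      by (intro tendsto_intros Rlim Qlim Q0 that)
    thus ?thesis by simp
  qed
  have \<xi>: "0 \<le> 1 - R n / Q j n" "1 - R n / Q j n < 1" "1 - R n / Q j n \<le> 1" if "j \<in> {1, 2, 3}" for j n
  proof -
    have "0 < R n / Q j n" "R n / Q j n < 1"
      using R[of n] Q[OF that, of n] by (auto simp: divide_less_eq_1)
    thus "0 \<le> 1 - R n / Q j n" "1 - R n / Q j n < 1" "1 - R n / Q j n \<le> 1" by auto
  qed
  have \<tau>lim: "(\<lambda>n. lam\<^sup>2 * of_real (R n) / 4) \<longlonglongrightarrow> 0"
  proof -
    have "(\<lambda>n. lam\<^sup>2 * of_real (R n) / 4) \<longlonglongrightarrow> lam\<^sup>2 * of_real 0 / 4"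
      by (intro tendsto_intros Rlim) auto
    thus ?thesis by simp
  qed
  have "(\<lambda>n. norm (lam\<^sup>2) / 4 * (Q 1 n + Q 2 n + Q 3 n)) \<longlonglongrightarrow> norm (lam\<^sup>2) / 4 * (rsqk e 1 x0 x0 + rsqk e 2 x0 x0 +
    rsqk e 3 x0 x0)"
    by (intro tendsto_intros Qlim)
  hence "Bseq (\<lambda>n. norm (lam\<^sup>2) / 4 * (Q 1 n + Q 2 n + Q 3 n))"
    by (intro convergent_imp_Bseq convergentI)
  then obtain K where K: "\<And>n. norm (norm (lam\<^sup>2) / 4 * (Q 1 n + Q 2 n + Q 3 n)) \<le> K"
    unfolding Bseq_def by blast
  have bound: "norm (lam\<^sup>2 * of_real (R n) / 4) * (1 + ?T n v) \<le> K"
    if v: "v \<in> space cube" for n v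
  proof -
    have "?T n v \<le> (1 - R n / Q 1 n) / (1 - (1 - R n / Q 1 n))
       + (1 - R n / Q 2 n) / (1 - (1 - R n / Q 2 n)) + (1 - R n / Q 3 n) / (1 - (1 - R n / Q 3 n))"
      by (intro mob3_le \<xi> v) auto
    moreover have "(1 - R n / Q j n) / (1 - (1 - R n / Q j n)) = Q j n / R n - 1" if "j \<in> {1, 2, 3}" for j
      using R[of n] Q[OF that, of n] by (simp add: field_simps)
    ultimately have "R n * (1 + ?T n v) \<le> R n * (Q 1 n / R n + Q 2 n / R n + Q 3 n / R n)"
      using R[of n] by (intro mult_left_mono) auto
    also have "\<dots> = Q 1 n + Q 2 n + Q 3 n" using R[of n] by (simp add: distrib_left)
    finally have "norm (lam\<^sup>2) / 4 * (R n * (1 + ?T n v)) \<le> norm (lam\<^sup>2) / 4 * (Q 1 n + Q 2 n + Q 3 n)"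
      by (intro mult_left_mono) auto
    also have "\<dots> \<le> K" using K[of n] unfolding real_norm_def by (rule abs_le_D1)
    finally show ?thesis using R[of n] by (simp add: norm_mult norm_divide mult_ac)
  qed
  have "(\<lambda>n. cube_int b1 b2 b3 a (1 - R n / Q 1 n) (1 - R n / Q 2 n) (1 - R n / Q 3 n) (lam\<^sup>2 * of_real (R n) /
    4)) \<longlonglongrightarrow> cube_int b1 b2 b3 a 1 1 1 0"
    by (rule cube_int_tendsto[OF c b]) (use \<xi> \<xi>lim \<tau>lim bound in auto)
  thus "(cube_int_at e b1 b2 b3 a lam x0 \<circ> X) \<longlonglongrightarrow> cube_int b1 b2 b3 a 1 1 1 0"
    by (simp add: cube_int_at_def o_def R_def Q_def)
qed

text \<open>
The exponents of \<open>r\<^sup>2\<close> are collected: \<open>-a\<close> from the prefactor and \<open>b\<^sub>1 + b\<^sub>2 + b\<^sub>3\<close> from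
\<open>1 - \<xi>\<^sub>j = r\<^sup>2 / r\<^sub>j\<^sup>2\<close> make \<open>1 - p/2\<close>.
\<close>
lemma H_sig_eq_cube_int_at:
  fixes e :: "nat \<Rightarrow> 'p::finite"
  assumes c: "1 - a \<notin> \<int>\<^sub>\<le>\<^sub>0"
    and b: "0 < b1" "0 < b2" "0 < b3" and a: "a = b1 + b2 + b3 + real CARD('p) / 2 - 1" "0 < a"
    and x: "x \<in> Rp3 e" "x0 \<in> Rp3 e" "x \<noteq> x0"
  shows "of_real (rsq x x0 powr (- a)) * H_sig e lam x x0 a b1 b2 b3 (2 * b1) (2 * b2) (2 * b3) =
     of_real (sqrt (rsq x x0) powr (2 - real CARD('p)) * (rsqk e 1 x x0 powr (- b1) * rsqk e 2 x x0 powr (- b2)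
       * rsqk e 3 x x0 powr (- b3)
        / (Beta b1 b1 * Beta b2 b2 * Beta b3 b3))) * cube_int_at e b1 b2 b3 a lam x0 x"
proof -
  define R where "R = rsq x x0"
  define Q where "Q j = rsqk e j x x0" for j
  have R: "0 < R" unfolding R_def using x by (intro rsq_pos)
  have Q: "R < Q j" if "j \<in> {1, 2, 3}" for j unfolding R_def Q_def using x that by (intro rsqk_gt)
  have Qp: "0 < Q j" if "j \<in> {1, 2, 3}" for j using Q[OF that] R by simp
  have \<xi>: "0 \<le> 1 - R / Q j" "1 - R / Q j < 1" if "j \<in> {1, 2, 3}" for j
    using R Q[OF that] Qp[OF that] by auto
  have sg: "sig e j x x0 = - ((1 - R / Q j) / (1 - (1 - R / Q j)))" if "j \<in> {1, 2, 3}" for j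
    using R Qp[OF that] unfolding sig_def R_def[symmetric] Q_def[symmetric] by (simp add: field_simps)
  have i: "(1::nat) \<in> {1, 2, 3}" "(2::nat) \<in> {1, 2, 3}" "(3::nat) \<in> {1, 2, 3}" by auto
  have dd: "1 - (1 - y) = y" for y :: real by simp
  have t: "sig4 lam x x0 = - (lam\<^sup>2 * of_real R / 4)" by (simp add: sig4_def R_def)
  have "H_sig e lam x x0 a b1 b2 b3 (2 * b1) (2 * b2) (2 * b3) =
     of_real ((R / Q 1) powr b1 / Beta b1 b1 * ((R / Q 2) powr b2 / Beta b2 b2) * ((R / Q 3) powr b3 / Beta b3
       b3))
      * cube_int_at e b1 b2 b3 a lam x0 x"
    unfolding H_sig_def t sg[OF i(1)] sg[OF i(2)] sg[OF i(3)]
      H430_eq_cube_int[OF c a(2) b \<xi>[OF i(1)] \<xi>[OF i(2)] \<xi>[OF i(3)]]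
    unfolding dd minus_minus cube_int_at_def R_def[symmetric] Q_def[symmetric] ..
  moreover have "R powr (- a) * ((R / Q 1) powr b1 / Beta b1 b1 * ((R / Q 2) powr b2 / Beta b2 b2) * ((R / Q 3)
    powr b3 / Beta b3 b3))
     = sqrt R powr (2 - real CARD('p)) * (Q 1 powr (- b1) * Q 2 powr (- b2) * Q 3 powr (- b3) / (Beta b1 b1 *
       Beta b2 b2 * Beta b3 b3))"
  proof -
    have "sqrt R powr (2 - real CARD('p)) = R powr (1 / 2 * (2 - real CARD('p)))"
      using R by (simp add: powr_half_sqrt[symmetric] powr_powr)
    also have "1 / 2 * (2 - real CARD('p)) = - a + b1 + b2 + b3" unfolding a(1) by (simp add: field_simps)
    finally have 1: "sqrt R powr (2 - real CARD('p)) = R powr (- a) * R powr b1 * R powr b2 * R powr b3"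
      by (simp only: powr_add)
    have 2: "(R / Q j) powr b = R powr b * Q j powr (- b)" if "j \<in> {1, 2, 3}" for j b
      using R Qp[OF that] by (simp add: powr_divide powr_minus inverse_eq_divide)
    show ?thesis unfolding 1 2[OF i(1)] 2[OF i(2)] 2[OF i(3)] by (simp add: mult_ac)
  qed
  ultimately show ?thesis
    unfolding R_def[symmetric] Q_def[symmetric] by (simp only: mult.assoc[symmetric] of_real_mult[symmetric])
qed

text \<open>
The common form of all eight solutions: \<open>m\<close> stands for the product of the factors \<open>(x\<^sub>j x\<^sub>0\<^sub>j)\<close> to the power
\<open>1 - 2\<alpha>\<^sub>j\<close>, and \<open>b\<^sub>j\<close> for \<open>\<alpha>\<^sub>j\<close> or \<open>1 - \<alpha>\<^sub>j\<close>.
\<close>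
lemma infinite_of_order_H_sig:
  fixes e :: "nat \<Rightarrow> 'p::finite" and kk :: complex
  assumes p: "CARD('p) \<ge> 3" and x0: "x0 \<in> Rp3 e" and c: "1 - a \<notin> \<int>\<^sub>\<le>\<^sub>0"
    and b: "0 < b1" "0 < b2" "0 < b3" and a: "a = b1 + b2 + b3 + real CARD('p) / 2 - 1"
    and m: "(m \<longlongrightarrow> m0) (at x0 within Rp3 e)" "m0 \<noteq> 0" and kk: "kk \<noteq> 0"
  shows "infinite_of_order (\<lambda>x. kk * of_real (rsq x x0 powr (- a) * m x) * H_sig e lam x x0 a b1 b2 b3 (2 * b1)
    (2 * b2) (2 * b3))
     (\<lambda>x. sqrt (rsq x x0) powr (2 - real CARD('p))) (at x0 within Rp3 e)"
proof -
  let ?F = "at x0 within Rp3 e"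
  let ?g = "\<lambda>x. sqrt (rsq x x0) powr (2 - real CARD('p))"
  let ?q = "\<lambda>x. kk * of_real (rsq x x0 powr (- a) * m x) * H_sig e lam x x0 a b1 b2 b3 (2 * b1) (2 * b2) (2 *
    b3)"
  have ba: "b1 + b2 + b3 < a" using a p by simp
  hence a0: "0 < a" using b by simp
  define C where "C x = rsqk e 1 x x0 powr (- b1) * rsqk e 2 x x0 powr (- b2) * rsqk e 3 x x0 powr (- b3)
        / (Beta b1 b1 * Beta b2 b2 * Beta b3 b3)" for x
  define h where "h x = kk * of_real (m x * C x) * cube_int_at e b1 b2 b3 a lam x0 x" for x
  have Q0: "0 < rsqk e j x0 x0" if "j \<in> {1, 2, 3}" for j
    using rsqk_gt[OF x0 x0 that] by simp
  have Bpos: "0 < Beta b1 b1" "0 < Beta b2 b2" "0 < Beta b3 b3" using b by (auto intro: Beta_real_pos)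
  have Clim: "(C \<longlongrightarrow> C x0) ?F"
    unfolding C_def using Bpos Q0[of 1] Q0[of 2] Q0[of 3] by (intro tendsto_intros tendsto_rsqk) auto
  have C0: "C x0 \<noteq> 0" unfolding C_def using Bpos Q0[of 1] Q0[of 2] Q0[of 3] by simp
  define L where "L = kk * of_real (m0 * C x0) * cube_int b1 b2 b3 a 1 1 1 0"
  have hlim: "(h \<longlongrightarrow> L) ?F"
    unfolding h_def L_def by (intro tendsto_intros m Clim cube_int_at_tendsto c b ba x0)
  define G where "G = Gamma b1 * Gamma b2 * Gamma b3 * Gamma (a - b1 - b2 - b3) / Gamma a"
  have "G > 0"
    unfolding G_def using b ba a0 by (intro divide_pos_pos mult_pos_pos Gamma_real_pos) auto
  hence L0: "L \<noteq> 0"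
    unfolding L_def cube_int_limit_value[OF b ba] G_def[symmetric] using kk m(2) C0 by simp
  have qeq: "\<forall>\<^sub>F x in ?F. ?q x = h x * of_real (?g x)"
    using eventually_in_punctured[of "Rp3 e" x0]
  proof eventually_elim
    case (elim x)
    have "?q x = kk * of_real (m x) * (of_real (rsq x x0 powr (- a)) * H_sig e lam x x0 a b1 b2 b3 (2 * b1) (2 *
      b2) (2 * b3))"
      by simp
    also have "\<dots> = h x * of_real (?g x)"
      using elim by (subst H_sig_eq_cube_int_at[OF c b a a0 _ x0]) (simp_all add: h_def C_def mult_ac)
    finally show ?case .
  qed
  have "filterlim ?g at_top ?F"
  proof -
    have s0: "((\<lambda>x. sqrt (rsq x x0)) \<longlongrightarrow> 0) ?F"
      using tendsto_real_sqrt[OF tendsto_rsq] by simp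
    have "filterlim (\<lambda>x. sqrt (rsq x x0)) (at_right 0) ?F"
      unfolding filterlim_at
    proof
      show "\<forall>\<^sub>F x in ?F. sqrt (rsq x x0) \<in> {0<..} \<and> sqrt (rsq x x0) \<noteq> 0"
        using eventually_in_punctured[of "Rp3 e" x0] by eventually_elim (use rsq_pos in force)
    qed (rule s0)
    moreover have "filterlim (\<lambda>y::real. y powr (2 - real CARD('p))) at_top (at_right 0)"
    proof -
      have "filterlim (\<lambda>y::real. - ln y) at_top (at_right 0)"
        unfolding filterlim_uminus_at_top using ln_at_0 by simp
      hence "filterlim (\<lambda>y::real. (real CARD('p) - 2) * (- ln y)) at_top (at_right 0)"
        by (rule filterlim_tendsto_pos_mult_at_top[OF tendsto_const, rotated]) (use p in simp)
      hence "filterlim (\<lambda>y::real. (2 - real CARD('p)) * ln y) at_top (at_right 0)"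
        by (simp add: algebra_simps)
      hence "filterlim (\<lambda>y::real. exp ((2 - real CARD('p)) * ln y)) at_top (at_right 0)"
        by (rule filterlim_compose[OF exp_at_top])
      moreover have "\<forall>\<^sub>F y::real in at_right 0. exp ((2 - real CARD('p)) * ln y) = y powr (2 - real CARD('p))"
        by (simp add: eventually_at_filter powr_def)
      ultimately show ?thesis using filterlim_cong[OF refl refl] by fast
    qed
    ultimately show ?thesis by (rule filterlim_compose[rotated])
  qed
  hence ginf: "filterlim (\<lambda>x. complex_of_real (?g x)) at_infinity ?F"
    by (rule filterlim_compose[OF filterlim_of_real_at_infinity])
  have "filterlim (\<lambda>x. h x * of_real (?g x)) at_infinity ?F"
    by (rule tendsto_mult_filterlim_at_infinity[OF hlim L0 ginf])
  hence 1: "filterlim ?q at_infinity ?F"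
    using filterlim_cong[OF refl refl qeq] by simp
  have "\<forall>\<^sub>F x in ?F. h x = ?q x / of_real (?g x)"
    using qeq eventually_in_punctured[of "Rp3 e" x0]
  proof eventually_elim
    case (elim x)
    have "?g x \<noteq> 0" using rsq_pos[of x x0] elim(2) by simp
    hence "complex_of_real (?g x) \<noteq> 0" by (simp only: of_real_eq_0_iff not_False_eq_True)
    thus ?case unfolding elim(1) by (rule nonzero_mult_div_cancel_right[symmetric])
  qed
  hence "((\<lambda>x. ?q x / of_real (?g x)) \<longlongrightarrow> L) ?F"
    by (rule Lim_transform_eventually[OF hlim])
  with 1 L0 show ?thesis unfolding infinite_of_order_def by blast
qed

section \<open>Representation of the first solution and growth of all eight\<close>

theorem mainTheorem2:
  fixes e :: "nat \<Rightarrow> 'p::finite"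
    and \<alpha> :: "nat \<Rightarrow> real"
    and lam :: complex
    and k :: "nat \<Rightarrow> complex"
    and x0 :: "real ^ 'p"
  assumes "CARD('p) \<ge> 3"
    and "inj_on e {1, 2, 3}"
    and "\<And>j. j \<in> {1, 2, 3} \<Longrightarrow> 0 < 2 * \<alpha> j \<and> 2 * \<alpha> j < 1"
    and "lam \<in> \<real> \<or> Re lam = 0"
    and "\<And>i. i \<in> {2..8} \<Longrightarrow> k i \<noteq> 0"
    and "x0 \<in> Rp3 e"
  shows
    "(1 - alpha_tot CARD('p) \<alpha> \<notin> \<int>\<^sub>\<le>\<^sub>0 \<longrightarrow>
        (\<forall>x\<in>Rp3 e. x \<noteq> x0 \<longrightarrow>
           f_term CARD('p) \<alpha> lam (rsq x x0) (rsqk e 1 x x0) (rsqk e 2 x x0) (rsqk e 3 x x0)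
             summable_on UNIV \<and>
           q1 e \<alpha> lam x x0 =
             of_real (sqrt (rsq x x0) powr (2 - real CARD('p))
               * sqrt (rsqk e 1 x x0) powr (- 2 * \<alpha> 1)
               * sqrt (rsqk e 2 x x0) powr (- 2 * \<alpha> 2)
               * sqrt (rsqk e 3 x x0) powr (- 2 * \<alpha> 3))
             * f_fun CARD('p) \<alpha> lam (rsq x x0) (rsqk e 1 x x0) (rsqk e 2 x x0) (rsqk e 3 x x0)) \<and>
        f_fun CARD('p) \<alpha> lam 0 (rsqk e 1 x0 x0) (rsqk e 2 x0 x0) (rsqk e 3 x0 x0) =
          of_real (4 powr (\<alpha> 1 + \<alpha> 2 + \<alpha> 3 - 1) / pi powr (real CARD('p) / 2)
            * Gamma ((real CARD('p) - 2) / 2)) \<and>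
        ((\<lambda>x. f_fun CARD('p) \<alpha> lam (rsq x x0) (rsqk e 1 x x0) (rsqk e 2 x x0) (rsqk e 3 x x0))
           \<longlongrightarrow> f_fun CARD('p) \<alpha> lam 0 (rsqk e 1 x0 x0) (rsqk e 2 x0 x0) (rsqk e 3 x0 x0))
          (at x0 within Rp3 e) \<and>
        infinite_of_order (\<lambda>x. q1 e \<alpha> lam x x0)
          (\<lambda>x. sqrt (rsq x x0) powr (2 - real CARD('p))) (at x0 within Rp3 e)) \<and>
     (1 - (1 + alpha_tot CARD('p) \<alpha> - 2 * \<alpha> 1) \<notin> \<int>\<^sub>\<le>\<^sub>0 \<longrightarrow>
        infinite_of_order (\<lambda>x. q2 e \<alpha> lam (k 2) x x0)
          (\<lambda>x. sqrt (rsq x x0) powr (2 - real CARD('p))) (at x0 within Rp3 e)) \<and>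
     (1 - (1 + alpha_tot CARD('p) \<alpha> - 2 * \<alpha> 2) \<notin> \<int>\<^sub>\<le>\<^sub>0 \<longrightarrow>
        infinite_of_order (\<lambda>x. q3 e \<alpha> lam (k 3) x x0)
          (\<lambda>x. sqrt (rsq x x0) powr (2 - real CARD('p))) (at x0 within Rp3 e)) \<and>
     (1 - (1 + alpha_tot CARD('p) \<alpha> - 2 * \<alpha> 3) \<notin> \<int>\<^sub>\<le>\<^sub>0 \<longrightarrow>
        infinite_of_order (\<lambda>x. q4 e \<alpha> lam (k 4) x x0)
          (\<lambda>x. sqrt (rsq x x0) powr (2 - real CARD('p))) (at x0 within Rp3 e)) \<and>
     (1 - (2 + alpha_tot CARD('p) \<alpha> - 2 * \<alpha> 1 - 2 * \<alpha> 2) \<notin> \<int>\<^sub>\<le>\<^sub>0 \<longrightarrow>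
        infinite_of_order (\<lambda>x. q5 e \<alpha> lam (k 5) x x0)
          (\<lambda>x. sqrt (rsq x x0) powr (2 - real CARD('p))) (at x0 within Rp3 e)) \<and>
     (1 - (2 + alpha_tot CARD('p) \<alpha> - 2 * \<alpha> 1 - 2 * \<alpha> 3) \<notin> \<int>\<^sub>\<le>\<^sub>0 \<longrightarrow>
        infinite_of_order (\<lambda>x. q6 e \<alpha> lam (k 6) x x0)
          (\<lambda>x. sqrt (rsq x x0) powr (2 - real CARD('p))) (at x0 within Rp3 e)) \<and>
     (1 - (2 + alpha_tot CARD('p) \<alpha> - 2 * \<alpha> 2 - 2 * \<alpha> 3) \<notin> \<int>\<^sub>\<le>\<^sub>0 \<longrightarrow>
        infinite_of_order (\<lambda>x. q7 e \<alpha> lam (k 7) x x0)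
          (\<lambda>x. sqrt (rsq x x0) powr (2 - real CARD('p))) (at x0 within Rp3 e)) \<and>
     (1 - (3 + alpha_tot CARD('p) \<alpha> - 2 * \<alpha> 1 - 2 * \<alpha> 2 - 2 * \<alpha> 3) \<notin> \<int>\<^sub>\<le>\<^sub>0 \<longrightarrow>
        infinite_of_order (\<lambda>x. q8 e \<alpha> lam (k 8) x x0)
          (\<lambda>x. sqrt (rsq x x0) powr (2 - real CARD('p))) (at x0 within Rp3 e))"
proof -
  define a where "a = alpha_tot CARD('p) \<alpha>"
  note p = assms(1) and x0 = assms(6)
  have al: "0 < \<alpha> 1" "0 < \<alpha> 2" "0 < \<alpha> 3" "0 < 1 - \<alpha> 1" "0 < 1 - \<alpha> 2" "0 < 1 - \<alpha> 3"
    using assms(3)[of 1] assms(3)[of 2] assms(3)[of 3] by auto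
  have kn: "k 2 \<noteq> 0" "k 3 \<noteq> 0" "k 4 \<noteq> 0" "k 5 \<noteq> 0" "k 6 \<noteq> 0" "k 7 \<noteq> 0" "k 8 \<noteq> 0"
    using assms(5) by auto
  have a: "a = \<alpha> 1 + \<alpha> 2 + \<alpha> 3 + real CARD('p) / 2 - 1" by (simp add: a_def alpha_tot_def)
  have ba: "\<alpha> 1 + \<alpha> 2 + \<alpha> 3 < a" using a p by simp
  have a0: "0 < a" using ba al by simp
  let ?F = "at x0 within Rp3 e"
  let ?g = "\<lambda>x. sqrt (rsq x x0) powr (2 - real CARD('p))"
  define w where "w j x = (x $ e j * x0 $ e j) powr (1 - 2 * \<alpha> j)" for j and x :: "real ^ 'p"
  have w: "(w j \<longlongrightarrow> w j x0) ?F" "w j x0 \<noteq> 0" if "j \<in> {1, 2, 3}" for j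
  proof -
    have "0 < x0 $ e j" using x0 that by (auto simp: Rp3_def)
    thus "w j x0 \<noteq> 0" "(w j \<longlongrightarrow> w j x0) ?F" unfolding w_def by (auto intro!: tendsto_intros)
  qed
  note w1 = w[of 1, simplified] and w2 = w[of 2, simplified] and w3 = w[of 3, simplified]
  note order = infinite_of_order_H_sig[where lam = lam, OF p x0]

  have q2: "infinite_of_order (\<lambda>x. q2 e \<alpha> lam (k 2) x x0) ?g ?F"
    if c: "1 - (1 + a - 2 * \<alpha> 1) \<notin> \<int>\<^sub>\<le>\<^sub>0"
  proof -
    have "q2 e \<alpha> lam (k 2) x x0 = k 2 * of_real (rsq x x0 powr (- (1 + a - 2 * \<alpha> 1)) * (w 1 x)) *
       H_sig e lam x x0 (1 + a - 2 * \<alpha> 1) (1 - \<alpha> 1) (\<alpha> 2) (\<alpha> 3) (2 * (1 - \<alpha> 1)) (2 * (\<alpha> 2)) (2 * (\<alpha> 3))" for x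
      by (simp add: q2_def Let_def a_def[symmetric] w_def algebra_simps)
    thus ?thesis
      using order[OF c al(4) al(2) al(3) _ w1(1) w1(2) kn(1)] by (simp add: a)
  qed
  have q3: "infinite_of_order (\<lambda>x. q3 e \<alpha> lam (k 3) x x0) ?g ?F"
    if c: "1 - (1 + a - 2 * \<alpha> 2) \<notin> \<int>\<^sub>\<le>\<^sub>0"
  proof -
    have "q3 e \<alpha> lam (k 3) x x0 = k 3 * of_real (rsq x x0 powr (- (1 + a - 2 * \<alpha> 2)) * (w 2 x)) *
       H_sig e lam x x0 (1 + a - 2 * \<alpha> 2) (\<alpha> 1) (1 - \<alpha> 2) (\<alpha> 3) (2 * (\<alpha> 1)) (2 * (1 - \<alpha> 2)) (2 * (\<alpha> 3))" for x
      by (simp add: q3_def Let_def a_def[symmetric] w_def algebra_simps)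
    thus ?thesis
      using order[OF c al(1) al(5) al(3) _ w2(1) w2(2) kn(2)] by (simp add: a)
  qed
  have q4: "infinite_of_order (\<lambda>x. q4 e \<alpha> lam (k 4) x x0) ?g ?F"
    if c: "1 - (1 + a - 2 * \<alpha> 3) \<notin> \<int>\<^sub>\<le>\<^sub>0"
  proof -
    have "q4 e \<alpha> lam (k 4) x x0 = k 4 * of_real (rsq x x0 powr (- (1 + a - 2 * \<alpha> 3)) * (w 3 x)) *
       H_sig e lam x x0 (1 + a - 2 * \<alpha> 3) (\<alpha> 1) (\<alpha> 2) (1 - \<alpha> 3) (2 * (\<alpha> 1)) (2 * (\<alpha> 2)) (2 * (1 - \<alpha> 3))" for x
      by (simp add: q4_def Let_def a_def[symmetric] w_def algebra_simps)
    thus ?thesis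
      using order[OF c al(1) al(2) al(6) _ w3(1) w3(2) kn(3)] by (simp add: a)
  qed
  have q5: "infinite_of_order (\<lambda>x. q5 e \<alpha> lam (k 5) x x0) ?g ?F"
    if c: "1 - (2 + a - 2 * \<alpha> 1 - 2 * \<alpha> 2) \<notin> \<int>\<^sub>\<le>\<^sub>0"
  proof -
    have "q5 e \<alpha> lam (k 5) x x0 = k 5 * of_real (rsq x x0 powr (- (2 + a - 2 * \<alpha> 1 - 2 * \<alpha> 2)) * (w 1 x * w 2
      x)) *
       H_sig e lam x x0 (2 + a - 2 * \<alpha> 1 - 2 * \<alpha> 2) (1 - \<alpha> 1) (1 - \<alpha> 2) (\<alpha> 3) (2 * (1 - \<alpha> 1)) (2 * (1 - \<alpha> 2)) (2
         * (\<alpha> 3))" for x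
      by (simp add: q5_def Let_def a_def[symmetric] w_def algebra_simps)
    thus ?thesis
      using order[OF c al(4) al(5) al(3) _ tendsto_mult[OF w1(1) w2(1)] no_zero_divisors[OF w1(2) w2(2)] kn(4)]
        by (simp add: a)
  qed
  have q6: "infinite_of_order (\<lambda>x. q6 e \<alpha> lam (k 6) x x0) ?g ?F"
    if c: "1 - (2 + a - 2 * \<alpha> 1 - 2 * \<alpha> 3) \<notin> \<int>\<^sub>\<le>\<^sub>0"
  proof -
    have "q6 e \<alpha> lam (k 6) x x0 = k 6 * of_real (rsq x x0 powr (- (2 + a - 2 * \<alpha> 1 - 2 * \<alpha> 3)) * (w 1 x * w 3
      x)) *
       H_sig e lam x x0 (2 + a - 2 * \<alpha> 1 - 2 * \<alpha> 3) (1 - \<alpha> 1) (\<alpha> 2) (1 - \<alpha> 3) (2 * (1 - \<alpha> 1)) (2 * (\<alpha> 2)) (2 *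
         (1 - \<alpha> 3))" for x
      by (simp add: q6_def Let_def a_def[symmetric] w_def algebra_simps)
    thus ?thesis
      using order[OF c al(4) al(2) al(6) _ tendsto_mult[OF w1(1) w3(1)] no_zero_divisors[OF w1(2) w3(2)] kn(5)]
        by (simp add: a)
  qed
  have q7: "infinite_of_order (\<lambda>x. q7 e \<alpha> lam (k 7) x x0) ?g ?F"
    if c: "1 - (2 + a - 2 * \<alpha> 2 - 2 * \<alpha> 3) \<notin> \<int>\<^sub>\<le>\<^sub>0"
  proof -
    have "q7 e \<alpha> lam (k 7) x x0 = k 7 * of_real (rsq x x0 powr (- (2 + a - 2 * \<alpha> 2 - 2 * \<alpha> 3)) * (w 2 x * w 3
      x)) *
       H_sig e lam x x0 (2 + a - 2 * \<alpha> 2 - 2 * \<alpha> 3) (\<alpha> 1) (1 - \<alpha> 2) (1 - \<alpha> 3) (2 * (\<alpha> 1)) (2 * (1 - \<alpha> 2)) (2 *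
         (1 - \<alpha> 3))" for x
      by (simp add: q7_def Let_def a_def[symmetric] w_def algebra_simps)
    thus ?thesis
      using order[OF c al(1) al(5) al(6) _ tendsto_mult[OF w2(1) w3(1)] no_zero_divisors[OF w2(2) w3(2)] kn(6)]
        by (simp add: a)
  qed
  have q8: "infinite_of_order (\<lambda>x. q8 e \<alpha> lam (k 8) x x0) ?g ?F"
    if c: "1 - (3 + a - 2 * \<alpha> 1 - 2 * \<alpha> 2 - 2 * \<alpha> 3) \<notin> \<int>\<^sub>\<le>\<^sub>0"
  proof -
    have "q8 e \<alpha> lam (k 8) x x0 = k 8 * of_real (rsq x x0 powr (- (3 + a - 2 * \<alpha> 1 - 2 * \<alpha> 2 - 2 * \<alpha> 3)) * (w 1
      x * w 2 x * w 3 x)) *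
       H_sig e lam x x0 (3 + a - 2 * \<alpha> 1 - 2 * \<alpha> 2 - 2 * \<alpha> 3) (1 - \<alpha> 1) (1 - \<alpha> 2) (1 - \<alpha> 3) (2 * (1 - \<alpha> 1)) (2 *
         (1 - \<alpha> 2)) (2 * (1 - \<alpha> 3))" for x
      by (simp add: q8_def Let_def a_def[symmetric] w_def algebra_simps)
    thus ?thesis
      using order[OF c al(4) al(5) al(6) _ tendsto_mult[OF tendsto_mult[OF w1(1) w2(1)] w3(1)]
        no_zero_divisors[OF no_zero_divisors[OF w1(2) w2(2)] w3(2)] kn(7)] by (simp add: a)
  qed
  have Q: "0 < rsqk e j x x0" "rsq x x0 < rsqk e j x x0" if "j \<in> {1, 2, 3}" "x \<in> Rp3 e" for j x
    using rsqk_gt[OF that(2) x0 that(1)] rsq_nonneg[of x x0] by auto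
  have i: "(1::nat) \<in> {1, 2, 3}" "(2::nat) \<in> {1, 2, 3}" "(3::nat) \<in> {1, 2, 3}" by auto
  define k1 where "k1 = k_one CARD('p) \<alpha>"
  define B where "B = Beta (\<alpha> 1) (\<alpha> 1) * Beta (\<alpha> 2) (\<alpha> 2) * Beta (\<alpha> 3) (\<alpha> 3)"
  have B: "0 < B" unfolding B_def using al by (intro mult_pos_pos Beta_real_pos)
  define L where "L = 4 powr (\<alpha> 1 + \<alpha> 2 + \<alpha> 3 - 1) / pi powr (real CARD('p) / 2) * Gamma ((real CARD('p) - 2) /
    2)"
  let ?f = "\<lambda>x. f_fun CARD('p) \<alpha> lam (rsq x x0) (rsqk e 1 x x0) (rsqk e 2 x x0) (rsqk e 3 x x0)"
  let ?fz = "f_fun CARD('p) \<alpha> lam 0 (rsqk e 1 x0 x0) (rsqk e 2 x0 x0) (rsqk e 3 x0 x0)"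
  have q1: "(\<forall>x\<in>Rp3 e. x \<noteq> x0 \<longrightarrow>
           f_term CARD('p) \<alpha> lam (rsq x x0) (rsqk e 1 x x0) (rsqk e 2 x x0) (rsqk e 3 x x0)
             summable_on UNIV \<and>
           q1 e \<alpha> lam x x0 =
             of_real (?g x
               * sqrt (rsqk e 1 x x0) powr (- 2 * \<alpha> 1)
               * sqrt (rsqk e 2 x x0) powr (- 2 * \<alpha> 2)
               * sqrt (rsqk e 3 x x0) powr (- 2 * \<alpha> 3))
             * ?f x) \<and>
        ?fz = of_real L \<and> (?f \<longlongrightarrow> ?fz) ?F \<and>
        infinite_of_order (\<lambda>x. q1 e \<alpha> lam x x0) ?g ?F"
    if c: "1 - a \<notin> \<int>\<^sub>\<le>\<^sub>0"
  proof (intro conjI ballI impI)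
    have hs: "(f_term CARD('p) \<alpha> lam (rsq x x0) (rsqk e 1 x x0) (rsqk e 2 x x0) (rsqk e 3 x x0) has_sum
        cube_int_at e (\<alpha> 1) (\<alpha> 2) (\<alpha> 3) a lam x0 x / of_real B) UNIV" if x: "x \<in> Rp3 e" for x
      using f_term_has_sum[OF c[unfolded a_def] al(1,2,3) ba[unfolded a_def] rsq_nonneg[of x x0]
          less_imp_le[OF Q(2)[OF i(1) x]] less_imp_le[OF Q(2)[OF i(2) x]] less_imp_le[OF Q(2)[OF i(3) x]]
          Q(1)[OF i(1) x] Q(1)[OF i(2) x] Q(1)[OF i(3) x], of lam]
      by (simp only: cube_int_at_def a_def B_def)
    have f: "?f x = of_real k1 * (cube_int_at e (\<alpha> 1) (\<alpha> 2) (\<alpha> 3) a lam x0 x / of_real B)" if "x \<in> Rp3 e" for x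
      unfolding f_fun_def k1_def[symmetric] infsumI[OF hs[OF that]] ..
    have q: "q1 e \<alpha> lam x x0 = of_real k1 * of_real (rsq x x0 powr (- a) * 1) * H_sig e lam x x0 a (\<alpha> 1) (\<alpha> 2)
      (\<alpha> 3) (2 * \<alpha> 1) (2 * \<alpha> 2) (2 * \<alpha> 3)" for x
      by (simp add: q1_def Let_def a_def k1_def)
    have sq: "sqrt y powr (- 2 * b) = y powr (- b)" if "0 < y" for y b :: real
      using that by (simp add: powr_half_sqrt[symmetric] powr_powr)
    {
      fix x assume x: "x \<in> Rp3 e" "x \<noteq> x0"
      show "f_term CARD('p) \<alpha> lam (rsq x x0) (rsqk e 1 x x0) (rsqk e 2 x x0) (rsqk e 3 x x0) summable_on UNIV"
        using hs[OF x(1)] by (rule has_sum_imp_summable)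
      have "q1 e \<alpha> lam x x0 = of_real k1 * (of_real (rsq x x0 powr (- a)) * H_sig e lam x x0 a (\<alpha> 1) (\<alpha> 2) (\<alpha> 3)
        (2 * \<alpha> 1) (2 * \<alpha> 2) (2 * \<alpha> 3))"
        unfolding q by simp
      also have "\<dots> = of_real k1 * (of_real (?g x * (rsqk e 1 x x0 powr (- \<alpha> 1) * rsqk e 2 x x0 powr (- \<alpha> 2) *
        rsqk e 3 x x0 powr (- \<alpha> 3) / B)) * cube_int_at e (\<alpha> 1) (\<alpha> 2) (\<alpha> 3) a lam x0 x)"
        unfolding H_sig_eq_cube_int_at[OF c al(1,2,3) a a0 x(1) x0 x(2)] B_def ..
      finally show "q1 e \<alpha> lam x x0 =
             of_real (?g x
               * sqrt (rsqk e 1 x x0) powr (- 2 * \<alpha> 1)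
               * sqrt (rsqk e 2 x x0) powr (- 2 * \<alpha> 2)
               * sqrt (rsqk e 3 x x0) powr (- 2 * \<alpha> 3))
             * ?f x"
        unfolding f[OF x(1)] sq[OF Q(1)[OF i(1) x(1)]] sq[OF Q(1)[OF i(2) x(1)]] sq[OF Q(1)[OF i(3) x(1)]]
        by simp
    }
    have J1: "cube_int (\<alpha> 1) (\<alpha> 2) (\<alpha> 3) a 1 1 1 0 = of_real (Gamma (\<alpha> 1) * Gamma (\<alpha> 2) * Gamma (\<alpha> 3) * Gamma
      ((real CARD('p) - 2) / 2) / Gamma a)"
    proof -
      have "a - \<alpha> 1 - \<alpha> 2 - \<alpha> 3 = (real CARD('p) - 2) / 2" unfolding a by (simp add: field_simps)
      thus ?thesis using cube_int_limit_value[OF al(1,2,3) ba] by (simp only:)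
    qed
    have "(f_term CARD('p) \<alpha> lam 0 (rsqk e 1 x0 x0) (rsqk e 2 x0 x0) (rsqk e 3 x0 x0) has_sum
        cube_int (\<alpha> 1) (\<alpha> 2) (\<alpha> 3) a 1 1 1 0 / of_real B) UNIV"
      using hs[OF x0] by (simp add: cube_int_at_def)
    hence f0: "?fz = of_real k1 * (cube_int (\<alpha> 1) (\<alpha> 2) (\<alpha> 3) a 1 1 1 0 / of_real B)"
      unfolding f_fun_def k1_def[symmetric] by (simp add: infsumI)
    have "k1 * (Gamma (\<alpha> 1) * Gamma (\<alpha> 2) * Gamma (\<alpha> 3) * Gamma ((real CARD('p) - 2) / 2) / Gamma a / B) = L"
    proof -
      have "Gamma (\<alpha> 1) \<noteq> 0" "Gamma (\<alpha> 2) \<noteq> 0" "Gamma (\<alpha> 3) \<noteq> 0" "Gamma a \<noteq> 0"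
        "Gamma (2 * \<alpha> 1) \<noteq> 0" "Gamma (2 * \<alpha> 2) \<noteq> 0" "Gamma (2 * \<alpha> 3) \<noteq> 0"
        by (rule less_imp_neq[THEN not_sym], rule Gamma_real_pos, use al a0 in linarith)+
      thus ?thesis
        unfolding k1_def k_one_def a_def[symmetric] L_def B_def Beta_def mult_2[symmetric]
        by (simp add: divide_simps)
    qed
    thus f0L: "?fz = of_real L" unfolding f0 J1 by (simp only: of_real_mult[symmetric]
      of_real_divide[symmetric])
    have "((\<lambda>x. of_real k1 * (cube_int_at e (\<alpha> 1) (\<alpha> 2) (\<alpha> 3) a lam x0 x / of_real B)) \<longlongrightarrow> ?fz) ?F"
      unfolding f0 using B by (intro tendsto_intros cube_int_at_tendsto c al ba x0) auto
    thus "(?f \<longlongrightarrow> ?fz) ?F"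
      by (rule Lim_transform_eventually) (use eventually_in_punctured[of "Rp3 e" x0] in eventually_elim, rule
        f[symmetric], simp)
    have "k1 > 0"
      unfolding k1_def k_one_def a_def[symmetric] using al a0 by (intro divide_pos_pos mult_pos_pos
        Gamma_real_pos) auto
    hence "complex_of_real k1 \<noteq> 0" by simp
    from order[OF c al(1,2,3) a tendsto_const _ this, of 1]
    show "infinite_of_order (\<lambda>x. q1 e \<alpha> lam x x0) ?g ?F" unfolding q by simp
  qed
  show ?thesis
    using q1 q2 q3 q4 q5 q6 q7 q8 unfolding a_def L_def by blast
qed

end
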